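(* Let $F$ be a non-Archimedean local field of characteristic $0$, let $\underline{G}$ be a reductive algebraic $F$-group and $G=\underline{G}(F)$. Let $\pi\in\mathrm{Rep}(G)$ and let $K\leq G$ be an open compact subgroup. Then for every $0<\epsilon<\epsilon_{\star}(\pi)$, there exists $C=C(\epsilon,K,\pi)>0$ such that for every $\tau\in\mathrm{Irr}(K)$: $$\dim\mathrm{Hom}_{K}\left(\tau,\pi|_{K}\right)<C\left(\dim\tau\right)^{1-\frac{2\epsilon}{1+\epsilon}}.$$
   Context: $\mathrm{Rep}(G)$ is the category of smooth, admissible representations of $G$ of finite length; $\mathrm{Irr}(K)$ is the set of equivalence classes of irreducible (smooth, hence finite-dimensional) representations of $K$. The character $\Theta_\pi$ of $\pi$ is a distribution on $G$ given by a locally integrable function $\theta_\pi$ (Harish-Chandra). For $x\in G$, $\epsilon_\star(\pi;x):=\sup\{s\ge0:\exists\text{ a ball }B\ni x\text{ in }G\text{ such that }\theta_\pi|_B\in L^{1+s}\}$ and $\epsilon_\star(\pi):=\inf_{x\in G}\epsilon_\star(\pi;x)$. *)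

theory Defs
  imports
    "HOL-Analysis.Analysis"
    "HOL-Library.Poly_Mapping"
    "HOL-Library.Function_Algebras"
    "HOL-Algebra.Coset"
    "HOL-Algebra.Algebraic_Closure_Type"
begin

section \<open>Non-Archimedean local fields of characteristic 0\<close>

text \<open>The absolute value is \<open>x \<mapsto> dist x 0\<close>.  A non-Archimedean local field is a field that
  is locally compact for the topology of a nontrivial ultrametric absolute value.\<close>

class nonarch_local_field_char_0 = field_char_0 + metric_space +
  assumes dist_translate: "dist x y = dist (x - y) 0"
    and abs_mult: "dist (x * y) 0 = dist x 0 * dist y 0"
    and ultrametric: "dist x z \<le> max (dist x y) (dist y z)"
    and abs_nontrivial: "\<exists>x. x \<noteq> 0 \<and> dist x 0 \<noteq> 1"
    and locally_compact: "\<exists>r>0. compact {x. dist x 0 \<le> r}"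


section \<open>Reductive algebraic groups over a field of characteristic 0\<close>

text \<open>Algebraic \<open>F\<close>-groups are taken as Zariski closed subgroups of \<open>GL\<^sub>n\<close> over an algebraic
  closure of \<open>F\<close> which are cut out by polynomials over \<open>F\<close> in the matrix entries; since \<open>F\<close> has
  characteristic 0, this is the same as being defined over \<open>F\<close>.\<close>

definition GL :: "('k::field ^ 'n ^ 'n) monoid" where
  "GL = \<lparr>carrier = {A. invertible A}, mult = (**), one = mat 1\<rparr>"

type_synonym ('n, 'k) entry_poly = "('n \<times> 'n \<Rightarrow>\<^sub>0 nat) \<Rightarrow>\<^sub>0 'k"

definition eval_entry_poly ::
    "('f::field \<Rightarrow> 'k::field) \<Rightarrow> ('n::finite, 'f) entry_poly \<Rightarrow> 'k ^ 'n ^ 'n \<Rightarrow> 'k" where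
  "eval_entry_poly \<phi> p A =
     (\<Sum>m \<in> Poly_Mapping.keys p. \<phi> (Poly_Mapping.lookup p m) *
        (\<Prod>(i, j) \<in> Poly_Mapping.keys m. (A $ i $ j) ^ Poly_Mapping.lookup m (i, j)))"

definition zero_locus ::
    "('f::field \<Rightarrow> 'k::field) \<Rightarrow> ('n::finite, 'f) entry_poly set \<Rightarrow> ('k ^ 'n ^ 'n) set" where
  "zero_locus \<phi> P = {A \<in> carrier GL. \<forall>p\<in>P. eval_entry_poly \<phi> p A = 0}"

definition zariski_closed :: "('k::field ^ 'n::finite ^ 'n) set \<Rightarrow> bool" where
  "zariski_closed S \<longleftrightarrow> (\<exists>P. S = zero_locus (\<lambda>c. c) P)"

definition zariski_connected :: "('k::field ^ 'n::finite ^ 'n) set \<Rightarrow> bool" where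
  "zariski_connected S \<longleftrightarrow>
     \<not> (\<exists>A B. zariski_closed A \<and> zariski_closed B \<and> S \<subseteq> A \<union> B \<and>
              A \<inter> B \<inter> S = {} \<and> A \<inter> S \<noteq> {} \<and> B \<inter> S \<noteq> {})"

definition unipotent :: "'k::field ^ 'n::finite ^ 'n \<Rightarrow> bool" where
  "unipotent A \<longleftrightarrow> (\<exists>r. (((**) (A - mat 1)) ^^ r) (mat 1) = 0)"

definition algebraic_F_group :: "('f::field_char_0 alg_closure ^ 'n::finite ^ 'n) set \<Rightarrow> bool" where
  "algebraic_F_group \<G> \<longleftrightarrow> subgroup \<G> GL \<and>
     (\<exists>P :: ('n, 'f) entry_poly set. \<G> = zero_locus to_ac P)"

text \<open>The largest Zariski closed, connected, normal, unipotent subgroup, written as the union of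
  all of them.\<close>

definition unipotent_radical :: "('k::field ^ 'n::finite ^ 'n) set \<Rightarrow> ('k ^ 'n ^ 'n) set" where
  "unipotent_radical \<G> = \<Union> {U. normal U (GL\<lparr>carrier := \<G>\<rparr>) \<and> zariski_closed U \<and>
     zariski_connected U \<and> (\<forall>u\<in>U. unipotent u)}"

text \<open>A reductive group is not required to be connected.\<close>

definition reductive_F_group :: "('f::field_char_0 alg_closure ^ 'n::finite ^ 'n) set \<Rightarrow> bool" where
  "reductive_F_group \<G> \<longleftrightarrow> algebraic_F_group \<G> \<and> unipotent_radical \<G> = {mat 1}"

text \<open>The group \<open>\<G>(F)\<close>; its topology is the one induced from the topology of \<open>F ^ 'n ^ 'n\<close>.\<close>

definition rational_points ::
    "('f::field_char_0 alg_closure ^ 'n::finite ^ 'n) set \<Rightarrow> ('f ^ 'n ^ 'n) monoid" where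
  "rational_points \<G> = GL\<lparr>carrier := {A. (\<chi> i j. to_ac (A $ i $ j)) \<in> \<G>}\<rparr>"


section \<open>Smooth representations\<close>

text \<open>Representations live on a subspace \<open>V\<close> of a complex vector space whose scalar multiplication
  is \<open>s\<close>.  The topology on a group \<open>G\<close> is the subspace topology on its carrier.\<close>

type_synonym 'v cscale = "complex \<Rightarrow> 'v \<Rightarrow> 'v"

definition linear_between ::
    "'v::ab_group_add cscale \<Rightarrow> 'v set \<Rightarrow> 'w::ab_group_add cscale \<Rightarrow> 'w set \<Rightarrow> ('v \<Rightarrow> 'w) \<Rightarrow> bool" where
  "linear_between s V s' W T \<longleftrightarrow> T \<in> V \<rightarrow> W \<and>
     (\<forall>x\<in>V. \<forall>y\<in>V. T (x + y) = T x + T y) \<and> (\<forall>c. \<forall>x\<in>V. T (s c x) = s' c (T x))"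

definition representation ::
    "'g monoid \<Rightarrow> 'v::ab_group_add cscale \<Rightarrow> 'v set \<Rightarrow> ('g \<Rightarrow> 'v \<Rightarrow> 'v) \<Rightarrow> bool" where
  "representation G s V \<pi> \<longleftrightarrow> vector_space s \<and> module.subspace s V \<and>
     (\<forall>g\<in>carrier G. linear_between s V s V (\<pi> g)) \<and>
     (\<forall>v\<in>V. \<pi> \<one>\<^bsub>G\<^esub> v = v) \<and>
     (\<forall>g\<in>carrier G. \<forall>h\<in>carrier G. \<forall>v\<in>V. \<pi> (g \<otimes>\<^bsub>G\<^esub> h) v = \<pi> g (\<pi> h v))"

definition invariant_subspace ::
    "'g monoid \<Rightarrow> 'v::ab_group_add cscale \<Rightarrow> 'v set \<Rightarrow> ('g \<Rightarrow> 'v \<Rightarrow> 'v) \<Rightarrow> 'v set \<Rightarrow> bool" where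
  "invariant_subspace G s V \<pi> W \<longleftrightarrow> module.subspace s W \<and> W \<subseteq> V \<and>
     (\<forall>g\<in>carrier G. \<pi> g ` W \<subseteq> W)"

definition irreducible_rep ::
    "'g monoid \<Rightarrow> 'v::ab_group_add cscale \<Rightarrow> 'v set \<Rightarrow> ('g \<Rightarrow> 'v \<Rightarrow> 'v) \<Rightarrow> bool" where
  "irreducible_rep G s V \<pi> \<longleftrightarrow> V \<noteq> {0} \<and>
     (\<forall>W. invariant_subspace G s V \<pi> W \<longrightarrow> W = {0} \<or> W = V)"

definition smooth_rep ::
    "'g::topological_space monoid \<Rightarrow> 'v::ab_group_add cscale \<Rightarrow> 'v set \<Rightarrow> ('g \<Rightarrow> 'v \<Rightarrow> 'v) \<Rightarrow> bool" where
  "smooth_rep G s V \<pi> \<longleftrightarrow>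
     (\<forall>v\<in>V. openin (top_of_set (carrier G)) {g \<in> carrier G. \<pi> g v = v})"

definition compact_open_subgroup :: "'g::topological_space set \<Rightarrow> 'g monoid \<Rightarrow> bool" where
  "compact_open_subgroup K G \<longleftrightarrow>
     subgroup K G \<and> compact K \<and> openin (top_of_set (carrier G)) K"

definition finite_dim :: "'v::ab_group_add cscale \<Rightarrow> 'v set \<Rightarrow> bool" where
  "finite_dim s V \<longleftrightarrow> (\<exists>B. finite B \<and> V \<subseteq> module.span s B)"

definition admissible_rep ::
    "'g::topological_space monoid \<Rightarrow> 'v::ab_group_add cscale \<Rightarrow> 'v set \<Rightarrow> ('g \<Rightarrow> 'v \<Rightarrow> 'v) \<Rightarrow> bool" where
  "admissible_rep G s V \<pi> \<longleftrightarrow>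
     (\<forall>K. compact_open_subgroup K G \<longrightarrow> finite_dim s {v \<in> V. \<forall>k\<in>K. \<pi> k v = v})"

text \<open>Finite length means that there is a composition series
  \<open>0 = U\<^sub>0 \<subset> U\<^sub>1 \<subset> \<dots> \<subset> U\<^sub>m = V\<close>; simplicity of \<open>U\<^sub>i\<^sub>+\<^sub>1 / U\<^sub>i\<close> says
  that no invariant subspace lies strictly in between.\<close>

definition finite_length_rep ::
    "'g monoid \<Rightarrow> 'v::ab_group_add cscale \<Rightarrow> 'v set \<Rightarrow> ('g \<Rightarrow> 'v \<Rightarrow> 'v) \<Rightarrow> bool" where
  "finite_length_rep G s V \<pi> \<longleftrightarrow> (\<exists>(m::nat) U. U 0 = {0} \<and> U m = V \<and>
     (\<forall>i\<le>m. invariant_subspace G s V \<pi> (U i)) \<and>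
     (\<forall>i<m. U i \<subset> U (Suc i) \<and>
        \<not> (\<exists>W. invariant_subspace G s V \<pi> W \<and> U i \<subset> W \<and> W \<subset> U (Suc i))))"

definition Rep ::
    "'g::topological_space monoid \<Rightarrow> 'v::ab_group_add cscale \<Rightarrow> ('v set \<times> ('g \<Rightarrow> 'v \<Rightarrow> 'v)) set" where
  "Rep G s = {(V, \<pi>). representation G s V \<pi> \<and> smooth_rep G s V \<pi> \<and>
     admissible_rep G s V \<pi> \<and> finite_length_rep G s V \<pi>}"

definition pointwise_scale :: "'v cscale \<Rightarrow> ('x \<Rightarrow> 'v) cscale" where
  "pointwise_scale s = (\<lambda>c f x. s c (f x))"

text \<open>Irreducible smooth representations of a compact group are finite-dimensional, so each
  equivalence class has representatives on subspaces of \<open>nat \<Rightarrow> complex\<close>.  The set below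
  consists of all these representatives.\<close>

definition Irr :: "'g::topological_space monoid \<Rightarrow>
    ((nat \<Rightarrow> complex) set \<times> ('g \<Rightarrow> (nat \<Rightarrow> complex) \<Rightarrow> (nat \<Rightarrow> complex))) set" where
  "Irr K = {(W, \<tau>). representation K (pointwise_scale (*)) W \<tau> \<and>
     smooth_rep K (pointwise_scale (*)) W \<tau> \<and> irreducible_rep K (pointwise_scale (*)) W \<tau>}"

text \<open>Maps are normalised to be 0 outside of \<open>W\<close>, so that each homomorphism on \<open>W\<close> is
  represented exactly once.\<close>

definition Hom_rep ::
    "'g monoid \<Rightarrow> 'w::ab_group_add cscale \<Rightarrow> 'w set \<Rightarrow> ('g \<Rightarrow> 'w \<Rightarrow> 'w) \<Rightarrow>
     'v::ab_group_add cscale \<Rightarrow> 'v set \<Rightarrow> ('g \<Rightarrow> 'v \<Rightarrow> 'v) \<Rightarrow> ('w \<Rightarrow> 'v) set" where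
  "Hom_rep K s' W \<tau> s V \<pi> = {T. linear_between s' W s V T \<and> (\<forall>w. w \<notin> W \<longrightarrow> T w = 0) \<and>
     (\<forall>k\<in>carrier K. \<forall>w\<in>W. T (\<tau> k w) = \<pi> k (T w))}"

text \<open>\<^const>\<open>vector_space.dim\<close> is 0 on infinite-dimensional spaces; here the dimension of such a
  space is infinite.\<close>

definition edim :: "'v::ab_group_add cscale \<Rightarrow> 'v set \<Rightarrow> ereal" where
  "edim s V = (if finite_dim s V then ereal (real (vector_space.dim s V)) else \<infinity>)"


section \<open>Characters and their local integrability exponents\<close>

text \<open>Borel regularity is automatic for the groups at hand, which are locally compact and second
  countable.\<close>

definition haar_measure :: "'g::t2_space monoid \<Rightarrow> 'g measure \<Rightarrow> bool" where
  "haar_measure G \<mu> \<longleftrightarrow> sets \<mu> = sets (restrict_space borel (carrier G)) \<and>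
     (\<forall>C. compact C \<and> C \<subseteq> carrier G \<longrightarrow> emeasure \<mu> C < \<infinity>) \<and>
     (\<forall>U. openin (top_of_set (carrier G)) U \<and> U \<noteq> {} \<longrightarrow> 0 < emeasure \<mu> U) \<and>
     (\<forall>g\<in>carrier G. \<forall>A\<in>sets \<mu>. emeasure \<mu> ((\<lambda>x. g \<otimes>\<^bsub>G\<^esub> x) ` A) = emeasure \<mu> A)"

text \<open>Locally constant functions with compact support.\<close>

definition test_function :: "'g::topological_space monoid \<Rightarrow> ('g \<Rightarrow> complex) \<Rightarrow> bool" where
  "test_function G f \<longleftrightarrow>
     (\<forall>x\<in>carrier G. \<exists>U. openin (top_of_set (carrier G)) U \<and> x \<in> U \<and> (\<forall>y\<in>U. f y = f x)) \<and>
     (\<exists>C. compact C \<and> C \<subseteq> carrier G \<and> (\<forall>x \<in> carrier G - C. f x = 0))"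

text \<open>The operator \<open>\<pi>(f) v = \<integral> f(g) \<pi>(g) v d\<mu>(g)\<close>.  For a test function \<open>f\<close> and a smooth \<open>\<pi>\<close>
  the integrand takes only finitely many values, each nonzero one on a compact open set, and the
  integral is the sum of the values weighted by the measures of their fibres.\<close>

definition hecke_op ::
    "'g measure \<Rightarrow> 'v::ab_group_add cscale \<Rightarrow> ('g \<Rightarrow> 'v \<Rightarrow> 'v) \<Rightarrow> ('g \<Rightarrow> complex) \<Rightarrow> 'v \<Rightarrow> 'v" where
  "hecke_op \<mu> s \<pi> f v =
     (\<Sum>w \<in> (\<lambda>g. s (f g) (\<pi> g v)) ` space \<mu> - {0}.
        s (of_real (measure \<mu> {g \<in> space \<mu>. s (f g) (\<pi> g v) = w})) w)"

text \<open>The trace of an operator of finite rank on \<open>V\<close> is the trace of its restriction to its image.\<close>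

definition finite_rank_trace :: "'v::ab_group_add cscale \<Rightarrow> 'v set \<Rightarrow> ('v \<Rightarrow> 'v) \<Rightarrow> complex" where
  "finite_rank_trace s V T =
     (let B = (SOME B. \<not> module.dependent s B \<and> module.span s B = T ` V)
      in \<Sum>b\<in>B. module.representation s B (T b) b)"

definition character_distribution ::
    "'g measure \<Rightarrow> 'v::ab_group_add cscale \<Rightarrow> 'v set \<Rightarrow> ('g \<Rightarrow> 'v \<Rightarrow> 'v) \<Rightarrow> ('g \<Rightarrow> complex) \<Rightarrow> complex" where
  "character_distribution \<mu> s V \<pi> f = finite_rank_trace s V (hecke_op \<mu> s \<pi> f)"

definition locally_integrable :: "'g::t2_space monoid \<Rightarrow> 'g measure \<Rightarrow> ('g \<Rightarrow> complex) \<Rightarrow> bool" where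
  "locally_integrable G \<mu> \<theta> \<longleftrightarrow> \<theta> \<in> borel_measurable \<mu> \<and>
     (\<forall>C. compact C \<and> C \<subseteq> carrier G \<longrightarrow> set_integrable \<mu> C \<theta>)"

text \<open>\<open>\<theta>\<close> is (a version of) the function \<open>\<theta>\<^sub>\<pi>\<close>; it is determined up to null sets.\<close>

definition character_function ::
    "'g::t2_space monoid \<Rightarrow> 'g measure \<Rightarrow> 'v::ab_group_add cscale \<Rightarrow> 'v set \<Rightarrow> ('g \<Rightarrow> 'v \<Rightarrow> 'v) \<Rightarrow>
     ('g \<Rightarrow> complex) \<Rightarrow> bool" where
  "character_function G \<mu> s V \<pi> \<theta> \<longleftrightarrow> locally_integrable G \<mu> \<theta> \<and>
     (\<forall>f. test_function G f \<longrightarrow> character_distribution \<mu> s V \<pi> f = (\<integral>g. f g * \<theta> g \<partial>\<mu>))"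

definition in_Lp_on :: "'g measure \<Rightarrow> real \<Rightarrow> 'g set \<Rightarrow> ('g \<Rightarrow> complex) \<Rightarrow> bool" where
  "in_Lp_on \<mu> p B \<theta> \<longleftrightarrow> set_borel_measurable \<mu> B \<theta> \<and>
     set_integrable \<mu> B (\<lambda>g. norm (\<theta> g) powr p)"

text \<open>The exponents \<open>\<epsilon>\<^sub>\<star>(\<pi>; x)\<close> and \<open>\<epsilon>\<^sub>\<star>(\<pi>)\<close>, with values in \<open>[0, \<infinity>]\<close>.  Which version of the
  character function is used does not matter, and neither does the choice of \<open>\<mu>\<close>.\<close>

definition eps_star_at ::
    "'g::metric_space monoid \<Rightarrow> 'g measure \<Rightarrow> 'v::ab_group_add cscale \<Rightarrow> 'v set \<Rightarrow> ('g \<Rightarrow> 'v \<Rightarrow> 'v) \<Rightarrow>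
     'g \<Rightarrow> ereal" where
  "eps_star_at G \<mu> s V \<pi> x = Sup {ereal t | t. 0 \<le> t \<and>
     (\<exists>\<theta> y r. character_function G \<mu> s V \<pi> \<theta> \<and> y \<in> carrier G \<and>
        x \<in> ball y r \<and> in_Lp_on \<mu> (1 + t) (ball y r \<inter> carrier G) \<theta>)}"

definition eps_star ::
    "'g::metric_space monoid \<Rightarrow> 'g measure \<Rightarrow> 'v::ab_group_add cscale \<Rightarrow> 'v set \<Rightarrow> ('g \<Rightarrow> 'v \<Rightarrow> 'v) \<Rightarrow>
     ereal" where
  "eps_star G \<mu> s V \<pi> = (INF x \<in> carrier G. eps_star_at G \<mu> s V \<pi> x)"

end

theory Submission
  imports Defs "HOL-Computational_Algebra.Fundamental_Theorem_Algebra"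
begin

text \<open>
  Let \<open>d\<close> be the dimension of an irreducible representation \<open>\<tau>\<close> of \<open>K\<close> with character \<open>\<chi>\<close>, and let
  \<open>m\<close> be its multiplicity in \<open>\<pi>\<close>.  Everything rests on the multiplicity formula
  \<open>vol(K) m = \<integral>\<^sub>K cnj \<chi> \<cdot> \<theta>\<^sub>\<pi>\<close>, which is proved for every finite-dimensional representation \<open>W\<close> of
  \<open>K\<close> on which some open normal subgroup \<open>N\<close> acts trivially
  (\<open>multiplicity_eq_character_distribution\<close>).  Its right-hand side is the trace of the Hecke operator
  of a test function that is invariant under \<open>N\<close>.  This operator maps into the finite-dimensional
  space \<open>V\<^sup>N\<close> of \<open>N\<close>-fixed vectors, and on \<open>V\<^sup>N\<close> it is a sum over the finite group \<open>Q = K / N\<close>.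
  So the formula is the identity \<open>|Q| dim Hom\<^sub>Q(W, U) = \<Sum>\<^sub>q \<chi>\<^sub>W(q\<inverse>) \<chi>\<^sub>U(q)\<close>
  (\<open>dim_Hom_rep_eq_character_average\<close>), that is, the fact that the trace of an idempotent is the
  dimension of its image, applied to averaging over \<open>Q\<close> on the space of linear maps \<open>W \<rightarrow> U\<close>.

  Suppose \<open>\<epsilon> \<le> 1\<close>, and put \<open>q = (1 + \<epsilon>) / \<epsilon> \<ge> 2\<close>, so that the exponent in the bound is
  \<open>\<alpha> = 1 - 2 / q\<close>.  The bounds \<open>|\<chi>| \<le> d\<close> and \<open>\<integral>\<^sub>K |\<chi>|\<^sup>2 \<le> vol(K)\<close> (Schur's lemma) give
  \<open>\<integral>\<^sub>K (|\<chi>| / d\<^sup>\<alpha>)\<^sup>q \<le> vol(K)\<close>, because \<open>\<alpha> q = q - 2\<close>.  Since \<open>\<theta>\<^sub>\<pi>\<close> lies in \<open>L\<^sup>1\<^sup>+\<^sup>\<epsilon>(K)\<close>, and \<open>1 + \<epsilon>\<close>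
  and \<open>q\<close> are conjugate exponents, Young's inequality for \<open>|\<theta>\<^sub>\<pi>|\<close> and \<open>|\<chi>| / d\<^sup>\<alpha>\<close> bounds \<open>m / d\<^sup>\<alpha>\<close>.

  If \<open>\<epsilon> > 1\<close>, then \<open>\<alpha> < 0\<close>, and the bound forces the dimensions of the \<open>\<tau>\<close> that occur in \<open>\<pi>\<close> to be
  bounded.  The reason is that \<open>V\<close> itself is finite-dimensional.  Indeed \<open>\<theta>\<^sub>\<pi>\<close> is now
  square-integrable on \<open>K\<close>, and the multiplicity formula for \<open>W = V\<^sup>N\<close> reads
  \<open>vol(K) dim End\<^sub>K(V\<^sup>N) = \<integral>\<^sub>K cnj \<chi> \<cdot> \<theta>\<^sub>\<pi> \<le> (\<parallel>\<theta>\<^sub>\<pi>\<parallel>\<^sup>2 + \<parallel>\<chi>\<parallel>\<^sup>2) / 2\<close> with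
  \<open>\<parallel>\<chi>\<parallel>\<^sup>2 = vol(K) dim End\<^sub>K(V\<^sup>N)\<close>.  Hence \<open>dim End\<^sub>K(V\<^sup>N)\<close> is at most \<open>\<parallel>\<theta>\<^sub>\<pi>\<parallel>\<^sup>2 / vol(K)\<close> for every
  \<open>N\<close>.  As it grows strictly with \<open>V\<^sup>N\<close>, the spaces \<open>V\<^sup>N\<close> become stationary, and their union is \<open>V\<close>.

  The exponent \<open>\<epsilon>\<^sub>\<star>\<close> gives, around each point of \<open>K\<close>, some version of the character function that
  is in \<open>L\<^sup>1\<^sup>+\<^sup>\<epsilon>\<close> there.  By compactness, finitely many of these versions are glued along clopen sets to
  one function on \<open>K\<close> (\<open>Lp_character_on_K\<close>).  All this takes place in a group with continuous
  translations and a base of clopen sets; in a group of rational points over a non-Archimedean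
  field, such a base is given by the balls of the maximum norm on the matrix entries.
\<close>


section \<open>Traces in coordinates\<close>

definition is_basis :: "'v::ab_group_add cscale \<Rightarrow> 'v set \<Rightarrow> 'v set \<Rightarrow> bool" where
  "is_basis s U B \<longleftrightarrow> finite B \<and> \<not> module.dependent s B \<and> module.span s B = U"

definition basis_trace :: "'v::ab_group_add cscale \<Rightarrow> 'v set \<Rightarrow> ('v \<Rightarrow> 'v) \<Rightarrow> complex" where
  "basis_trace s B A = (\<Sum>b\<in>B. module.representation s B (A b) b)"

lemma linear_betweenD:
  assumes "linear_between s V s' W T"
  shows "x \<in> V \<Longrightarrow> T x \<in> W" "x \<in> V \<Longrightarrow> y \<in> V \<Longrightarrow> T (x + y) = T x + T y"
    "x \<in> V \<Longrightarrow> T (s c x) = s' c (T x)"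
  using assms by (auto simp: linear_between_def)

context
  fixes s :: "complex \<Rightarrow> 'v::ab_group_add \<Rightarrow> 'v"
  assumes vs: "vector_space s"
begin

interpretation vs: vector_space s by (rule vs)

lemma linear_between_zero:
  assumes "linear_between s U s' W T" "vector_space s'" "vs.subspace U"
  shows "T 0 = 0"
proof -
  interpret w: vector_space s' by fact
  have "T (s 0 0) = s' 0 (T 0)"
    using linear_betweenD(3)[OF assms(1)] vs.subspace_0[OF assms(3)] by blast
  then show ?thesis by simp
qed

lemma linear_between_sum:
  assumes "linear_between s U s' W T" "vector_space s'" "vs.subspace U" "\<And>i. i \<in> I \<Longrightarrow> f i \<in> U"
  shows "T (\<Sum>i\<in>I. f i) = (\<Sum>i\<in>I. T (f i))"
  using assms(4)
proof (induction I rule: infinite_finite_induct)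
  case (insert i I)
  then show ?case
    using linear_betweenD(2)[OF assms(1), of "f i" "sum f I"] vs.subspace_sum[OF assms(3), of I f]
    by simp
qed (simp_all add: linear_between_zero[OF assms(1-3)])

lemma is_basisD:
  assumes "is_basis s U B"
  shows "finite B" "vs.independent B" "vs.span B = U" "vs.subspace U" "B \<subseteq> U" "finite_dim s U"
    "vs.dim U = card B"
  using assms vs.span_superset[of B] vs.dim_span_eq_card_independent[of B]
  by (auto simp: is_basis_def finite_dim_def)

lemma is_basis_representation_sum:
  assumes "is_basis s U B" "x \<in> U"
  shows "(\<Sum>b\<in>B. s (vs.representation B x b) b) = x"
  using is_basisD[OF assms(1)] assms(2) by (intro vs.sum_representation_eq) auto

lemma is_basis_representation_lincomb:
  assumes "is_basis s U B" "\<And>i. i \<in> I \<Longrightarrow> x i \<in> U"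
  shows "vs.representation B (\<Sum>i\<in>I. s (c i) (x i)) b = (\<Sum>i\<in>I. c i * vs.representation B (x i) b)"
proof -
  note B = is_basisD[OF assms(1)]
  have x: "x i \<in> vs.span B" if "i \<in> I" for i
    using that assms(2) B(3) by auto
  show ?thesis
    by (subst vs.representation_sum)
      (auto simp: B(2) x vs.span_scale vs.representation_scale intro!: sum.cong)
qed

lemma is_basis_extend:
  assumes "vs.subspace U" "finite_dim s U" "B \<subseteq> U" "vs.independent B"
  shows "\<exists>C. B \<subseteq> C \<and> is_basis s U C"
proof -
  obtain C where C: "B \<subseteq> C" "C \<subseteq> U" "vs.independent C" "U \<subseteq> vs.span C"
    using vs.maximal_independent_subset_extend[OF assms(3,4)] by blast
  obtain F where F: "finite F" "U \<subseteq> vs.span F"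
    using assms(2) by (auto simp: finite_dim_def)
  have "finite C"
    using vs.independent_span_bound[OF F(1) C(3)] C(2) F(2) by blast
  moreover have "vs.span C = U"
    using vs.span_minimal[OF C(2) assms(1)] C(4) by blast
  ultimately show ?thesis using C by (auto simp: is_basis_def)
qed

lemma is_basis_exists:
  assumes "vs.subspace U" "finite_dim s U"
  shows "\<exists>B. is_basis s U B"
  using is_basis_extend[OF assms empty_subsetI vs.independent_empty] by blast

lemma finite_dim_subset: "finite_dim s U \<Longrightarrow> W \<subseteq> U \<Longrightarrow> finite_dim s W"
  by (auto simp: finite_dim_def)

lemma dim_subset_finite_dim:
  assumes "vs.subspace U" "finite_dim s U" "vs.subspace W" "W \<subset> U"
  shows "vs.dim W < vs.dim U"
proof -
  obtain B where B: "is_basis s W B"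
    using is_basis_exists[OF assms(3) finite_dim_subset[OF assms(2)]] assms(4) by blast
  note B' = is_basisD[OF B]
  obtain C where C: "B \<subseteq> C" "is_basis s U C"
    using is_basis_extend[OF assms(1,2) _ B'(2)] B'(5) assms(4) by blast
  have "B \<noteq> C" using B'(3) is_basisD(3)[OF C(2)] assms(4) by auto
  then show ?thesis
    using C(1) is_basisD(1,7)[OF C(2)] B'(7) by (auto intro: psubset_card_mono)
qed

text \<open>Expanding \<open>A b\<close> in \<open>C\<close> and \<open>A c\<close> in \<open>B\<close> turns both traces into the same double sum over
  \<open>B \<times> C\<close>.\<close>

lemma basis_trace_unique:
  assumes B: "is_basis s U B" and C: "is_basis s U C" and A: "linear_between s U s U A"
  shows "basis_trace s B A = basis_trace s C A"
proof -
  note B' = is_basisD[OF B] and C' = is_basisD[OF C]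
  have AU: "A x \<in> U" if "x \<in> U" for x using linear_betweenD(1)[OF A that] .
  let ?r = "vs.representation"
  have AA: "A x = (\<Sum>i\<in>D. s (?r D x i) (A i))" if D: "is_basis s U D" "x \<in> U" for D x
  proof -
    have DU: "i \<in> D \<Longrightarrow> i \<in> U" for i using is_basisD(5)[OF D(1)] by auto
    have "A x = A (\<Sum>i\<in>D. s (?r D x i) i)"
      by (simp add: is_basis_representation_sum[OF D])
    also have "\<dots> = (\<Sum>i\<in>D. A (s (?r D x i) i))"
      using DU by (intro linear_between_sum[OF A vs is_basisD(4)[OF D(1)]])
        (simp add: vs.subspace_scale B'(4))
    also have "\<dots> = (\<Sum>i\<in>D. s (?r D x i) (A i))"
      using DU by (intro sum.cong refl linear_betweenD(3)[OF A]) auto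
    finally show ?thesis .
  qed
  have "basis_trace s B A = (\<Sum>b\<in>B. \<Sum>c\<in>C. ?r C b c * ?r B (A c) b)"
    unfolding basis_trace_def
  proof (intro sum.cong refl)
    fix b assume "b \<in> B"
    then have b: "b \<in> U" using B' by auto
    show "?r B (A b) b = (\<Sum>c\<in>C. ?r C b c * ?r B (A c) b)"
      using AU C'(5) by (subst AA[OF C b]) (auto intro!: is_basis_representation_lincomb[OF B])
  qed
  also have "\<dots> = (\<Sum>c\<in>C. \<Sum>b\<in>B. ?r B (A c) b * ?r C b c)"
    by (subst sum.swap) (simp add: mult.commute)
  also have "\<dots> = basis_trace s C A"
    unfolding basis_trace_def
  proof (intro sum.cong refl)
    fix c assume "c \<in> C"
    then have c: "A c \<in> U" using C' AU by auto
    have "?r C (A c) c = ?r C (\<Sum>b\<in>B. s (?r B (A c) b) b) c"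
      by (simp add: is_basis_representation_sum[OF B c])
    also have "\<dots> = (\<Sum>b\<in>B. ?r B (A c) b * ?r C b c)"
      using B'(5) by (intro is_basis_representation_lincomb[OF C]) auto
    finally show "(\<Sum>b\<in>B. ?r B (A c) b * ?r C b c) = ?r C (A c) c" by simp
  qed
  finally show ?thesis .
qed

text \<open>The trace of an operator on \<open>U\<close> can be computed on any subspace that contains its image: the
  remaining vectors of an extended basis contribute diagonal entries 0.  This connects
  \<^const>\<open>finite_rank_trace\<close>, which uses a basis of the image, with traces on a fixed space \<open>U\<close>.\<close>

lemma basis_trace_range:
  assumes C: "is_basis s U C" and B: "is_basis s I B" "B \<subseteq> C" and A: "A ` U \<subseteq> I"
  shows "basis_trace s C A = basis_trace s B A"
proof -
  note B' = is_basisD[OF B(1)] and C' = is_basisD[OF C]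
  have r: "vs.representation C (A c) = vs.representation B (A c)" if "c \<in> C" for c
    using that A B' C' by (intro vs.representation_extend[OF C'(2) _ B(2)]) auto
  have "basis_trace s C A = (\<Sum>c\<in>C. vs.representation B (A c) c)"
    by (simp add: basis_trace_def r)
  also have "\<dots> = (\<Sum>c\<in>B. vs.representation B (A c) c)"
    using B(2) C'(1) vs.representation_ne_zero by (intro sum.mono_neutral_right) blast+
  finally show ?thesis by (simp add: basis_trace_def)
qed

lemma basis_trace_id:
  assumes "is_basis s U B" "\<And>x. x \<in> U \<Longrightarrow> A x = x"
  shows "basis_trace s B A = of_nat (vs.dim U)"
proof -
  note B' = is_basisD[OF assms(1)]
  have "vs.representation B (A b) b = 1" if "b \<in> B" for b
    using that B'(5) assms(2) by (auto simp: vs.representation_basis[OF B'(2)])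
  then show ?thesis by (simp add: basis_trace_def B'(7))
qed

lemma subspace_image_linear_between:
  assumes A: "linear_between s U s' W A" and s': "vector_space s'" and U: "vs.subspace U"
  shows "module.subspace s' (A ` U)"
proof -
  interpret w: vector_space s' by fact
  show ?thesis
  proof (rule w.subspaceI)
    show "0 \<in> A ` U"
      using linear_between_zero[OF A s' U] vs.subspace_0[OF U] by force
    fix x y assume "x \<in> A ` U" "y \<in> A ` U"
    then show "x + y \<in> A ` U"
      using linear_betweenD(2)[OF A, symmetric] vs.subspace_add[OF U] by auto
  next
    fix c x assume "x \<in> A ` U"
    then show "s' c x \<in> A ` U"
      using linear_betweenD(3)[OF A, symmetric] vs.subspace_scale[OF U] by auto
  qed
qed

text \<open>An idempotent is the identity on its image, and the trace can be computed there.\<close>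

lemma basis_trace_idempotent:
  assumes B: "is_basis s U B" and P: "linear_between s U s U P" "\<And>x. x \<in> U \<Longrightarrow> P (P x) = P x"
  shows "basis_trace s B P = of_nat (vs.dim (P ` U))"
proof -
  note B' = is_basisD[OF B]
  have PU: "P ` U \<subseteq> U" using linear_betweenD(1)[OF P(1)] by auto
  obtain D where D: "is_basis s (P ` U) D"
    using is_basis_exists[OF subspace_image_linear_between[OF P(1) vs B'(4)]
        finite_dim_subset[OF B'(6) PU]] by blast
  obtain C where C: "D \<subseteq> C" "is_basis s U C"
    using is_basis_extend[OF B'(4,6) _ is_basisD(2)[OF D]] is_basisD(5)[OF D] PU by blast
  have "basis_trace s B P = basis_trace s C P"
    by (rule basis_trace_unique[OF B C(2) P(1)])
  also have "\<dots> = basis_trace s D P"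
    by (rule basis_trace_range[OF C(2) D C(1)]) auto
  also have "\<dots> = of_nat (vs.dim (P ` U))"
    by (rule basis_trace_id[OF D]) (use P(2) in auto)
  finally show ?thesis .
qed

lemma basis_trace_lincomb:
  assumes B: "is_basis s U B" and "\<And>i b. i \<in> I \<Longrightarrow> b \<in> U \<Longrightarrow> A i b \<in> U"
    and "\<And>b. b \<in> U \<Longrightarrow> T b = (\<Sum>i\<in>I. s (c i) (A i b))"
  shows "basis_trace s B T = (\<Sum>i\<in>I. c i * basis_trace s B (A i))"
proof -
  have "basis_trace s B T = (\<Sum>b\<in>B. \<Sum>i\<in>I. c i * vs.representation B (A i b) b)"
    unfolding basis_trace_def
  proof (intro sum.cong refl)
    fix b assume "b \<in> B"
    then have b: "b \<in> U" using is_basisD(5)[OF B] by auto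
    show "vs.representation B (T b) b = (\<Sum>i\<in>I. c i * vs.representation B (A i b) b)"
      unfolding assms(3)[OF b] by (rule is_basis_representation_lincomb[OF B]) (rule assms(2)[OF _ b])
  qed
  then show ?thesis
    by (simp add: sum.swap[of _ B] basis_trace_def sum_distrib_left)
qed

text \<open>A family \<open>e\<close> with coordinate functions \<open>c\<close> is a basis, and the trace can be read off from
  the coordinates without mentioning \<open>module.representation\<close>.  This is used for the space of
  linear maps, where the coordinates are the matrix entries.\<close>

lemma basis_trace_indexed:
  assumes I: "finite I" and H: "vs.subspace H" and e: "\<And>i. i \<in> I \<Longrightarrow> e i \<in> H"
    and c: "\<And>x. x \<in> H \<Longrightarrow> x = (\<Sum>i\<in>I. s (c x i) (e i))"
    and uniq: "\<And>a i. (\<Sum>i\<in>I. s (a i) (e i)) = 0 \<Longrightarrow> i \<in> I \<Longrightarrow> a i = 0"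
  shows "is_basis s H (e ` I)"
    and "(\<And>x. x \<in> H \<Longrightarrow> A x \<in> H) \<Longrightarrow> basis_trace s (e ` I) A = (\<Sum>i\<in>I. c (A (e i)) i)"
proof -
  have inj: "inj_on e I"
  proof (rule inj_onI, rule ccontr)
    fix i j assume ij: "i \<in> I" "j \<in> I" "e i = e j" "i \<noteq> j"
    have "(\<Sum>k\<in>I. s (if k = i then 1 else if k = j then -1 else 0) (e k))
        = (\<Sum>k\<in>I. (if k = i then e i else 0) - (if k = j then e j else 0))"
      using ij by (intro sum.cong) auto
    also have "\<dots> = 0" using ij I by (simp add: sum_subtractf)
    finally show False using uniq[of "\<lambda>k. if k = i then 1 else if k = j then -1 else 0" i] ij by simp
  qed
  have sp: "vs.span (e ` I) = H"
  proof (rule vs.span_subspace)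
    show "e ` I \<subseteq> H" using e by auto
    show "H \<subseteq> vs.span (e ` I)"
    proof
      fix x assume "x \<in> H"
      have "(\<Sum>i\<in>I. s (c x i) (e i)) \<in> vs.span (e ` I)"
        by (intro vs.span_sum vs.span_scale vs.span_base) simp
      then show "x \<in> vs.span (e ` I)"
        by (subst c[OF \<open>x \<in> H\<close>])
    qed
  qed fact
  have ind: "vs.independent (e ` I)"
  proof
    assume "vs.dependent (e ` I)"
    then obtain u v where u: "v \<in> e ` I" "u v \<noteq> 0" "(\<Sum>v\<in>e ` I. s (u v) v) = 0"
      using vs.dependent_finite[of "e ` I"] I by auto
    obtain i where i: "i \<in> I" "v = e i" using u by auto
    have "(\<Sum>i\<in>I. s (u (e i)) (e i)) = 0"
      using u(3) by (simp add: sum.reindex[OF inj])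
    from uniq[OF this i(1)] u i show False by simp
  qed
  show basis: "is_basis s H (e ` I)"
    using I ind sp by (simp add: is_basis_def)
  show "basis_trace s (e ` I) A = (\<Sum>i\<in>I. c (A (e i)) i)" if A: "\<And>x. x \<in> H \<Longrightarrow> A x \<in> H"
  proof -
    have "vs.representation (e ` I) (A (e i)) (e i) = c (A (e i)) i" if i: "i \<in> I" for i
    proof -
      have x: "A (e i) \<in> H" (is "?x \<in> H") using e A i by auto
      have "vs.representation (e ` I) ?x (e i)
          = (\<Sum>j\<in>I. c ?x j * vs.representation (e ` I) (e j) (e i))"
        by (subst c[OF x], rule is_basis_representation_lincomb[OF basis]) (rule e)
      also have "\<dots> = (\<Sum>j\<in>I. c ?x j * (if j = i then 1 else 0))"
        using i inj by (intro sum.cong refl) (auto simp: vs.representation_basis[OF ind] inj_on_eq_iff)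
      also have "\<dots> = c ?x i" using I i by (simp add: if_distrib cong: if_cong)
      finally show ?thesis .
    qed
    then show ?thesis by (simp add: basis_trace_def sum.reindex[OF inj])
  qed
qed

end


section \<open>Representations of finite groups\<close>

lemma (in group) sum_left_translate:
  assumes "g \<in> carrier G"
  shows "(\<Sum>x\<in>carrier G. f (g \<otimes> x)) = (\<Sum>x\<in>carrier G. f x)"
  by (rule sum.reindex_bij_witness[of _ "\<lambda>x. inv g \<otimes> x" "\<lambda>x. g \<otimes> x"])
    (auto simp: assms m_assoc[symmetric])

lemma representationD:
  assumes "representation G s V \<pi>"
  shows "vector_space s" "module.subspace s V" "g \<in> carrier G \<Longrightarrow> linear_between s V s V (\<pi> g)"
    "v \<in> V \<Longrightarrow> \<pi> \<one>\<^bsub>G\<^esub> v = v"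
    "g \<in> carrier G \<Longrightarrow> h \<in> carrier G \<Longrightarrow> v \<in> V \<Longrightarrow> \<pi> (g \<otimes>\<^bsub>G\<^esub> h) v = \<pi> g (\<pi> h v)"
    "g \<in> carrier G \<Longrightarrow> v \<in> V \<Longrightarrow> \<pi> g v \<in> V"
  using assms by (auto simp: representation_def linear_between_def)

lemma vector_space_pointwise_scale:
  assumes "vector_space s"
  shows "vector_space (pointwise_scale s)"
proof -
  interpret vector_space s by fact
  show ?thesis
    by unfold_locales (auto simp: pointwise_scale_def fun_eq_iff scale_right_distrib scale_left_distrib)
qed

text \<open>The maps vanish outside \<open>W\<close>, in accordance with \<^const>\<open>Hom_rep\<close>, so that
  \<^const>\<open>Hom_rep\<close> is a subspace.\<close>

definition linear_maps ::
    "'w::ab_group_add cscale \<Rightarrow> 'w set \<Rightarrow> 'v::ab_group_add cscale \<Rightarrow> 'v set \<Rightarrow> ('w \<Rightarrow> 'v) set" where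
  "linear_maps s' W s U = {T. linear_between s' W s U T \<and> (\<forall>w. w \<notin> W \<longrightarrow> T w = 0)}"

lemma sum_fun_apply: "(\<Sum>i\<in>I. f i) x = (\<Sum>i\<in>I. f i x)"
  by (induction I rule: infinite_finite_induct) auto

lemma subspace_linear_maps:
  assumes s: "vector_space s" and s': "vector_space s'" and U: "module.subspace s U"
  shows "module.subspace (pointwise_scale s) (linear_maps s' W s U)"
proof -
  interpret s: vector_space s by fact
  interpret s': vector_space s' by fact
  interpret p: vector_space "pointwise_scale s" by (rule vector_space_pointwise_scale[OF s])
  show ?thesis
    by (rule p.subspaceI)
      (auto simp: linear_maps_def linear_between_def pointwise_scale_def Pi_iff s.scale_right_distrib
        mult.commute s.subspace_0[OF U] s.subspace_add[OF U] s.subspace_scale[OF U])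
qed

lemma subspace_Hom_rep:
  assumes s: "vector_space s" and s': "vector_space s'" and U: "module.subspace s U"
    and rho: "\<And>k. k \<in> carrier K \<Longrightarrow> linear_between s U s U (\<rho> k)"
    and tau: "\<And>k w. k \<in> carrier K \<Longrightarrow> w \<in> W \<Longrightarrow> \<tau> k w \<in> W"
  shows "module.subspace (pointwise_scale s) (Hom_rep K s' W \<tau> s U \<rho>)"
proof -
  interpret s: vector_space s by fact
  interpret s': vector_space s' by fact
  interpret p: vector_space "pointwise_scale s" by (rule vector_space_pointwise_scale[OF s])
  have L: "p.subspace (linear_maps s' W s U)" by (rule subspace_linear_maps[OF s s' U])
  have H: "Hom_rep K s' W \<tau> s U \<rho> =
      {T \<in> linear_maps s' W s U. \<forall>k\<in>carrier K. \<forall>w\<in>W. T (\<tau> k w) = \<rho> k (T w)}"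
    by (auto simp: Hom_rep_def linear_maps_def)
  have r: "\<rho> k 0 = 0" if "k \<in> carrier K" for k
    by (rule linear_between_zero[OF s rho[OF that] s U])
  show ?thesis
    unfolding H using p.subspace_0[OF L] p.subspace_add[OF L] p.subspace_scale[OF L]
    by (intro p.subspaceI)
      (auto simp: r pointwise_scale_def linear_betweenD(2,3)[OF rho] linear_maps_def linear_betweenD(1) tau)
qed

context
  fixes s :: "complex \<Rightarrow> 'v::ab_group_add \<Rightarrow> 'v" and s' :: "complex \<Rightarrow> 'w::ab_group_add \<Rightarrow> 'w"
    and U :: "'v set" and W :: "'w set" and D B
  assumes s: "vector_space s" and s': "vector_space s'"
    and D: "is_basis s U D" and B: "is_basis s' W B"
begin

interpretation s: vector_space s by (rule s)
interpretation s': vector_space s' by (rule s')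
interpretation p: vector_space "pointwise_scale s" by (rule vector_space_pointwise_scale[OF s])

text \<open>The matrix unit that sends the basis vector \<open>w\<close> to \<open>b\<close> and the other basis vectors to 0.  It
  vanishes outside \<open>W\<close> because \<open>module.representation\<close> is 0 outside the span of the basis.\<close>

definition elementary_map :: "'w \<times> 'v \<Rightarrow> 'w \<Rightarrow> 'v" where
  "elementary_map = (\<lambda>(w, b) x. s (s'.representation B x w) b)"

text \<open>The coordinate of \<open>T\<close> at the matrix unit \<open>(w, b)\<close> is its matrix entry, the \<open>b\<close>-coordinate of
  \<open>T w\<close>.\<close>

lemma elementary_maps_basis:
  shows "is_basis (pointwise_scale s) (linear_maps s' W s U) (elementary_map ` (B \<times> D))"
    and "(\<And>T. T \<in> linear_maps s' W s U \<Longrightarrow> P T \<in> linear_maps s' W s U) \<Longrightarrow>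
      basis_trace (pointwise_scale s) (elementary_map ` (B \<times> D)) P =
      (\<Sum>(w, b)\<in>B \<times> D. s.representation D (P (elementary_map (w, b)) w) b)"
    and "w \<in> B \<Longrightarrow> b \<in> D \<Longrightarrow> elementary_map (w, b) \<in> linear_maps s' W s U"
proof -
  note D' = is_basisD[OF s D] and B' = is_basisD[OF s' B]
  have out: "s'.representation B x w = 0" if "x \<notin> W" for x w
    using that by (simp add: s'.representation_def B'(3))
  have mem: "elementary_map i \<in> linear_maps s' W s U" if iBD: "i \<in> B \<times> D" for i
  proof -
    obtain w b where i: "i = (w, b)" "w \<in> B" "b \<in> D" using iBD by auto
    have "b \<in> U" using i D'(5) by auto
    then show ?thesis
      by (auto simp: i elementary_map_def linear_maps_def linear_between_def s.subspace_scale[OF D'(4)]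
          s'.representation_add[OF B'(2)] s'.representation_scale[OF B'(2)] B'(3) s.scale_left_distrib out)
  qed
  have dec: "T = (\<Sum>i\<in>B \<times> D. pointwise_scale s
      ((\<lambda>(w, b). s.representation D (T w) b) i) (elementary_map i))"
    if T: "T \<in> linear_maps s' W s U" for T
  proof
    fix x
    have lin: "linear_between s' W s U T" using T by (auto simp: linear_maps_def)
    have BW: "w \<in> B \<Longrightarrow> w \<in> W" for w using B'(5) by auto
    have "(\<Sum>i\<in>B \<times> D. pointwise_scale s
      ((\<lambda>(w, b). s.representation D (T w) b) i) (elementary_map i)) x
      = (\<Sum>(w, b)\<in>B \<times> D. s (s.representation D (T w) b) (s (s'.representation B x w) b))"
      by (auto simp: sum_fun_apply pointwise_scale_def elementary_map_def intro!: sum.cong)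
    also have "\<dots> = (\<Sum>w\<in>B. \<Sum>b\<in>D. s (s'.representation B x w) (s (s.representation D (T w) b) b))"
      by (simp add: sum.cartesian_product[symmetric] mult.commute)
    also have "\<dots> = (\<Sum>w\<in>B. s (s'.representation B x w) (T w))"
      using BW linear_betweenD(1)[OF lin]
      by (intro sum.cong refl)
        (simp add: s.scale_sum_right[symmetric] is_basis_representation_sum[OF s D] del: s.scale_scale)
    also have "\<dots> = T x"
    proof (cases "x \<in> W")
      case True
      have "T x = T (\<Sum>w\<in>B. s' (s'.representation B x w) w)"
        by (simp add: is_basis_representation_sum[OF s' B True])
      also have "\<dots> = (\<Sum>w\<in>B. T (s' (s'.representation B x w) w))"
        using BW by (intro linear_between_sum[OF s' lin s B'(4)]) (simp add: s'.subspace_scale[OF B'(4)])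
      finally show ?thesis using BW linear_betweenD(3)[OF lin] by simp
    next
      case False
      then show ?thesis using T by (simp add: linear_maps_def s'.representation_def B'(3))
    qed
    finally show "T x = (\<Sum>i\<in>B \<times> D. pointwise_scale s
      ((\<lambda>(w, b). s.representation D (T w) b) i) (elementary_map i)) x" by simp
  qed
  have uniq: "a i = 0"
    if a: "(\<Sum>i\<in>B \<times> D. pointwise_scale s (a i) (elementary_map i)) = 0" and i: "i \<in> B \<times> D" for a i
  proof -
    obtain w b where wb: "i = (w, b)" "w \<in> B" "b \<in> D" using i by auto
    have "0 = (\<Sum>i\<in>B \<times> D. pointwise_scale s (a i) (elementary_map i)) w"
      using a by simp
    also have "\<dots> = (\<Sum>w'\<in>B. \<Sum>b\<in>D. s (a (w', b)) (s (if w' = w then 1 else 0) b))"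
      by (simp add: sum_fun_apply pointwise_scale_def elementary_map_def sum.cartesian_product
          s'.representation_basis[OF B'(2) wb(2)] split_def)
    also have "\<dots> = (\<Sum>w'\<in>B. if w' = w then \<Sum>b\<in>D. s (a (w', b)) b else 0)"
      by (intro sum.cong refl) auto
    also have "\<dots> = (\<Sum>b\<in>D. s (a (w, b)) b)" using B'(1) wb(2) by simp
    finally show ?thesis
      using s.independentD[OF D'(2,1) subset_refl, of "\<lambda>b. a (w, b)" b] wb by simp
  qed
  note idx = basis_trace_indexed[where s = "pointwise_scale s" and I = "B \<times> D" and H = "linear_maps s' W s U" and e = elementary_map
      and c = "\<lambda>T (w, b). s.representation D (T w) b",
      OF vector_space_pointwise_scale[OF s] _ subspace_linear_maps[OF s s' D'(4)] mem dec]
  show "is_basis (pointwise_scale s) (linear_maps s' W s U) (elementary_map ` (B \<times> D))"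
    by (rule idx(1)) (use D'(1) B'(1) in simp, assumption, assumption, erule (1) uniq)
  show "basis_trace (pointwise_scale s) (elementary_map ` (B \<times> D)) P =
      (\<Sum>(w, b)\<in>B \<times> D. s.representation D (P (elementary_map (w, b)) w) b)"
    if "\<And>T. T \<in> linear_maps s' W s U \<Longrightarrow> P T \<in> linear_maps s' W s U"
  proof -
    have "basis_trace (pointwise_scale s) (elementary_map ` (B \<times> D)) P =
        (\<Sum>i\<in>B \<times> D. (\<lambda>(w, b). s.representation D (P (elementary_map i) w) b) i)"
      by (rule idx(2)) (use D'(1) B'(1) in simp, assumption, assumption, erule (1) uniq, erule that)
    then show ?thesis by (simp add: split_def)
  qed
  show "w \<in> B \<Longrightarrow> b \<in> D \<Longrightarrow> elementary_map (w, b) \<in> linear_maps s' W s U"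
    using mem by auto
qed

text \<open>Averaging \<open>T \<mapsto> \<rho> q \<circ> T \<circ> \<tau> q\<inverse>\<close> over \<open>Q\<close> is an idempotent on the space of linear maps
  \<open>W \<rightarrow> U\<close> whose image is the space of intertwining maps, so its trace is the dimension of that space.
  In the basis of matrix units, the trace of \<open>T \<mapsto> \<rho> q \<circ> T \<circ> \<tau> q\<inverse>\<close> is the product of the traces of
  \<open>\<tau> q\<inverse>\<close> and \<open>\<rho> q\<close>.\<close>

lemma dim_Hom_rep_eq_character_average:
  fixes Q :: "'q monoid"
  assumes Q: "group Q" "finite (carrier Q)"
    and tau: "representation Q s' W \<tau>" and rho: "representation Q s U \<rho>"
  shows "finite_dim (pointwise_scale s) (Hom_rep Q s' W \<tau> s U \<rho>)"
    and "of_nat (card (carrier Q)) * of_nat (p.dim (Hom_rep Q s' W \<tau> s U \<rho>)) =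
      (\<Sum>q\<in>carrier Q. basis_trace s' B (\<tau> (inv\<^bsub>Q\<^esub> q)) * basis_trace s D (\<rho> q))"
proof -
  interpret Q: group Q by fact
  note D' = is_basisD[OF s D] and B' = is_basisD[OF s' B]
  note tau' = representationD[OF tau] and rho' = representationD[OF rho]
  let ?L = "linear_maps s' W s U" and ?H = "Hom_rep Q s' W \<tau> s U \<rho>"
  let ?n = "of_nat (card (carrier Q)) :: complex"
  have n: "?n \<noteq> 0" using Q.one_closed Q(2) by auto
  have LU: "T x \<in> U" if "T \<in> ?L" "x \<in> W" for T x
    using that linear_betweenD(1) by (auto simp: linear_maps_def)
  define P where "P T x = (if x \<in> W
      then s (1 / ?n) (\<Sum>q\<in>carrier Q. \<rho> q (T (\<tau> (inv\<^bsub>Q\<^esub> q) x))) else 0)" for T x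
  have PL: "P T \<in> ?L" if T: "T \<in> ?L" for T
  proof -
    have lin: "linear_between s' W s U T" using T by (auto simp: linear_maps_def)
    show ?thesis
      unfolding linear_maps_def linear_between_def
      by (auto simp: P_def s'.subspace_add[OF B'(4)] s'.subspace_scale[OF B'(4)] tau'(6) rho'(6) Q.inv_closed
          linear_betweenD[OF lin] linear_betweenD(2,3)[OF tau'(3)] linear_betweenD(2,3)[OF rho'(3)]
          sum.distrib s.scale_right_distrib s.scale_sum_right[symmetric] mult.commute
          intro!: s.subspace_scale[OF D'(4)] s.subspace_sum[OF D'(4)])
  qed
  have Pq: "P T (\<tau> k x) = \<rho> k (P T x)" if T: "T \<in> ?L" and k: "k \<in> carrier Q" and x: "x \<in> W" for T k x
  proof -
    have t: "\<tau> q x \<in> W" if "q \<in> carrier Q" for q using tau'(6) x that by auto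
    have "(\<Sum>q\<in>carrier Q. \<rho> q (T (\<tau> (inv\<^bsub>Q\<^esub> q) (\<tau> k x)))) =
          (\<Sum>q\<in>carrier Q. \<rho> (k \<otimes>\<^bsub>Q\<^esub> q) (T (\<tau> (inv\<^bsub>Q\<^esub> (k \<otimes>\<^bsub>Q\<^esub> q)) (\<tau> k x))))"
      by (rule Q.sum_left_translate[OF k, symmetric])
    also have "\<dots> = (\<Sum>q\<in>carrier Q. \<rho> k (\<rho> q (T (\<tau> (inv\<^bsub>Q\<^esub> q) x))))"
    proof (intro sum.cong refl)
      fix q assume q: "q \<in> carrier Q"
      have "\<tau> (inv\<^bsub>Q\<^esub> (k \<otimes>\<^bsub>Q\<^esub> q)) (\<tau> k x) = \<tau> (inv\<^bsub>Q\<^esub> q) x"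
        using q k x by (subst tau'(5)[symmetric]) (auto simp: Q.inv_mult_group Q.m_assoc)
      then show "\<rho> (k \<otimes>\<^bsub>Q\<^esub> q) (T (\<tau> (inv\<^bsub>Q\<^esub> (k \<otimes>\<^bsub>Q\<^esub> q)) (\<tau> k x))) = \<rho> k (\<rho> q (T (\<tau> (inv\<^bsub>Q\<^esub> q) x)))"
        using q k LU[OF T t[of "inv\<^bsub>Q\<^esub> q"]] by (simp add: rho'(5))
    qed
    also have "\<dots> = \<rho> k (\<Sum>q\<in>carrier Q. \<rho> q (T (\<tau> (inv\<^bsub>Q\<^esub> q) x)))"
      using k by (intro linear_between_sum[OF s rho'(3)[OF k] s D'(4), symmetric])
        (auto intro!: rho'(6) LU[OF T] t)
    finally show ?thesis
      using x k tau'(6)[OF k x]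
      by (simp add: P_def, subst linear_betweenD(3)[OF rho'(3)[OF k]])
        (auto intro!: s.subspace_sum[OF D'(4)] rho'(6) LU[OF T] t)
  qed
  have HL: "T \<in> ?H \<longleftrightarrow> T \<in> ?L \<and> (\<forall>k\<in>carrier Q. \<forall>w\<in>W. T (\<tau> k w) = \<rho> k (T w))" for T
    by (auto simp: Hom_rep_def linear_maps_def)
  have PH: "P T \<in> ?H" if "T \<in> ?L" for T using PL Pq that by (auto simp: HL)
  have Pid: "P T = T" if T: "T \<in> ?H" for T
  proof
    fix x
    have "\<rho> q (T (\<tau> (inv\<^bsub>Q\<^esub> q) x)) = T x" if "x \<in> W" "q \<in> carrier Q" for q
    proof -
      have "\<rho> q (T (\<tau> (inv\<^bsub>Q\<^esub> q) x)) = \<rho> q (\<rho> (inv\<^bsub>Q\<^esub> q) (T x))" using T that by (simp add: HL)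
      also have "\<dots> = \<rho> (q \<otimes>\<^bsub>Q\<^esub> inv\<^bsub>Q\<^esub> q) (T x)"
        using that T by (intro rho'(5)[symmetric]) (auto simp: HL LU)
      also have "\<dots> = T x" using that T LU by (simp add: rho'(4) HL)
      finally show ?thesis .
    qed
    then show "P T x = T x"
      using T n by (cases "x \<in> W") (auto simp: P_def s.sum_constant_scale HL linear_maps_def)
  qed
  have img: "P ` ?L = ?H"
    using PH Pid by (force simp: HL image_iff)
  let ?E = "elementary_map ` (B \<times> D)"
  have E: "is_basis (pointwise_scale s) ?L ?E" by (rule elementary_maps_basis)
  note E' = is_basisD[OF vector_space_pointwise_scale[OF s] E]
  have linP: "linear_between (pointwise_scale s) ?L (pointwise_scale s) ?L P"
    unfolding linear_between_def
  proof (intro conjI ballI allI)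
    show "P \<in> ?L \<rightarrow> ?L" using PL by auto
    fix S T assume S: "S \<in> ?L" and T: "T \<in> ?L"
    show "P (S + T) = P S + P T"
      by (auto simp: P_def fun_eq_iff linear_betweenD(2)[OF rho'(3)] LU[OF S] LU[OF T] tau'(6)
          sum.distrib s.scale_right_distrib)
  next
    fix c S assume S: "S \<in> ?L"
    show "P (pointwise_scale s c S) = pointwise_scale s c (P S)"
      by (auto simp: P_def fun_eq_iff pointwise_scale_def linear_betweenD(3)[OF rho'(3)] LU[OF S] tau'(6)
          s.scale_sum_right[symmetric] mult.commute)
  qed
  show "finite_dim (pointwise_scale s) ?H"
    by (rule finite_dim_subset[OF vector_space_pointwise_scale[OF s] E'(6)]) (simp add: HL subset_iff)
  have "of_nat (p.dim ?H) = basis_trace (pointwise_scale s) ?E P"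
    using basis_trace_idempotent[OF vector_space_pointwise_scale[OF s] E linP] PH Pid img by simp
  also have "\<dots> = (\<Sum>(w, b)\<in>B \<times> D. s.representation D (P (elementary_map (w, b)) w) b)"
    using PL by (rule elementary_maps_basis)
  also have "\<dots> = (\<Sum>(w, b)\<in>B \<times> D. (1 / ?n) * (\<Sum>q\<in>carrier Q.
      s'.representation B (\<tau> (inv\<^bsub>Q\<^esub> q) w) w * s.representation D (\<rho> q b) b))"
  proof (intro sum.cong refl, clarsimp)
    fix w b assume wb: "w \<in> B" "b \<in> D"
    have wb': "w \<in> W" "b \<in> U" using wb D'(5) B'(5) by auto
    have "P (elementary_map (w, b)) w =
        s (1 / ?n) (\<Sum>q\<in>carrier Q. s (s'.representation B (\<tau> (inv\<^bsub>Q\<^esub> q) w) w) (\<rho> q b))"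
      using wb' by (simp add: P_def elementary_map_def linear_betweenD(3)[OF rho'(3)])
    also have "\<dots> = (\<Sum>q\<in>carrier Q. s (1 / ?n * s'.representation B (\<tau> (inv\<^bsub>Q\<^esub> q) w) w) (\<rho> q b))"
      by (simp add: s.scale_sum_right)
    also have "s.representation D \<dots> b = (\<Sum>q\<in>carrier Q.
        (1 / ?n * s'.representation B (\<tau> (inv\<^bsub>Q\<^esub> q) w) w) * s.representation D (\<rho> q b) b)"
      by (rule is_basis_representation_lincomb[OF s D]) (simp add: rho'(6) wb')
    finally show "s.representation D (P (elementary_map (w, b)) w) b =
      (\<Sum>q\<in>carrier Q. s'.representation B (\<tau> (inv\<^bsub>Q\<^esub> q) w) w * s.representation D (\<rho> q b) b) / ?n"
      by (simp add: sum_divide_distrib)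
  qed
  also have "\<dots> = (1 / ?n) * (\<Sum>q\<in>carrier Q. \<Sum>(w, b)\<in>B \<times> D.
      s'.representation B (\<tau> (inv\<^bsub>Q\<^esub> q) w) w * s.representation D (\<rho> q b) b)"
    by (subst sum.swap) (simp add: sum_distrib_left split_def)
  also have "\<dots> = (1 / ?n) * (\<Sum>q\<in>carrier Q. basis_trace s' B (\<tau> (inv\<^bsub>Q\<^esub> q)) * basis_trace s D (\<rho> q))"
    by (simp add: basis_trace_def sum_product sum.cartesian_product)
  finally show "?n * of_nat (p.dim ?H) =
      (\<Sum>q\<in>carrier Q. basis_trace s' B (\<tau> (inv\<^bsub>Q\<^esub> q)) * basis_trace s D (\<rho> q))"
    using n by simp
qed

end


section \<open>Values of characters and Schur's lemma\<close>

lemma sum_power_root_of_unity: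
  fixes r :: complex
  assumes "r ^ m = 1" "r \<noteq> 1"
  shows "(\<Sum>j<m. r ^ j) = 0"
  using assms geometric_sum[of r m] by simp

lemma cis_fraction_power:
  assumes "m > 0"
  shows "cis (2 * pi * real j / real m) ^ m = 1"
proof -
  have "cis (2 * pi * real j / real m) ^ m = cis (2 * pi * real j)"
    using assms by (simp only: Complex.DeMoivre) simp
  also have "\<dots> = 1" by (rule cis_multiple_2pi) simp
  finally show ?thesis .
qed

text \<open>An operator \<open>A\<close> of finite order \<open>m\<close> acts on \<open>U\<close> with \<open>m\<close>-th roots of unity as eigenvalues,
  and \<open>d j\<close> is the dimension of the eigenspace for the \<open>j\<close>-th root \<open>z j\<close>.  This dimension is the trace of
  the idempotent \<open>P j = (1 / m) \<Sum>\<^sub>k z j\<^sup>-\<^sup>k A\<^sup>k\<close>, and orthogonality of the powers of the roots inverts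
  this discrete Fourier transform.\<close>

lemma spectral_trace_formula:
  assumes s: "vector_space s" and B: "is_basis s U B" and A: "linear_between s U s U A"
    and m: "m > 0" and Am: "\<And>x. x \<in> U \<Longrightarrow> (A ^^ m) x = x"
  shows "\<exists>d :: nat \<Rightarrow> nat. \<forall>k<m. basis_trace s B (A ^^ k) =
    (\<Sum>j<m. cis (2 * pi * real j / real m) ^ k * of_nat (d j))"
proof -
  interpret s: vector_space s by fact
  note B' = is_basisD[OF s B]
  define z where "z j = cis (2 * pi * real j / real m)" for j
  have zm: "z j ^ m = 1" for j
    using cis_fraction_power[OF m] by (simp add: z_def)
  have zc: "z j * cnj (z j) = 1" for j
    by (simp add: z_def cis_cnj cis_mult)
  have orth: "(\<Sum>j<m. z j ^ k * cnj (z j) ^ i) = (if i = k then of_nat m else 0)"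
    if ik: "i < m" "k < m" for i k
  proof (cases "i = k")
    case True
    then show ?thesis by (simp add: power_mult_distrib[symmetric] zc)
  next
    case False
    define r where "r = cis (2 * pi * (real k - real i) / real m)"
    have zr: "z j ^ k * cnj (z j) ^ i = r ^ j" for j
    proof -
      have "real k * (2 * pi * real j / real m) + real i * - (2 * pi * real j / real m)
          = real j * (2 * pi * (real k - real i) / real m)"
        by (simp add: algebra_simps diff_divide_distrib)
      then show ?thesis
        by (simp only: z_def r_def Complex.DeMoivre cis_cnj cis_mult)
    qed
    have "r ^ m = cis (2 * pi * (real k - real i))"
      using m by (simp add: r_def Complex.DeMoivre)
    also have "\<dots> = cis (2 * pi * of_int (int k - int i))" by simp
    also have "\<dots> = 1" by (rule cis_multiple_2pi) auto
    finally have "r ^ m = 1" .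
    moreover have "r \<noteq> 1"
    proof
      assume "r = 1"
      then have "cos (2 * pi * (real k - real i) / real m) = 1"
        by (metis r_def cis.sel(1) one_complex.sel(1))
      then obtain n :: int where n: "2 * pi * (real k - real i) / real m = real_of_int n * 2 * pi"
        by (auto simp: cos_one_2pi_int)
      then have "(2 * pi) * (real k - real i) = (2 * pi) * (real_of_int n * real m)"
        using m by (simp add: field_simps)
      then have "real k - real i = real_of_int n * real m"
        by (simp only: mult_cancel_left) simp
      then have "real_of_int (int k - int i) = real_of_int (n * int m)" by simp
      then have kn: "int k - int i = n * int m" by (simp only: of_int_eq_iff)
      have "\<bar>int k - int i\<bar> < int m" using ik by auto
      then have "\<bar>n\<bar> * int m < 1 * int m" by (simp add: kn abs_mult)
      then have "n = 0" using m by (simp add: mult_less_cancel_right)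
      then show False using kn False by simp
    qed
    ultimately show ?thesis
      using False by (simp add: zr sum_power_root_of_unity)
  qed
  have Ak: "(A ^^ k) x \<in> U" if "x \<in> U" for k x
    using that linear_betweenD(1)[OF A] by (induction k) auto
  have Alin: "linear_between s U s U (A ^^ k)" for k
  proof (induction k)
    case 0
    then show ?case by (auto simp: linear_between_def)
  next
    case (Suc k)
    then show ?case
      using A by (auto simp: linear_between_def Pi_iff)
  qed
  define P where "P j x = (\<Sum>k<m. s (cnj (z j) ^ k / of_nat m) ((A ^^ k) x))" for j x
  have PU: "P j x \<in> U" if "x \<in> U" for j x
    using that by (auto simp: P_def intro!: s.subspace_sum[OF B'(4)] s.subspace_scale[OF B'(4)] Ak)
  have Plin: "linear_between s U s U (P j)" for j
    using PU by (auto simp: linear_between_def P_def linear_betweenD(2,3)[OF Alin] s.scale_right_distrib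
        sum.distrib s.scale_sum_right mult.commute)
  have AP: "A (P j x) = s (z j) (P j x)" if x: "x \<in> U" for j x
  proof -
    let ?f = "\<lambda>k. s (z j * cnj (z j) ^ k / of_nat m) ((A ^^ k) x)"
    have "A (P j x) = (\<Sum>k<m. A (s (cnj (z j) ^ k / of_nat m) ((A ^^ k) x)))"
      unfolding P_def by (rule linear_between_sum[OF s A s B'(4)])
        (auto intro!: s.subspace_scale[OF B'(4)] Ak x)
    also have "\<dots> = (\<Sum>k<m. ?f (Suc k))"
    proof (intro sum.cong refl)
      fix k
      have "z j * cnj (z j) ^ Suc k = cnj (z j) ^ k"
        using zc[of j] by (simp add: mult.assoc[symmetric])
      then show "A (s (cnj (z j) ^ k / of_nat m) ((A ^^ k) x)) = ?f (Suc k)"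
        using linear_betweenD(3)[OF A Ak[OF x]] by simp
    qed
    also have "\<dots> = (\<Sum>k<Suc m. ?f k) - ?f 0" by (simp only: sum.lessThan_Suc_shift) simp
    also have "\<dots> = (\<Sum>k<m. ?f k) + (?f m - ?f 0)" by simp
    also have "?f m = ?f 0"
      using zm[of j] by (simp add: Am[OF x] flip: complex_cnj_power)
    also have "(\<Sum>k<m. ?f k) + (?f 0 - ?f 0) = s (z j) (P j x)"
      by (simp add: P_def s.scale_sum_right)
    finally show ?thesis .
  qed
  have APk: "(A ^^ k) (P j x) = s (z j ^ k) (P j x)" if x: "x \<in> U" for j x k
  proof (induction k)
    case (Suc k)
    then show ?case
      using linear_betweenD(3)[OF A PU[OF x]] AP[OF x] by (simp add: mult.commute)
  qed simp
  have idem: "P j (P j x) = P j x" if x: "x \<in> U" for j x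
  proof -
    have one: "cnj (z j) ^ k * z j ^ k = 1" for k
      using zc[of j] by (simp add: power_mult_distrib[symmetric] mult.commute)
    have "P j (P j x) = (\<Sum>k<m. s (1 / of_nat m) (P j x))"
      unfolding P_def[of j "P j x"]
    proof (intro sum.cong refl)
      fix k
      have "s (cnj (z j) ^ k / of_nat m) (s (z j ^ k) (P j x)) = s ((cnj (z j) ^ k * z j ^ k) / of_nat m) (P j x)"
        by simp
      then show "s (cnj (z j) ^ k / of_nat m) ((A ^^ k) (P j x)) = s (1 / of_nat m) (P j x)"
        by (simp only: APk[OF x] one)
    qed
    then show ?thesis using m by (simp add: s.sum_constant_scale)
  qed
  have tr: "basis_trace s B (P j) = of_nat (s.dim (P j ` U))" for j
    by (rule basis_trace_idempotent[OF s B Plin idem])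
  have "basis_trace s B (A ^^ k) = (\<Sum>j<m. z j ^ k * of_nat (s.dim (P j ` U)))" if k: "k < m" for k
  proof -
    have "(\<Sum>j<m. z j ^ k * of_nat (s.dim (P j ` U)))
        = (\<Sum>j<m. z j ^ k * (\<Sum>i<m. cnj (z j) ^ i / of_nat m * basis_trace s B (A ^^ i)))"
      unfolding tr[symmetric]
      by (intro sum.cong refl arg_cong2[where f = "(*)"] basis_trace_lincomb[OF s B])
        (auto simp: Ak P_def)
    also have "\<dots> = (\<Sum>i<m. (\<Sum>j<m. z j ^ k * cnj (z j) ^ i) / of_nat m * basis_trace s B (A ^^ i))"
    proof -
      have "(\<Sum>j<m. z j ^ k * (\<Sum>i<m. cnj (z j) ^ i / of_nat m * basis_trace s B (A ^^ i)))
          = (\<Sum>j<m. \<Sum>i<m. z j ^ k * cnj (z j) ^ i / of_nat m * basis_trace s B (A ^^ i))"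
        by (simp add: sum_distrib_left mult.assoc)
      also have "\<dots> = (\<Sum>i<m. \<Sum>j<m. z j ^ k * cnj (z j) ^ i / of_nat m * basis_trace s B (A ^^ i))"
        by (rule sum.swap)
      finally show ?thesis by (simp only: sum_distrib_right sum_divide_distrib)
    qed
    also have "\<dots> = (\<Sum>i<m. if i = k then basis_trace s B (A ^^ i) else 0)"
      using k m by (intro sum.cong refl) (auto simp: orth)
    also have "\<dots> = basis_trace s B (A ^^ k)" using k by simp
    finally show ?thesis ..
  qed
  then show ?thesis
    unfolding z_def[symmetric] by (intro exI[of _ "\<lambda>j. s.dim (P j ` U)"] allI impI)
qed

text \<open>Both claims follow from the eigenvalues of \<open>\<rho> q\<close>: they are roots of unity, and their
  multiplicities add up to the dimension.  This takes the place of an invariant inner product.\<close>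

lemma
  assumes Q: "group Q" "finite (carrier Q)" and rho: "representation Q s U \<rho>"
    and B: "is_basis s U B" and q: "q \<in> carrier Q"
  shows norm_character_le: "cmod (basis_trace s B (\<rho> q)) \<le> real (vector_space.dim s U)"
    and character_inv: "basis_trace s B (\<rho> (inv\<^bsub>Q\<^esub> q)) = cnj (basis_trace s B (\<rho> q))"
proof -
  interpret Q: group Q by fact
  note rho' = representationD[OF rho]
  interpret s: vector_space s by (rule rho'(1))
  note B' = is_basisD[OF rho'(1) B]
  \<comment> \<open>Twice the order makes \<open>m > 1\<close>, so that \<open>q\<close> itself is among the powers below \<open>m\<close>.\<close>
  define m where "m = 2 * card (carrier Q)"
  have "card (carrier Q) > 0" using Q.one_closed Q(2) card_gt_0_iff by blast
  then have m: "m > 1" by (simp add: m_def)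
  have qm: "q [^]\<^bsub>Q\<^esub> m = \<one>\<^bsub>Q\<^esub>"
    using Q.pow_order_eq_1[OF q] q by (simp add: m_def order_def mult.commute flip: Q.nat_pow_pow)
  have pw: "(\<rho> q ^^ k) x = \<rho> (q [^]\<^bsub>Q\<^esub> k) x" if "x \<in> U" for k x
  proof (induction k)
    case 0
    then show ?case by (simp add: rho'(4) that)
  next
    case (Suc k)
    have "\<rho> (q [^]\<^bsub>Q\<^esub> Suc k) x = \<rho> (q \<otimes>\<^bsub>Q\<^esub> q [^]\<^bsub>Q\<^esub> k) x"
      using Q.nat_pow_Suc2[OF q] by simp
    then show ?case using q that Suc by (simp add: rho'(5) del: Group.nat_pow_Suc)
  qed
  have tr: "basis_trace s B (\<rho> q ^^ k) = basis_trace s B (\<rho> (q [^]\<^bsub>Q\<^esub> k))" for k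
    using B'(5) by (auto simp: basis_trace_def pw intro!: sum.cong)
  obtain d :: "nat \<Rightarrow> nat" where d: "\<And>k. k < m \<Longrightarrow> basis_trace s B (\<rho> (q [^]\<^bsub>Q\<^esub> k)) =
      (\<Sum>j<m. cis (2 * pi * real j / real m) ^ k * of_nat (d j))"
    using spectral_trace_formula[OF rho'(1) B rho'(3)[OF q], of m] m qm
    by (auto simp: pw rho'(4) tr)
  have tr1: "basis_trace s B (\<rho> q) = (\<Sum>j<m. cis (2 * pi * real j / real m) * of_nat (d j))"
    using d[of 1] m q by simp
  have "of_nat (s.dim U) = basis_trace s B (\<rho> \<one>\<^bsub>Q\<^esub>)"
    by (subst basis_trace_id[OF rho'(1) B]) (auto simp: rho'(4))
  also have "\<dots> = of_nat (\<Sum>j<m. d j)" using d[of 0] m by simp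
  finally have dim: "s.dim U = (\<Sum>j<m. d j)" by (simp only: of_nat_eq_iff)
  have "cmod (basis_trace s B (\<rho> q)) \<le> (\<Sum>j<m. cmod (cis (2 * pi * real j / real m) * of_nat (d j)))"
    unfolding tr1 by (rule norm_sum)
  then show "cmod (basis_trace s B (\<rho> q)) \<le> real (s.dim U)"
    by (simp add: dim norm_mult)
  have "q [^]\<^bsub>Q\<^esub> (m - 1) \<otimes>\<^bsub>Q\<^esub> q = \<one>\<^bsub>Q\<^esub>"
    using qm m by (simp flip: Group.nat_pow_Suc)
  then have inv: "inv\<^bsub>Q\<^esub> q = q [^]\<^bsub>Q\<^esub> (m - 1)"
    using q by (intro Q.inv_equality) auto
  have "cis (2 * pi * real j / real m) ^ (m - 1) = cnj (cis (2 * pi * real j / real m))" for j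
  proof -
    let ?z = "cis (2 * pi * real j / real m)"
    have "?z ^ (m - 1) * ?z = 1"
      using m cis_fraction_power[of m j] by (simp flip: power_Suc2)
    then have "?z ^ (m - 1) * (?z * cnj ?z) = cnj ?z" by (simp only: mult.assoc[symmetric] mult_1)
    moreover have "?z * cnj ?z = 1" by (simp add: cis_cnj cis_mult)
    ultimately show ?thesis by simp
  qed
  then show "basis_trace s B (\<rho> (inv\<^bsub>Q\<^esub> q)) = cnj (basis_trace s B (\<rho> q))"
    using m by (simp add: inv d tr1)
qed

text \<open>The vectors \<open>A\<^sup>i w\<close> are linearly dependent, so \<open>p(A) w = 0\<close> for some polynomial \<open>p \<noteq> 0\<close>.
  Split off linear factors \<open>X - z\<close> from \<open>p\<close> until the remaining factor \<open>q\<close> satisfies \<open>q(A) w \<noteq> 0\<close>.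
  Then \<open>q(A) w\<close> is an eigenvector.\<close>

lemma eigenvector_exists:
  assumes s: "vector_space s" and U: "module.subspace s U" "finite_dim s U"
    and A: "linear_between s U s U A" and w: "w \<in> U" "w \<noteq> 0"
  shows "\<exists>z v. v \<in> U \<and> v \<noteq> 0 \<and> A v = s z v"
proof -
  interpret s: vector_space s by fact
  have Ak: "(A ^^ k) x \<in> U" if "x \<in> U" for k x
    using that linear_betweenD(1)[OF A] by (induction k) auto
  \<comment> \<open>\<open>E p x\<close> is \<open>p(A) x\<close>.\<close>
  define E where "E p x = (\<Sum>i\<le>Polynomial.degree p. s (Polynomial.coeff p i) ((A ^^ i) x))" for p x
  have E_bound: "E p x = (\<Sum>i\<le>n. s (Polynomial.coeff p i) ((A ^^ i) x))" if "Polynomial.degree p \<le> n" for p x n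
    unfolding E_def using that
    by (intro sum.mono_neutral_left) (auto simp: coeff_eq_0)
  have EU: "E p x \<in> U" if "x \<in> U" for p x
    using that by (auto simp: E_def intro!: s.subspace_sum[OF U(1)] s.subspace_scale[OF U(1)] Ak)
  have E_mult: "E ([:- z, 1:] * q) x = A (E q x) - s z (E q x)" if x: "x \<in> U" for q x z
  proof -
    let ?n = "Polynomial.degree q"
    have deg: "Polynomial.degree ([:- z, 1:] * q) \<le> Suc ?n"
      by (rule order_trans[OF degree_mult_le]) auto
    have co: "Polynomial.coeff ([:- z, 1:] * q) i = (if i = 0 then 0 else Polynomial.coeff q (i - 1)) - z * Polynomial.coeff q i" for i
      by (cases i) auto
    have "E ([:- z, 1:] * q) x = (\<Sum>i\<le>Suc ?n. s (if i = 0 then 0 else Polynomial.coeff q (i - 1)) ((A ^^ i) x))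
        - (\<Sum>i\<le>Suc ?n. s (z * Polynomial.coeff q i) ((A ^^ i) x))"
      by (simp only: E_bound[OF deg] co s.scale_left_diff_distrib sum_subtractf)
    also have "(\<Sum>i\<le>Suc ?n. s (if i = 0 then 0 else Polynomial.coeff q (i - 1)) ((A ^^ i) x))
        = (\<Sum>i\<le>?n. s (Polynomial.coeff q i) (A ((A ^^ i) x)))"
      by (subst sum.atMost_Suc_shift) simp
    also have "\<dots> = (\<Sum>i\<le>?n. A (s (Polynomial.coeff q i) ((A ^^ i) x)))"
      by (simp add: linear_betweenD(3)[OF A Ak[OF x]])
    also have "\<dots> = A (E q x)"
      unfolding E_def
      by (intro linear_between_sum[OF s A s U(1), symmetric] s.subspace_scale[OF U(1)] Ak x)
    also have "(\<Sum>i\<le>Suc ?n. s (z * Polynomial.coeff q i) ((A ^^ i) x)) = s z (E q x)"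
      by (simp add: E_def s.scale_sum_right coeff_eq_0)
    finally show ?thesis .
  qed
  have main: "\<exists>z v. v \<in> U \<and> v \<noteq> 0 \<and> A v = s z v" if "p \<noteq> 0" "E p w = 0" for p
    using that
  proof (induction "Polynomial.degree p" arbitrary: p)
    case 0
    then have "Polynomial.coeff p 0 \<noteq> 0" using leading_coeff_0_iff[of p] by simp
    then show ?case using 0 w by (simp add: E_def)
  next
    case (Suc n)
    then have "\<not> constant (poly p)" by (simp add: constant_degree)
    then obtain z where "poly p z = 0" using fundamental_theorem_of_algebra by blast
    then obtain q where q: "p = [:- z, 1:] * q" by (metis poly_eq_0_iff_dvd dvdE)
    have q0: "q \<noteq> 0" using q Suc by auto
    then have "Polynomial.degree p = Suc (Polynomial.degree q)" unfolding q by (subst degree_mult_eq) auto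
    then have dq: "n = Polynomial.degree q" using Suc by simp
    show ?case
    proof (cases "E q w = 0")
      case True
      then show ?thesis using Suc(1)[OF dq q0] by blast
    next
      case False
      have "A (E q w) = s z (E q w)" using E_mult[OF w(1), of z q] Suc(4) q by simp
      then show ?thesis using False EU[OF w(1)] by blast
    qed
  qed
  obtain F where F: "finite F" "U \<subseteq> s.span F" using U(2) by (auto simp: finite_dim_def)
  let ?a = "\<lambda>i. (A ^^ i) w" and ?n = "card F"
  have "\<exists>u :: nat \<Rightarrow> complex. (\<exists>i\<le>?n. u i \<noteq> 0) \<and> (\<Sum>i\<le>?n. s (u i) (?a i)) = 0"
  proof (cases "inj_on ?a {..?n}")
    case True
    have "s.dependent (?a ` {..?n})"
    proof (rule ccontr)
      assume "\<not> s.dependent (?a ` {..?n})"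
      then have "card (?a ` {..?n}) \<le> card F"
        using s.independent_span_bound[OF F(1)] F(2) Ak[OF w(1)] by blast
      then show False by (simp add: card_image[OF True])
    qed
    then obtain u where u: "\<exists>v\<in>?a ` {..?n}. u v \<noteq> 0" "(\<Sum>v\<in>?a ` {..?n}. s (u v) v) = 0"
      using s.dependent_finite[of "?a ` {..?n}"] by auto
    then show ?thesis
      by (intro exI[of _ "\<lambda>i. u (?a i)"]) (auto simp: sum.reindex[OF True])
  next
    case False
    then obtain i j where ij: "i \<le> ?n" "j \<le> ?n" "i \<noteq> j" "?a i = ?a j"
      by (auto simp: inj_on_def)
    have "(\<Sum>k\<le>?n. s (if k = i then 1 else if k = j then -1 else 0) (?a k))
        = (\<Sum>k\<le>?n. (if k = i then ?a i else 0) - (if k = j then ?a j else 0))"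
      using ij by (intro sum.cong) auto
    also have "\<dots> = 0" using ij by (simp add: sum_subtractf)
    finally show ?thesis
      using ij by (intro exI[of _ "\<lambda>k. if k = i then 1 else if k = j then -1 else 0"]) auto
  qed
  then obtain u :: "nat \<Rightarrow> complex" and i0
    where u: "i0 \<le> ?n" "u i0 \<noteq> 0" "(\<Sum>i\<le>?n. s (u i) (?a i)) = 0" by blast
  define p where "p = (\<Sum>i\<le>?n. Polynomial.monom (u i) i)"
  have cp: "Polynomial.coeff p i = (if i \<le> ?n then u i else 0)" for i
    by (simp add: p_def coeff_sum)
  have "Polynomial.degree p \<le> ?n" by (rule degree_le) (auto simp: cp)
  then have "E p w = 0" using u(3) by (simp add: E_bound cp)
  moreover have "p \<noteq> 0" using cp[of i0] u by auto
  ultimately show ?thesis using main by blast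
qed

text \<open>Schur's lemma: the eigenspace of an intertwining operator is an invariant subspace.\<close>

lemma dim_Hom_rep_irreducible:
  assumes rho: "representation Q s W \<rho>" "irreducible_rep Q s W \<rho>" and W: "finite_dim s W"
  shows "vector_space.dim (pointwise_scale s) (Hom_rep Q s W \<rho> s W \<rho>) \<le> 1"
proof -
  note rho' = representationD[OF rho(1)]
  interpret s: vector_space s by (rule rho'(1))
  interpret p: vector_space "pointwise_scale s" by (rule vector_space_pointwise_scale[OF rho'(1)])
  obtain w where w: "w \<in> W" "w \<noteq> 0"
    using rho(2) s.subspace_0[OF rho'(2)] by (auto simp: irreducible_rep_def)
  define J where "J x = (if x \<in> W then x else 0)" for x
  have "T \<in> p.span {J}" if T: "T \<in> Hom_rep Q s W \<rho> s W \<rho>" for T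
  proof -
    have lin: "linear_between s W s W T" and out: "\<And>x. x \<notin> W \<Longrightarrow> T x = 0"
      and eq: "\<And>k x. k \<in> carrier Q \<Longrightarrow> x \<in> W \<Longrightarrow> T (\<rho> k x) = \<rho> k (T x)"
      using T by (auto simp: Hom_rep_def)
    obtain z v where v: "v \<in> W" "v \<noteq> 0" "T v = s z v"
      using eigenvector_exists[OF rho'(1,2) W lin w] by blast
    let ?E = "{x \<in> W. T x = s z x}"
    have T0: "T 0 = 0" by (rule linear_between_zero[OF rho'(1) lin rho'(1,2)])
    have "invariant_subspace Q s W \<rho> ?E"
      unfolding invariant_subspace_def
    proof (intro conjI ballI)
      show "s.subspace ?E"
        by (rule s.subspaceI)
          (auto simp: T0 s.subspace_0[OF rho'(2)] s.subspace_add[OF rho'(2)] s.subspace_scale[OF rho'(2)]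
            linear_betweenD(2,3)[OF lin] s.scale_right_distrib mult.commute)
    qed (auto simp: rho'(6) eq linear_betweenD(3)[OF rho'(3)])
    then have "?E = W"
      using rho(2) v by (auto simp: irreducible_rep_def)
    then have "T = pointwise_scale s z J"
      using out by (auto simp: pointwise_scale_def J_def fun_eq_iff)
    then show ?thesis by (simp add: p.span_scale p.span_base)
  qed
  then show ?thesis using p.dim_le_card[of "Hom_rep Q s W \<rho> s W \<rho>" "{J}"] by auto
qed


section \<open>Representations of finite quotients\<close>

text \<open>A coset acts through an arbitrarily chosen representative; for a subgroup that acts trivially
  the choice does not matter (\<open>quotient_rep_coset\<close> below).\<close>

definition quotient_rep :: "('g \<Rightarrow> 'v \<Rightarrow> 'v) \<Rightarrow> 'g set \<Rightarrow> 'v \<Rightarrow> 'v" where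
  "quotient_rep \<pi> c = \<pi> (SOME k. k \<in> c)"

locale finite_quotient = normal H G for H :: "'g set" and G :: "'g monoid" (structure) +
  assumes finite_cosets: "finite (carrier (G Mod H))"
begin

lemma coset_rep:
  assumes "c \<in> carrier (G Mod H)"
  shows "(SOME k. k \<in> c) \<in> carrier G" "H #> (SOME k. k \<in> c) = c" "(SOME k. k \<in> c) \<in> c"
proof -
  obtain k where k: "k \<in> carrier G" "c = H #> k"
    using assms by (auto simp: carrier_FactGroup)
  have "k \<in> c" using rcos_self[OF k(1)] subgroup_axioms k(2) by simp
  then show kc: "(SOME k. k \<in> c) \<in> c" by (rule someI)
  show "(SOME k. k \<in> c) \<in> carrier G"
    using kc k r_coset_subset_G[OF subset] by auto
  show "H #> (SOME k. k \<in> c) = c"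
    using kc k repr_independence[OF _ k(1) subgroup_axioms] by simp
qed

lemma coset_invariant_value:
  assumes "\<And>n k. n \<in> H \<Longrightarrow> k \<in> carrier G \<Longrightarrow> f (n \<otimes> k) = f k" and k: "k \<in> carrier G"
  shows "f (SOME x. x \<in> H #> k) = f k"
proof -
  have "H #> k \<in> carrier (G Mod H)" using k by (auto simp: carrier_FactGroup)
  from coset_rep(3)[OF this] obtain n where "n \<in> H" "(SOME x. x \<in> H #> k) = n \<otimes> k"
    by (auto simp: r_coset_def)
  then show ?thesis using assms by simp
qed

context
  fixes s :: "complex \<Rightarrow> 'v::ab_group_add \<Rightarrow> 'v" and U \<rho>
  assumes rep: "Defs.representation G s U \<rho>" and triv: "\<forall>n\<in>H. \<forall>u\<in>U. \<rho> n u = u"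
begin

lemma quotient_rep_coset:
  assumes "k \<in> carrier G" "u \<in> U"
  shows "quotient_rep \<rho> (H #> k) u = \<rho> k u"
  unfolding quotient_rep_def
  by (rule coset_invariant_value[of "\<lambda>k. \<rho> k u"])
    (use assms in \<open>auto simp: representationD(5,6)[OF rep] triv mem_carrier\<close>)

lemma representation_quotient: "Defs.representation (G Mod H) s U (quotient_rep \<rho>)"
  unfolding Defs.representation_def
proof (intro conjI ballI)
  note rep' = representationD[OF rep]
  show "vector_space s" "module.subspace s U" by (fact rep')+
  show "linear_between s U s U (quotient_rep \<rho> c)" if "c \<in> carrier (G Mod H)" for c
    unfolding quotient_rep_def by (rule rep'(3)[OF coset_rep(1)[OF that]])
  show "quotient_rep \<rho> \<one>\<^bsub>G Mod H\<^esub> u = u" if "u \<in> U" for u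
    using quotient_rep_coset[OF one_closed that] rep'(4)[OF that]
    by (simp add: coset_mult_one subset)
  fix c d u assume c: "c \<in> carrier (G Mod H)" and d: "d \<in> carrier (G Mod H)" and u: "u \<in> U"
  obtain x y where xy: "x \<in> carrier G" "c = H #> x" "y \<in> carrier G" "d = H #> y"
    using c d by (auto simp: carrier_FactGroup)
  show "quotient_rep \<rho> (c \<otimes>\<^bsub>G Mod H\<^esub> d) u = quotient_rep \<rho> c (quotient_rep \<rho> d u)"
    using xy u by (simp add: rcos_sum quotient_rep_coset rep'(5,6))
qed

lemma norm_character_le_dim:
  assumes B: "is_basis s U B" and k: "k \<in> carrier G"
  shows "cmod (basis_trace s B (\<rho> k)) \<le> real (vector_space.dim s U)"
proof -
  have c: "H #> k \<in> carrier (G Mod H)" using k by (auto simp: carrier_FactGroup)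
  have "basis_trace s B (quotient_rep \<rho> (H #> k)) = basis_trace s B (\<rho> k)"
    using is_basisD(5)[OF representationD(1)[OF rep] B] k
    by (auto simp: basis_trace_def quotient_rep_coset intro!: sum.cong)
  then show ?thesis
    using norm_character_le[OF factorgroup_is_group finite_cosets representation_quotient B c] by simp
qed

end

text \<open>This is \<open>dim_Hom_rep_eq_character_average\<close> for the finite quotient, whose intertwining maps
  are those of \<open>G\<close>.\<close>

lemma dim_Hom_rep_eq_coset_sum:
  assumes rep: "Defs.representation G s U \<rho>" and triv: "\<forall>n\<in>H. \<forall>u\<in>U. \<rho> n u = u"
    and rep': "Defs.representation G s' W \<tau>" and triv': "\<forall>n\<in>H. \<forall>u\<in>W. \<tau> n u = u"
    and D: "is_basis s U D" and B: "is_basis s' W B"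
  shows "finite_dim (pointwise_scale s) (Hom_rep G s' W \<tau> s U \<rho>)"
    and "of_nat (card (carrier (G Mod H))) *
        of_nat (vector_space.dim (pointwise_scale s) (Hom_rep G s' W \<tau> s U \<rho>)) =
      (\<Sum>c\<in>carrier (G Mod H). cnj (basis_trace s' B (\<tau> (SOME k. k \<in> c))) *
        basis_trace s D (\<rho> (SOME k. k \<in> c)))"
proof -
  have "T (quotient_rep \<tau> c w) = quotient_rep \<rho> c (T w)"
    if "\<forall>k\<in>carrier G. \<forall>w\<in>W. T (\<tau> k w) = \<rho> k (T w)" "c \<in> carrier (G Mod H)" "w \<in> W" for T c w
    using that coset_rep(1)[OF that(2)] by (simp add: quotient_rep_def)
  moreover have "T (\<tau> k w) = \<rho> k (T w)"
    if "\<forall>c\<in>carrier (G Mod H). \<forall>w\<in>W. T (quotient_rep \<tau> c w) = quotient_rep \<rho> c (T w)"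
      "k \<in> carrier G" "w \<in> W" "linear_between s' W s U T" for T k w
  proof -
    have "H #> k \<in> carrier (G Mod H)" using that by (auto simp: carrier_FactGroup)
    then have "T (quotient_rep \<tau> (H #> k) w) = quotient_rep \<rho> (H #> k) (T w)" using that by blast
    then show ?thesis
      using that linear_betweenD(1)[OF that(4,3)]
      by (simp add: quotient_rep_coset[OF rep triv] quotient_rep_coset[OF rep' triv'])
  qed
  ultimately have eq: "Hom_rep G s' W \<tau> s U \<rho> =
      Hom_rep (G Mod H) s' W (quotient_rep \<tau>) s U (quotient_rep \<rho>)"
    unfolding Hom_rep_def by blast
  note q = representation_quotient[OF rep triv] and q' = representation_quotient[OF rep' triv']
  note main = dim_Hom_rep_eq_character_average[OF representationD(1)[OF rep] representationD(1)[OF rep']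
      D B factorgroup_is_group finite_cosets q' q]
  show "finite_dim (pointwise_scale s) (Hom_rep G s' W \<tau> s U \<rho>)"
    unfolding eq by (rule main(1))
  show "of_nat (card (carrier (G Mod H))) *
        of_nat (vector_space.dim (pointwise_scale s) (Hom_rep G s' W \<tau> s U \<rho>)) =
      (\<Sum>c\<in>carrier (G Mod H). cnj (basis_trace s' B (\<tau> (SOME k. k \<in> c))) *
        basis_trace s D (\<rho> (SOME k. k \<in> c)))"
    unfolding eq
    by (rule trans[OF main(2)], intro sum.cong refl)
      (simp add: character_inv[OF factorgroup_is_group finite_cosets q' B] quotient_rep_def[symmetric])
qed

text \<open>Exchanging the two representations conjugates the character sum, and the sum is a real
  number.\<close>

lemma dim_Hom_rep_symmetric:
  assumes rep: "Defs.representation G s U \<rho>" and triv: "\<forall>n\<in>H. \<forall>u\<in>U. \<rho> n u = u"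
    and rep': "Defs.representation G s' W \<tau>" and triv': "\<forall>n\<in>H. \<forall>u\<in>W. \<tau> n u = u"
    and fin: "finite_dim s U" "finite_dim s' W"
  shows "vector_space.dim (pointwise_scale s) (Hom_rep G s' W \<tau> s U \<rho>) =
    vector_space.dim (pointwise_scale s') (Hom_rep G s U \<rho> s' W \<tau>)"
proof -
  obtain D B where D: "is_basis s U D" and B: "is_basis s' W B"
    using is_basis_exists[OF representationD(1,2)[OF rep] fin(1)]
      is_basis_exists[OF representationD(1,2)[OF rep'] fin(2)] by blast
  let ?n = "card (carrier (G Mod H))"
  have n: "?n > 0" using finite_cosets one_closed by (auto simp: card_gt_0_iff carrier_FactGroup)
  have "of_nat ?n * complex_of_nat (vector_space.dim (pointwise_scale s) (Hom_rep G s' W \<tau> s U \<rho>)) =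
      cnj (of_nat ?n * of_nat (vector_space.dim (pointwise_scale s') (Hom_rep G s U \<rho> s' W \<tau>)))"
    unfolding dim_Hom_rep_eq_coset_sum(2)[OF rep triv rep' triv' D B]
      dim_Hom_rep_eq_coset_sum(2)[OF rep' triv' rep triv B D]
    by (simp add: mult.commute)
  then have "complex_of_nat (?n * vector_space.dim (pointwise_scale s) (Hom_rep G s' W \<tau> s U \<rho>)) =
      complex_of_nat (?n * vector_space.dim (pointwise_scale s') (Hom_rep G s U \<rho> s' W \<tau>))"
    by simp
  then show ?thesis using n by (simp only: of_nat_eq_iff) simp
qed

end


section \<open>Open normal subgroups of compact open subgroups\<close>

locale zero_dim_group = group G for G :: "'g::metric_space monoid" (structure) +
  assumes continuous_left: "g \<in> carrier G \<Longrightarrow> continuous_on (carrier G) (\<lambda>x. g \<otimes> x)"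
    and continuous_right: "g \<in> carrier G \<Longrightarrow> continuous_on (carrier G) (\<lambda>x. x \<otimes> g)"
    and clopen_base: "x \<in> carrier G \<Longrightarrow> open O' \<Longrightarrow> x \<in> O' \<Longrightarrow>
      \<exists>S. open S \<and> closed S \<and> x \<in> S \<and> S \<subseteq> O'"

locale compact_open = zero_dim_group G for G :: "'g::metric_space monoid" (structure) +
  fixes K :: "'g set"
  assumes K: "compact_open_subgroup K G"
begin

abbreviation "GK \<equiv> G\<lparr>carrier := K\<rparr>"
abbreviation "openG \<equiv> openin (top_of_set (carrier G))"

lemma K_subgroup: "subgroup K G" and K_compact: "compact K" and K_open: "openG K"
  using K by (auto simp: compact_open_subgroup_def)

lemma K_subset: "K \<subseteq> carrier G" by (rule subgroup.subset[OF K_subgroup])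

lemma GK_group: "group GK"
  by (rule subgroup.subgroup_is_group[OF K_subgroup is_group])

sublocale GK: group GK by (rule GK_group)

lemma GK_inv: "k \<in> K \<Longrightarrow> inv\<^bsub>GK\<^esub> k = inv k"
  by (simp add: m_inv_consistent K_subgroup)

definition open_normal :: "'g set \<Rightarrow> bool" where
  "open_normal N \<longleftrightarrow> N \<lhd> GK \<and> openG N"

lemma open_preimage:
  assumes "continuous_on (carrier G) f" "f ` carrier G \<subseteq> carrier G" "openG S"
  shows "openG {x \<in> carrier G. f x \<in> S}"
proof -
  have "openG (carrier G \<inter> f -` S)"
    by (rule continuous_openin_preimage[OF assms(1) _ assms(3)]) (use assms(2) in auto)
  then show ?thesis by (simp add: Int_def vimage_def)
qed

lemma open_right_coset:
  assumes "openG S" "g \<in> carrier G"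
  shows "openG (S #> g)"
proof -
  have S: "S \<subseteq> carrier G" using openin_subset[OF assms(1)] by simp
  have "S #> g = {x \<in> carrier G. x \<otimes> inv g \<in> S}"
  proof (intro Set.set_eqI iffI)
    fix x assume "x \<in> S #> g"
    then show "x \<in> {x \<in> carrier G. x \<otimes> inv g \<in> S}"
      using S assms(2) by (auto simp: r_coset_def m_assoc)
  next
    fix x assume x: "x \<in> {x \<in> carrier G. x \<otimes> inv g \<in> S}"
    then have "x = (x \<otimes> inv g) \<otimes> g" using assms(2) by (simp add: m_assoc)
    then show "x \<in> S #> g" using x by (auto simp: r_coset_def)
  qed
  then show ?thesis
    using open_preimage[OF continuous_right _ assms(1), of "inv g"] assms(2) by auto
qed

text \<open>The cosets of an open subgroup are a disjoint open cover of the compact set \<open>K\<close>.\<close>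

lemma finite_open_cosets:
  assumes H: "subgroup H GK" "openG H"
  shows "finite (rcosets\<^bsub>GK\<^esub> H)"
proof -
  have sub: "c \<subseteq> K" if "c \<in> rcosets\<^bsub>GK\<^esub> H" for c
    using that GK.rcosets_part_G[OF H(1)] by auto
  have "openin (top_of_set K) c" if c: "c \<in> rcosets\<^bsub>GK\<^esub> H" for c
  proof -
    obtain k where k: "k \<in> K" "c = H #> k" using c by (auto simp: RCOSETS_def r_coset_def)
    have "openG c" unfolding k using open_right_coset[OF H(2)] k K_subset by auto
    then show ?thesis by (rule openin_subset_trans[OF _ sub[OF c] K_subset])
  qed
  moreover have "K \<subseteq> \<Union>(rcosets\<^bsub>GK\<^esub> H)" using GK.rcosets_part_G[OF H(1)] by simp
  ultimately obtain D where D: "D \<subseteq> rcosets\<^bsub>GK\<^esub> H" "finite D" "K \<subseteq> \<Union>D"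
    using K_compact unfolding compact_eq_openin_cover by meson
  have "c \<in> D" if c: "c \<in> rcosets\<^bsub>GK\<^esub> H" for c
  proof -
    obtain k where k: "k \<in> K" "c = H #>\<^bsub>GK\<^esub> k" using c by (auto simp: RCOSETS_def)
    have "k \<in> c" using GK.rcos_self[of k H] H(1) k by simp
    obtain d where d: "d \<in> D" "k \<in> d" using D(3) k by auto
    have "c = d"
      using GK.rcos_disjoint[OF H(1)] c d D(1) \<open>k \<in> c\<close> by (auto simp: pairwise_def disjnt_def)
    then show ?thesis using d by simp
  qed
  then show ?thesis using D(2) by (meson finite_subset subsetI)
qed

text \<open>The intersection \<open>N\<close> of all conjugates of \<open>H\<close> is open, because a conjugate
  \<open>k\<inverse> H k\<close> depends only on the coset \<open>H k\<close>, so that the intersection is finite.\<close>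

lemma open_normal_core:
  assumes H: "subgroup H GK" "openG H"
  shows "\<exists>N. open_normal N \<and> N \<subseteq> H"
proof -
  interpret H: subgroup H GK by fact
  have HK: "H \<subseteq> K" using H.subset by simp
  have K': "k \<in> K \<Longrightarrow> k \<in> carrier G" for k using K_subset by auto
  have Kcl: "x \<in> K \<Longrightarrow> y \<in> K \<Longrightarrow> x \<otimes> y \<in> K" "x \<in> K \<Longrightarrow> inv x \<in> K" "\<one> \<in> K" for x y
    using subgroup.m_closed[OF K_subgroup] subgroup.m_inv_closed[OF K_subgroup]
      subgroup.one_closed[OF K_subgroup] by auto
  have Hcl: "x \<otimes> y \<in> H" if "x \<in> H" "y \<in> H" for x y
    using H.m_closed[OF that] by simp
  have Hinv: "inv x \<in> H" if "x \<in> H" for x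
    by (metis H.m_inv_closed GK_inv HK subsetD that)
  have Hone: "\<one> \<in> H"
    using H.one_closed by simp
  define N where "N = {n \<in> K. \<forall>k\<in>K. k \<otimes> n \<otimes> inv k \<in> H}"
  have NH: "N \<subseteq> H"
  proof
    fix n assume n: "n \<in> N"
    then have "\<one> \<otimes> n \<otimes> inv \<one> \<in> H" using Kcl(3) unfolding N_def by blast
    then show "n \<in> H" using n K' by (simp add: N_def)
  qed
  have conj_mult: "k \<otimes> (x \<otimes> y) \<otimes> inv k = (k \<otimes> x \<otimes> inv k) \<otimes> (k \<otimes> y \<otimes> inv k)"
    if "k \<in> carrier G" "x \<in> carrier G" "y \<in> carrier G" for k x y
    using that by (simp add: m_assoc inv_solve_left)
  have conj_inv: "k \<otimes> inv x \<otimes> inv k = inv (k \<otimes> x \<otimes> inv k)" if "k \<in> carrier G" "x \<in> carrier G" for k x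
    using that by (simp add: m_assoc inv_mult_group)
  have sub: "subgroup N GK"
  proof (rule GK.subgroupI)
    show "N \<subseteq> carrier GK" by (auto simp: N_def)
    show "N \<noteq> {}" using Kcl(3) Hone K' by (auto simp: N_def intro!: exI[of _ \<one>])
    show "inv\<^bsub>GK\<^esub> x \<in> N" if "x \<in> N" for x
      using that by (simp add: N_def GK_inv Kcl Hinv conj_inv K')
    show "x \<otimes>\<^bsub>GK\<^esub> y \<in> N" if "x \<in> N" "y \<in> N" for x y
      using that by (simp add: N_def Kcl conj_mult K' Hcl)
  qed
  have "x \<otimes> h \<otimes> inv x \<in> N" if x: "x \<in> K" and h: "h \<in> N" for x h
  proof -
    have hK: "h \<in> K" and h': "\<And>k. k \<in> K \<Longrightarrow> k \<otimes> h \<otimes> inv k \<in> H" using h by (auto simp: N_def)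
    have "k \<otimes> (x \<otimes> h \<otimes> inv x) \<otimes> inv k = (k \<otimes> x) \<otimes> h \<otimes> inv (k \<otimes> x)" if "k \<in> K" for k
      using that x hK K' by (simp add: m_assoc inv_mult_group)
    then show ?thesis using x hK h' by (auto simp: N_def Kcl)
  qed
  then have normal: "N \<lhd> GK"
    using sub by (auto simp: GK.normal_inv_iff GK_inv)
  let ?C = "rcosets\<^bsub>GK\<^esub> H" and ?r = "\<lambda>c. SOME k. k \<in> c"
  have rep: "\<exists>c\<in>?C. \<exists>h\<in>H. k = h \<otimes> ?r c \<and> ?r c \<in> K" if k: "k \<in> K" for k
  proof -
    let ?c = "H #>\<^bsub>GK\<^esub> k"
    have "?c \<in> ?C" using k by (auto simp: RCOSETS_def)
    moreover have "k \<in> ?c" using GK.rcos_self[of k H] H(1) k by simp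
    then have "?r ?c \<in> ?c" by (rule someI)
    then obtain h where h: "h \<in> H" "?r ?c = h \<otimes> k" by (auto simp: r_coset_def)
    then have "k = inv h \<otimes> ?r ?c" using k HK K' by (auto simp: m_assoc[symmetric])
    moreover have "?r ?c \<in> K" using h k HK Kcl by auto
    ultimately show ?thesis using Hinv[OF h(1)] by blast
  qed
  have rK: "?r c \<in> K" if c: "c \<in> ?C" for c
  proof -
    obtain k where k: "k \<in> K" "c = H #>\<^bsub>GK\<^esub> k" using c by (auto simp: RCOSETS_def)
    have "k \<in> c" using GK.rcos_self[of k H] H(1) k by simp
    then have "?r c \<in> c" by (rule someI)
    then show ?thesis using GK.rcosets_part_G[OF H(1)] c by auto
  qed
  have Neq: "N = K \<inter> (\<Inter>c\<in>?C. {n \<in> carrier G. ?r c \<otimes> n \<otimes> inv (?r c) \<in> H})"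
  proof (intro Set.set_eqI iffI)
    fix n assume "n \<in> N"
    then show "n \<in> K \<inter> (\<Inter>c\<in>?C. {n \<in> carrier G. ?r c \<otimes> n \<otimes> inv (?r c) \<in> H})"
      using rK K' by (auto simp: N_def)
  next
    fix n assume n: "n \<in> K \<inter> (\<Inter>c\<in>?C. {n \<in> carrier G. ?r c \<otimes> n \<otimes> inv (?r c) \<in> H})"
    have "k \<otimes> n \<otimes> inv k \<in> H" if k: "k \<in> K" for k
    proof -
      obtain c h where c: "c \<in> ?C" "h \<in> H" "k = h \<otimes> ?r c" "?r c \<in> K" using rep[OF k] by blast
      have "k \<otimes> n \<otimes> inv k = h \<otimes> (?r c \<otimes> n \<otimes> inv (?r c)) \<otimes> inv h"
        unfolding c(3) using c(2,4) n HK K' by (simp add: m_assoc inv_mult_group subset_iff)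
      also have "\<dots> \<in> H"
        using n c(1) by (intro Hcl[OF Hcl[OF c(2)] Hinv[OF c(2)]]) blast
      finally show ?thesis .
    qed
    then show "n \<in> N" using n by (auto simp: N_def)
  qed
  have op: "openG {n \<in> carrier G. g \<otimes> n \<otimes> inv g \<in> H}" if g: "g \<in> carrier G" for g
  proof (rule open_preimage[OF _ _ H(2)])
    show "continuous_on (carrier G) (\<lambda>n. g \<otimes> n \<otimes> inv g)"
      using g by (intro continuous_on_compose2[OF continuous_right continuous_left]) auto
  qed (use g in auto)
  have "openG N"
  proof (cases "?C = {}")
    case True
    then show ?thesis unfolding Neq using K_open by simp
  next
    case False
    then show ?thesis
      unfolding Neq using finite_open_cosets[OF H] rK K'
      by (intro openin_Int[OF K_open] openin_INT2) (auto intro!: op)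
  qed
  then show ?thesis using normal NH by (auto simp: open_normal_def)
qed

lemma open_normal_Int: "open_normal N \<Longrightarrow> open_normal M \<Longrightarrow> open_normal (N \<inter> M)"
  by (auto simp: open_normal_def intro: GK.normal_subgroup_intersect)

lemma open_normalD:
  assumes "open_normal N"
  shows "N \<lhd> GK" "subgroup N GK" "N \<subseteq> K" "openG N" "finite (carrier (GK Mod N))"
    "compact_open_subgroup N G"
proof -
  show n: "N \<lhd> GK" and o: "openG N" using assms by (auto simp: open_normal_def)
  show s: "subgroup N GK" by (rule normal_imp_subgroup[OF n])
  show NK: "N \<subseteq> K" using subgroup.subset[OF s] by simp
  show "finite (carrier (GK Mod N))"
    using finite_open_cosets[OF s o] by (simp add: FactGroup_def)
  have "K - N = \<Union>(rcosets\<^bsub>GK\<^esub> N - {N})"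
  proof -
    have N: "N \<in> rcosets\<^bsub>GK\<^esub> N" by (rule subgroup.subgroup_in_rcosets[OF s GK_group])
    have "c \<inter> N = {}" if "c \<in> rcosets\<^bsub>GK\<^esub> N" "c \<noteq> N" for c
      using pairwiseD[OF GK.rcos_disjoint[OF s] that(1) N that(2)] by (simp add: disjnt_def)
    then show ?thesis
      using GK.rcosets_part_G[OF s] by fastforce
  qed
  moreover have "openG c" if c: "c \<in> rcosets\<^bsub>GK\<^esub> N" for c
  proof -
    obtain k where k: "k \<in> K" "c = N #> k" using c by (auto simp: RCOSETS_def r_coset_def)
    then show ?thesis using open_right_coset[OF o] K_subset by auto
  qed
  ultimately have "openG (K - N)" by (metis (no_types, lifting) DiffE openin_Union)
  then have "openin (top_of_set K) (K - N)" using openin_subset_trans K_subset by blast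
  then have "closedin (top_of_set K) N" using NK by (simp add: closedin_def)
  then have "compact N" using K_compact closedin_compact by blast
  moreover have "subgroup N G" using incl_subgroup[OF K_subgroup s] .
  ultimately show "compact_open_subgroup N G" using o by (simp add: compact_open_subgroup_def)
qed

lemma open_normal_finite_quotient: "open_normal N \<Longrightarrow> finite_quotient N GK"
  by (simp add: finite_quotient_def finite_quotient_axioms_def open_normalD)

lemma K_open_normal: "open_normal K"
proof -
  have "K \<lhd> GK"
    unfolding GK.normal_inv_iff
  proof (intro conjI ballI)
    show "subgroup K GK" using GK.subgroup_self by simp
    fix x h assume "x \<in> carrier GK" "h \<in> K"
    then show "x \<otimes>\<^bsub>GK\<^esub> h \<otimes>\<^bsub>GK\<^esub> inv\<^bsub>GK\<^esub> x \<in> K"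
      using GK.m_closed[OF GK.m_closed[of x h] GK.inv_closed[of x]] by simp
  qed
  then show ?thesis using K_open by (simp add: open_normal_def)
qed

lemma smooth_stabiliser:
  assumes rep: "Defs.representation GK s V \<pi>" and v: "v \<in> V"
    and smooth: "openG {k \<in> K. \<pi> k v = v}"
  shows "\<exists>N. open_normal N \<and> (\<forall>n\<in>N. \<pi> n v = v)"
proof -
  note rep' = representationD[OF rep]
  have "subgroup {k \<in> K. \<pi> k v = v} GK"
  proof (rule GK.subgroupI)
    show "{k \<in> K. \<pi> k v = v} \<noteq> {}" using rep'(4)[OF v] GK.one_closed by auto
    show "inv\<^bsub>GK\<^esub> a \<in> {k \<in> K. \<pi> k v = v}" if a: "a \<in> {k \<in> K. \<pi> k v = v}" for a
    proof -
      have "\<pi> (inv\<^bsub>GK\<^esub> a) v = \<pi> (inv\<^bsub>GK\<^esub> a) (\<pi> a v)" using a by simp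
      also have "\<dots> = \<pi> (inv\<^bsub>GK\<^esub> a \<otimes>\<^bsub>GK\<^esub> a) v"
        using a v GK.inv_closed[of a] by (intro rep'(5)[symmetric]) auto
      also have "\<dots> = v" using a rep'(4)[OF v] GK.l_inv[of a] by simp
      finally show ?thesis using a GK.inv_closed[of a] by simp
    qed
    show "a \<otimes>\<^bsub>GK\<^esub> b \<in> {k \<in> K. \<pi> k v = v}" if "a \<in> {k \<in> K. \<pi> k v = v}" "b \<in> {k \<in> K. \<pi> k v = v}" for a b
      using that v rep'(5)[of a b v] GK.m_closed[of a b] by simp
  qed auto
  from open_normal_core[OF this smooth] show ?thesis by blast
qed

definition fixed_space :: "'v set \<Rightarrow> ('g \<Rightarrow> 'v \<Rightarrow> 'v) \<Rightarrow> 'g set \<Rightarrow> 'v set" where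
  "fixed_space V \<pi> N = {v \<in> V. \<forall>n\<in>N. \<pi> n v = v}"

lemma representation_fixed_space:
  assumes rep: "Defs.representation GK s V \<pi>" and N: "open_normal N"
  shows "Defs.representation GK s (fixed_space V \<pi> N) \<pi>"
proof -
  note rep' = representationD[OF rep]
  interpret vector_space s by (rule rep'(1))
  interpret N: finite_quotient N GK by (rule open_normal_finite_quotient[OF N])
  have NK: "n \<in> K" if "n \<in> N" for n using that open_normalD(3)[OF N] by auto
  have sub: "subspace (fixed_space V \<pi> N)"
  proof (rule subspaceI)
    show "0 \<in> fixed_space V \<pi> N"
      using subspace_0[OF rep'(2)] NK linear_between_zero[OF rep'(1) rep'(3) rep'(1,2)]
      by (auto simp: fixed_space_def)
    show "x + y \<in> fixed_space V \<pi> N" if "x \<in> fixed_space V \<pi> N" "y \<in> fixed_space V \<pi> N" for x y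
      using that NK subspace_add[OF rep'(2)] by (auto simp: fixed_space_def linear_betweenD(2)[OF rep'(3)])
    show "s c x \<in> fixed_space V \<pi> N" if "x \<in> fixed_space V \<pi> N" for c x
      using that NK subspace_scale[OF rep'(2)] by (auto simp: fixed_space_def linear_betweenD(3)[OF rep'(3)])
  qed
  have inv: "\<pi> k v \<in> fixed_space V \<pi> N" if k: "k \<in> K" and v: "v \<in> fixed_space V \<pi> N" for k v
  proof -
    have vV: "v \<in> V" and vN: "\<And>n. n \<in> N \<Longrightarrow> \<pi> n v = v" using v by (auto simp: fixed_space_def)
    have "\<pi> n (\<pi> k v) = \<pi> k v" if n: "n \<in> N" for n
    proof -
      have "n \<otimes> k \<in> N #>\<^bsub>GK\<^esub> k" using n by (auto simp: r_coset_def)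
      then obtain m where m: "m \<in> N" "n \<otimes> k = k \<otimes> m"
        using N.coset_eq k by (auto simp: l_coset_def)
      have "\<pi> n (\<pi> k v) = \<pi> (n \<otimes> k) v" using rep'(5)[of n k v] NK n k vV by simp
      also have "\<dots> = \<pi> k (\<pi> m v)" using rep'(5)[of k m v] NK m k vV by simp
      finally show ?thesis using vN[OF m(1)] by simp
    qed
    then show ?thesis using rep'(6)[of k v] k vV by (auto simp: fixed_space_def)
  qed
  have "linear_between s (fixed_space V \<pi> N) s (fixed_space V \<pi> N) (\<pi> k)" if "k \<in> K" for k
    using rep'(3)[of k] that inv[OF that] by (auto simp: linear_between_def fixed_space_def)
  then show ?thesis
    using rep sub by (auto simp: Defs.representation_def fixed_space_def)
qed

text \<open>Take an open normal \<open>N\<close> that fixes a nonzero vector \<open>w\<close>.  The space of \<open>N\<close>-fixed vectors is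
  invariant since \<open>N\<close> is normal, hence it is all of \<open>W\<close>.  The vector \<open>\<tau> k w\<close> then
  depends only on the coset of \<open>k\<close>, so the orbit of \<open>w\<close> is finite; its span is invariant, hence
  also all of \<open>W\<close>.\<close>

lemma irreducible_smooth_rep:
  assumes rep: "Defs.representation GK s W \<tau>" and smooth: "smooth_rep GK s W \<tau>"
    and irr: "irreducible_rep GK s W \<tau>"
  shows "finite_dim s W" "\<exists>N. open_normal N \<and> (\<forall>n\<in>N. \<forall>w\<in>W. \<tau> n w = w)"
proof -
  note rep' = representationD[OF rep]
  interpret vector_space s by (rule rep'(1))
  obtain w where w: "w \<in> W" "w \<noteq> 0"
    using irr subspace_0[OF rep'(2)] by (auto simp: irreducible_rep_def)
  have "openG {k \<in> K. \<tau> k w = w}"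
    using smooth w K_open by (auto simp: smooth_rep_def intro: openin_trans)
  then obtain N where N: "open_normal N" "\<forall>n\<in>N. \<tau> n w = w"
    using smooth_stabiliser[OF rep w(1)] by blast
  interpret N: finite_quotient N GK by (rule open_normal_finite_quotient[OF N(1)])
  have "invariant_subspace GK s W \<tau> (fixed_space W \<tau> N)"
    using representationD(2,6)[OF representation_fixed_space[OF rep N(1)]]
    by (auto simp: invariant_subspace_def fixed_space_def)
  moreover have "w \<in> fixed_space W \<tau> N" using w N by (auto simp: fixed_space_def)
  ultimately have fW: "fixed_space W \<tau> N = W"
    using irr w by (auto simp: irreducible_rep_def)
  then have triv: "\<forall>n\<in>N. \<forall>x\<in>W. \<tau> n x = x"
    by (auto simp: fixed_space_def)
  then show "\<exists>N. open_normal N \<and> (\<forall>n\<in>N. \<forall>w\<in>W. \<tau> n w = w)" using N(1) by blast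
  let ?S = "(\<lambda>k. \<tau> k w) ` K"
  have "?S \<subseteq> (\<lambda>c. quotient_rep \<tau> c w) ` carrier (GK Mod N)"
  proof
    fix x assume "x \<in> ?S"
    then obtain k where k: "k \<in> K" "x = \<tau> k w" by auto
    then have "x = quotient_rep \<tau> (N #>\<^bsub>GK\<^esub> k) w"
      using N.quotient_rep_coset[OF rep triv] w by simp
    then show "x \<in> (\<lambda>c. quotient_rep \<tau> c w) ` carrier (GK Mod N)"
      using k by (auto simp: carrier_FactGroup)
  qed
  then have fin: "finite ?S" using open_normalD(5)[OF N(1)] finite_surj by blast
  have SW: "span ?S \<subseteq> W"
    using rep'(6) w by (intro span_minimal rep'(2)) auto
  have "x \<in> W \<and> \<tau> g x \<in> span ?S" if g: "g \<in> K" and x: "x \<in> span ?S" for g x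
    using x
  proof (induction rule: span_induct_alt)
    case base
    then show ?case
      using linear_between_zero[OF rep'(1) rep'(3) rep'(1,2), of g] g span_zero subspace_0[OF rep'(2)] by simp
  next
    case (step c x y)
    then obtain k where k: "k \<in> K" "x = \<tau> k w" by auto
    have xW: "x \<in> W" using k rep'(6) w by simp
    have yW: "y \<in> W" using step(2) by simp
    have "\<tau> g x = \<tau> (g \<otimes> k) w" using rep'(5)[of g k w] g k w by simp
    moreover have "g \<otimes> k \<in> K" using GK.m_closed g k by simp
    ultimately have "\<tau> g x \<in> span ?S" by (auto intro: span_base)
    then show ?case
      using step(2) linear_betweenD(2,3)[OF rep'(3)[of g]] g xW yW subspace_scale[OF rep'(2) xW]
        subspace_add[OF rep'(2)]
      by (auto intro!: span_add span_scale)
  qed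
  then have "invariant_subspace GK s W \<tau> (span ?S)"
    using SW by (auto simp: invariant_subspace_def)
  moreover have "w \<in> span ?S"
    using rep'(4)[OF w(1)] GK.one_closed by (intro span_base image_eqI[of _ _ \<one>]) auto
  ultimately have "span ?S = W"
    using irr w by (auto simp: irreducible_rep_def)
  then show "finite_dim s W" using fin by (auto simp: finite_dim_def)
qed

end


section \<open>Hecke operators and traces\<close>

locale haar_compact_open = compact_open G K for G :: "'g::metric_space monoid" (structure) and K +
  fixes \<mu> :: "'g measure"
  assumes haar: "haar_measure G \<mu>"
begin

lemma space_haar: "space \<mu> = carrier G"
proof -
  have "sets \<mu> = sets (restrict_space borel (carrier G))" using haar by (simp add: haar_measure_def)
  from sets_eq_imp_space_eq[OF this] show ?thesis by (simp add: space_restrict_space)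
qed

lemma open_measurable: "openG S \<Longrightarrow> S \<in> sets \<mu>"
  using haar by (auto simp: haar_measure_def sets_restrict_space openin_open)

lemma measure_K_pos: "measure \<mu> K > 0" and K_measurable: "K \<in> sets \<mu>" and K_finite: "emeasure \<mu> K < \<infinity>"
proof -
  show "K \<in> sets \<mu>" by (rule open_measurable[OF K_open])
  show fin: "emeasure \<mu> K < \<infinity>" using haar K_compact K_subset by (simp add: haar_measure_def)
  have "K \<noteq> {}" using subgroup.one_closed[OF K_subgroup] by auto
  then have "0 < emeasure \<mu> K" using haar K_open by (simp add: haar_measure_def)
  then show "measure \<mu> K > 0" using fin by (simp add: measure_def enn2real_positive_iff)
qed

lemma measure_coset:
  assumes N: "open_normal N" and c: "c \<in> carrier (GK Mod N)"
  shows "c \<in> sets \<mu>" "emeasure \<mu> c < \<infinity>" "measure \<mu> c = measure \<mu> N" "c \<subseteq> K"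
proof -
  interpret N: finite_quotient N GK by (rule open_normal_finite_quotient[OF N])
  obtain k where k: "k \<in> K" "c = N #>\<^bsub>GK\<^esub> k" using c by (auto simp: carrier_FactGroup)
  have kG: "k \<in> carrier G" using k K_subset by auto
  have "c = N #> k" using k by (simp add: r_coset_def)
  then have "openG c" using open_right_coset[OF open_normalD(4)[OF N] kG] by simp
  then show "c \<in> sets \<mu>" by (rule open_measurable)
  have "c = k <#\<^bsub>GK\<^esub> N" using N.coset_eq k by auto
  then have "c = (\<lambda>x. k \<otimes> x) ` N" by (auto simp: l_coset_def)
  then have "emeasure \<mu> c = emeasure \<mu> N"
    using haar kG open_measurable[OF open_normalD(4)[OF N]] by (simp add: haar_measure_def)
  then show "measure \<mu> c = measure \<mu> N" by (simp add: measure_def)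
  show cK: "c \<subseteq> K" using GK.r_coset_subset_G[OF N.subset] k by auto
  show "emeasure \<mu> c < \<infinity>"
    using emeasure_mono[OF cK K_measurable] K_finite by (rule order_le_less_trans)
qed

text \<open>The \<open>N\<close>-cosets in \<open>K\<close> all have the same volume, so the integral of a function that is constant
  on them is a finite sum.\<close>

lemma integral_coset_sum:
  fixes g :: "'g \<Rightarrow> 'b::{banach, second_countable_topology}"
  assumes N: "open_normal N" and inv: "\<And>n k. n \<in> N \<Longrightarrow> k \<in> K \<Longrightarrow> g (n \<otimes> k) = g k"
    and out: "\<And>x. x \<in> carrier G - K \<Longrightarrow> g x = 0"
  shows "integrable \<mu> g"
    and "integral\<^sup>L \<mu> g = measure \<mu> N *\<^sub>R (\<Sum>c\<in>carrier (GK Mod N). g (SOME k. k \<in> c))"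
proof -
  interpret N: finite_quotient N GK by (rule open_normal_finite_quotient[OF N])
  let ?Q = "carrier (GK Mod N)"
  let ?h = "\<lambda>x. \<Sum>c\<in>?Q. indicator c x *\<^sub>R g (SOME k. k \<in> c)"
  have eq: "g x = ?h x" if x: "x \<in> space \<mu>" for x
  proof (cases "x \<in> K")
    case True
    let ?c = "N #>\<^bsub>GK\<^esub> x"
    have cQ: "?c \<in> ?Q" using True by (auto simp: carrier_FactGroup)
    have "indicator c x = (if c = ?c then 1 else 0 :: real)" if "c \<in> ?Q" for c
    proof -
      have "x \<in> ?c" using GK.rcos_self[of x N] True N.subgroup_axioms by simp
      moreover have "c \<inter> ?c = {}" if "c \<noteq> ?c"
        using GK.rcos_disjoint[OF N.subgroup_axioms] \<open>c \<in> ?Q\<close> cQ that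
        by (auto simp: FactGroup_def pairwise_def disjnt_def)
      ultimately show ?thesis by (auto simp: indicator_def)
    qed
    then have "?h x = (\<Sum>c\<in>?Q. if c = ?c then g (SOME k. k \<in> c) else 0)"
      by (intro sum.cong refl) simp
    also have "\<dots> = g (SOME k. k \<in> ?c)" using cQ N.finite_cosets by simp
    also have "\<dots> = g x" by (rule N.coset_invariant_value) (use inv True in auto)
    finally show ?thesis ..
  next
    case False
    then have "?h x = 0" using measure_coset(4)[OF N] by (intro sum.neutral) (auto simp: indicator_def)
    then show ?thesis using False x out by (simp add: space_haar)
  qed
  have int: "integrable \<mu> (\<lambda>x. indicator c x *\<^sub>R g (SOME k. k \<in> c))" if "c \<in> ?Q" for c
    using measure_coset[OF N that] by (intro integrable_scaleR_left) (simp add: integrable_indicator_iff)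
  have "integrable \<mu> g \<longleftrightarrow> integrable \<mu> ?h"
    by (rule Bochner_Integration.integrable_cong) (use eq in auto)
  then show "integrable \<mu> g" using int by simp
  have "integral\<^sup>L \<mu> g = integral\<^sup>L \<mu> ?h"
    by (rule Bochner_Integration.integral_cong) (use eq in auto)
  also have "\<dots> = (\<Sum>c\<in>?Q. measure \<mu> c *\<^sub>R g (SOME k. k \<in> c))"
    using int measure_coset[OF N] sets.sets_into_space
    by (simp add: Bochner_Integration.integral_sum)
  also have "\<dots> = measure \<mu> N *\<^sub>R (\<Sum>c\<in>?Q. g (SOME k. k \<in> c))"
    by (simp add: measure_coset[OF N] scaleR_sum_right)
  finally show "integral\<^sup>L \<mu> g = measure \<mu> N *\<^sub>R (\<Sum>c\<in>?Q. g (SOME k. k \<in> c))" .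
qed

lemma measure_K_eq:
  assumes N: "open_normal N"
  shows "measure \<mu> K = measure \<mu> N * card (carrier (GK Mod N))"
proof -
  interpret N: finite_quotient N GK by (rule open_normal_finite_quotient[OF N])
  have mult: "n \<otimes> k \<in> K" if "n \<in> N" "k \<in> K" for n k
    using GK.m_closed[of n k] that open_normalD(3)[OF N] by auto
  have "measure \<mu> K = integral\<^sup>L \<mu> (indicator K :: 'g \<Rightarrow> real)"
    using K_subset by (simp add: space_haar Int_absorb2)
  also have "\<dots> = measure \<mu> N *\<^sub>R (\<Sum>c\<in>carrier (GK Mod N). indicator K (SOME k. k \<in> c))"
    by (rule integral_coset_sum[OF N]) (auto simp: mult)
  also have "\<dots> = measure \<mu> N *\<^sub>R (\<Sum>c\<in>carrier (GK Mod N). 1)"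
    using N.coset_rep(1) by (intro arg_cong2[where f = scaleR] sum.cong refl) simp
  finally show ?thesis by simp
qed

text \<open>In \<^const>\<open>hecke_op\<close>, the terms are grouped by the value of the integrand.  If the integrand is
  constant on the \<open>N\<close>-cosets, its fibres are unions of cosets, and the terms can be grouped by cosets
  instead.\<close>

lemma hecke_op_coset_sum:
  assumes s: "vector_space s" and N: "open_normal N"
    and inv: "\<And>n k. n \<in> N \<Longrightarrow> k \<in> K \<Longrightarrow> s (f (n \<otimes> k)) (\<pi> (n \<otimes> k) v) = s (f k) (\<pi> k v)"
    and out: "\<And>x. x \<in> carrier G - K \<Longrightarrow> f x = 0"
  shows "hecke_op \<mu> s \<pi> f v = (\<Sum>c\<in>carrier (GK Mod N).
    s (of_real (measure \<mu> N) * f (SOME k. k \<in> c)) (\<pi> (SOME k. k \<in> c) v))"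
proof -
  interpret vector_space s by fact
  interpret N: finite_quotient N GK by (rule open_normal_finite_quotient[OF N])
  let ?Q = "carrier (GK Mod N)" and ?r = "\<lambda>c. SOME k. k \<in> c"
  define F where "F g = s (f g) (\<pi> g v)" for g
  have F0: "F x = 0" if "x \<in> carrier G - K" for x using out[OF that] by (simp add: F_def)
  have Finv: "F (n \<otimes> k) = F k" if "n \<in> N" "k \<in> K" for n k using inv[OF that] by (simp add: F_def)
  have meas: "measure \<mu> {g \<in> space \<mu>. F g = w} = measure \<mu> N * (\<Sum>c\<in>?Q. if F (?r c) = w then 1 else 0)"
    if w: "w \<noteq> 0" for w
  proof -
    let ?g = "\<lambda>x. if F x = w then 1 else (0::real)"
    have "measure \<mu> {g \<in> space \<mu>. F g = w} = integral\<^sup>L \<mu> (indicator {g \<in> space \<mu>. F g = w} :: 'g \<Rightarrow> real)"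
      by (simp add: Int_absorb2)
    also have "\<dots> = integral\<^sup>L \<mu> ?g"
      by (rule Bochner_Integration.integral_cong) (auto simp: indicator_def)
    also have "\<dots> = measure \<mu> N *\<^sub>R (\<Sum>c\<in>?Q. ?g (?r c))"
      by (rule integral_coset_sum[OF N]) (use w F0 Finv in auto)
    finally show ?thesis by simp
  qed
  have sub: "F ` space \<mu> - {0} \<subseteq> (\<lambda>c. F (?r c)) ` ?Q"
  proof
    fix w assume "w \<in> F ` space \<mu> - {0}"
    then obtain x where x: "x \<in> carrier G" "w = F x" "w \<noteq> 0" by (auto simp: space_haar)
    then have xK: "x \<in> K" using F0 by auto
    have "F (?r (N #>\<^bsub>GK\<^esub> x)) = F x" by (rule N.coset_invariant_value) (use Finv xK in auto)
    then show "w \<in> (\<lambda>c. F (?r c)) ` ?Q"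
      using x xK by (intro image_eqI[of _ _ "N #>\<^bsub>GK\<^esub> x"]) (auto simp: carrier_FactGroup)
  qed
  then have fin: "finite (F ` space \<mu> - {0})" using N.finite_cosets finite_surj by blast
  have "hecke_op \<mu> s \<pi> f v = (\<Sum>w\<in>F ` space \<mu> - {0}. s (of_real (measure \<mu> {g \<in> space \<mu>. F g = w})) w)"
    by (simp add: hecke_op_def F_def[abs_def])
  also have "\<dots> = (\<Sum>w\<in>F ` space \<mu> - {0}. \<Sum>c\<in>?Q. if F (?r c) = w then s (of_real (measure \<mu> N)) w else 0)"
  proof (intro sum.cong refl)
    fix w assume "w \<in> F ` space \<mu> - {0}"
    then have w: "w \<noteq> 0" by auto
    have "s (of_real (measure \<mu> {g \<in> space \<mu>. F g = w})) w
        = s (\<Sum>c\<in>?Q. if F (?r c) = w then of_real (measure \<mu> N) else 0) w"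
      unfolding meas[OF w]
      by (intro arg_cong2[where f = s] refl)
        (simp add: sum_distrib_left of_real_sum if_distrib cong: if_cong)
    also have "\<dots> = (\<Sum>c\<in>?Q. if F (?r c) = w then s (of_real (measure \<mu> N)) w else 0)"
      unfolding scale_sum_left by (intro sum.cong refl) auto
    finally show "s (of_real (measure \<mu> {g \<in> space \<mu>. F g = w})) w
        = (\<Sum>c\<in>?Q. if F (?r c) = w then s (of_real (measure \<mu> N)) w else 0)" .
  qed
  also have "\<dots> = (\<Sum>c\<in>?Q. \<Sum>w\<in>F ` space \<mu> - {0}. if F (?r c) = w then s (of_real (measure \<mu> N)) w else 0)"
    by (rule sum.swap)
  also have "\<dots> = (\<Sum>c\<in>?Q. s (of_real (measure \<mu> N)) (F (?r c)))"
  proof (intro sum.cong refl)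
    fix c assume "c \<in> ?Q"
    then have "?r c \<in> space \<mu>" using N.coset_rep(1) K_subset by (auto simp: space_haar)
    then show "(\<Sum>w\<in>F ` space \<mu> - {0}. if F (?r c) = w then s (of_real (measure \<mu> N)) w else 0)
        = s (of_real (measure \<mu> N)) (F (?r c))"
      using fin by (simp add: sum.delta')
  qed
  finally show ?thesis by (simp add: F_def)
qed

end

locale smooth_admissible_rep = haar_compact_open G K \<mu>
  for G :: "'g::metric_space monoid" (structure) and K \<mu> +
  fixes s :: "complex \<Rightarrow> 'v::ab_group_add \<Rightarrow> 'v" and V :: "'v set" and \<pi> :: "'g \<Rightarrow> 'v \<Rightarrow> 'v"
  assumes rep: "Defs.representation G s V \<pi>" and smooth: "smooth_rep G s V \<pi>"
    and admissible: "admissible_rep G s V \<pi>"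
begin

interpretation vs: vector_space s by (rule representationD(1)[OF rep])

lemma repK: "Defs.representation GK s V \<pi>"
  using rep K_subset by (auto simp: Defs.representation_def subset_iff)

lemma smooth_open_normal:
  assumes "v \<in> V"
  shows "\<exists>N. open_normal N \<and> v \<in> fixed_space V \<pi> N"
proof -
  have "openG (K \<inter> {g \<in> carrier G. \<pi> g v = v})"
    using smooth assms K_open by (auto simp: smooth_rep_def intro: openin_Int)
  also have "K \<inter> {g \<in> carrier G. \<pi> g v = v} = {k \<in> K. \<pi> k v = v}" using K_subset by auto
  finally show ?thesis
    using smooth_stabiliser[OF repK assms] assms by (auto simp: fixed_space_def)
qed

lemma finite_dim_fixed_space: "open_normal N \<Longrightarrow> finite_dim s (fixed_space V \<pi> N)"
  using admissible open_normalD(6) by (auto simp: admissible_rep_def fixed_space_def)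

lemma fixed_space_antimono: "M \<subseteq> N \<Longrightarrow> fixed_space V \<pi> N \<subseteq> fixed_space V \<pi> M"
  by (auto simp: fixed_space_def)

text \<open>Now let \<open>f\<close> be a function on \<open>K\<close> that is constant on the cosets of \<open>N\<close>.  A vector of \<open>V\<close> need not
  be fixed by \<open>N\<close>, but it is fixed by some smaller open normal \<open>M\<close>, and the Hecke operator is then a sum
  over the \<open>M\<close>-cosets.\<close>

context
  fixes N :: "'g set" and f :: "'g \<Rightarrow> complex"
  assumes N: "open_normal N"
    and f_inv: "\<And>n k. n \<in> N \<Longrightarrow> k \<in> K \<Longrightarrow> f (n \<otimes> k) = f k"
    and f_out: "\<And>x. x \<in> carrier G - K \<Longrightarrow> f x = 0"
begin

lemma hecke_op_fixed_space:
  assumes M: "open_normal M" "M \<subseteq> N" and v: "v \<in> fixed_space V \<pi> M"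
  shows "hecke_op \<mu> s \<pi> f v = (\<Sum>c\<in>carrier (GK Mod M).
    s (of_real (measure \<mu> M) * f (SOME k. k \<in> c)) (\<pi> (SOME k. k \<in> c) v))"
proof (rule hecke_op_coset_sum[OF representationD(1)[OF rep] M(1) _ f_out])
  fix m k assume m: "m \<in> M" and k: "k \<in> K"
  note r = representationD[OF representation_fixed_space[OF repK M(1)]]
  have "\<pi> (m \<otimes> k) v = \<pi> m (\<pi> k v)"
    using r(5)[of m k v] m k v open_normalD(3)[OF M(1)] by auto
  also have "\<dots> = \<pi> k v" using r(6)[of k v] m k v by (auto simp: fixed_space_def)
  finally show "s (f (m \<otimes> k)) (\<pi> (m \<otimes> k) v) = s (f k) (\<pi> k v)"
    using f_inv m k M(2) by auto
qed auto

text \<open>Left translation by \<open>n \<in> N\<close> permutes the summands, since it permutes the \<open>M\<close>-cosets and leaves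
  \<open>f\<close> unchanged.\<close>

lemma hecke_op_image: "v \<in> V \<Longrightarrow> hecke_op \<mu> s \<pi> f v \<in> fixed_space V \<pi> N"
proof -
  assume v: "v \<in> V"
  obtain M' where M': "open_normal M'" "v \<in> fixed_space V \<pi> M'" using smooth_open_normal[OF v] by blast
  define M where "M = M' \<inter> N"
  have M: "open_normal M" "M \<subseteq> N" "v \<in> fixed_space V \<pi> M"
    using open_normal_Int[OF M'(1) N] M'(2) fixed_space_antimono[of M M'] by (auto simp: M_def)
  interpret M: finite_quotient M GK by (rule open_normal_finite_quotient[OF M(1)])
  interpret Q: group "GK Mod M" by (rule M.factorgroup_is_group)
  note r = representationD[OF repK]
  let ?Q = "carrier (GK Mod M)" and ?r = "\<lambda>c. SOME k. k \<in> c"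
  define h where "h k = s (of_real (measure \<mu> M) * f k) (\<pi> k v)" for k
  have T: "hecke_op \<mu> s \<pi> f v = (\<Sum>c\<in>?Q. h (?r c))"
    unfolding h_def by (rule hecke_op_fixed_space[OF M])
  have rK: "?r c \<in> K" if "c \<in> ?Q" for c using M.coset_rep(1)[OF that] by simp
  have hV: "h k \<in> V" if "k \<in> K" for k
    using r(6)[of k v] that v by (simp add: h_def vs.subspace_scale[OF r(2)])
  have h_inv: "h (m \<otimes> k) = h k" if mk: "m \<in> M" "k \<in> K" for m k
  proof -
    note r' = representationD[OF representation_fixed_space[OF repK M(1)]]
    have "\<pi> (m \<otimes> k) v = \<pi> m (\<pi> k v)"
      using r'(5)[of m k v] mk M(3) open_normalD(3)[OF M(1)] by auto
    also have "\<dots> = \<pi> k v" using r'(6)[of k v] mk M(3) by (auto simp: fixed_space_def)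
    finally show ?thesis using f_inv mk M(2) by (auto simp: h_def)
  qed
  have "\<pi> n (hecke_op \<mu> s \<pi> f v) = hecke_op \<mu> s \<pi> f v" if n: "n \<in> N" for n
  proof -
    have nK: "n \<in> K" using n open_normalD(3)[OF N] by auto
    let ?n = "M #>\<^bsub>GK\<^esub> n"
    have nQ: "?n \<in> ?Q" using nK by (auto simp: carrier_FactGroup)
    have step: "\<pi> n (h (?r c)) = h (?r (?n \<otimes>\<^bsub>GK Mod M\<^esub> c))" if c: "c \<in> ?Q" for c
    proof -
      have "?n \<otimes>\<^bsub>GK Mod M\<^esub> c = ?n \<otimes>\<^bsub>GK Mod M\<^esub> (M #>\<^bsub>GK\<^esub> ?r c)"
        using M.coset_rep(2)[OF c] by simp
      also have "\<dots> = M #>\<^bsub>GK\<^esub> (n \<otimes> ?r c)"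
        using M.rcos_sum[of n "?r c"] nK rK[OF c] by simp
      finally have e: "?n \<otimes>\<^bsub>GK Mod M\<^esub> c = M #>\<^bsub>GK\<^esub> (n \<otimes> ?r c)" .
      have nr: "n \<otimes> ?r c \<in> K" using GK.m_closed[of n "?r c"] nK rK[OF c] by simp
      have "h (?r (?n \<otimes>\<^bsub>GK Mod M\<^esub> c)) = h (n \<otimes> ?r c)"
        unfolding e by (rule M.coset_invariant_value) (use h_inv nr in auto)
      also have "\<dots> = \<pi> n (h (?r c))"
        using r(5)[of n "?r c" v] r(6)[of "?r c" v] linear_betweenD(3)[OF r(3)[of n]] nK rK[OF c] v f_inv n
        by (simp add: h_def)
      finally show ?thesis ..
    qed
    have "\<pi> n (hecke_op \<mu> s \<pi> f v) = (\<Sum>c\<in>?Q. \<pi> n (h (?r c)))"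
      unfolding T using nK by (intro linear_between_sum[OF r(1) r(3) r(1,2)]) (auto intro: hV rK)
    also have "\<dots> = (\<Sum>c\<in>?Q. h (?r (?n \<otimes>\<^bsub>GK Mod M\<^esub> c)))" using step by simp
    also have "\<dots> = (\<Sum>c\<in>?Q. h (?r c))"
      by (rule Q.sum_left_translate[OF nQ])
    finally show ?thesis unfolding T .
  qed
  moreover have "hecke_op \<mu> s \<pi> f v \<in> V"
    unfolding T by (intro vs.subspace_sum[OF r(2)] hV rK)
  ultimately show ?thesis by (auto simp: fixed_space_def)
qed

lemma hecke_op_linear: "linear_between s V s V (hecke_op \<mu> s \<pi> f)"
  unfolding linear_between_def
proof (intro conjI ballI allI)
  note r = representationD[OF repK]
  show "hecke_op \<mu> s \<pi> f \<in> V \<rightarrow> V" using hecke_op_image by (auto simp: fixed_space_def)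
  fix x y assume xy: "x \<in> V" "y \<in> V"
  obtain Mx My where M': "open_normal Mx" "x \<in> fixed_space V \<pi> Mx" "open_normal My" "y \<in> fixed_space V \<pi> My"
    using smooth_open_normal xy by blast
  define M where "M = Mx \<inter> My \<inter> N"
  have M: "open_normal M" "M \<subseteq> N" using open_normal_Int M' N by (auto simp: M_def)
  have x: "x \<in> fixed_space V \<pi> M" and y: "y \<in> fixed_space V \<pi> M"
    using M' fixed_space_antimono[of M Mx] fixed_space_antimono[of M My] by (auto simp: M_def)
  interpret M: finite_quotient M GK by (rule open_normal_finite_quotient[OF M(1)])
  have xy': "x + y \<in> fixed_space V \<pi> M"
    using vs.subspace_add[OF representationD(2)[OF representation_fixed_space[OF repK M(1)]]] x y by blast
  have "\<pi> (SOME k. k \<in> c) (x + y) = \<pi> (SOME k. k \<in> c) x + \<pi> (SOME k. k \<in> c) y"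
    if "c \<in> carrier (GK Mod M)" for c
    using M.coset_rep(1)[OF that] xy by (intro linear_betweenD(2)[OF r(3)]) auto
  then show "hecke_op \<mu> s \<pi> f (x + y) = hecke_op \<mu> s \<pi> f x + hecke_op \<mu> s \<pi> f y"
    by (simp add: hecke_op_fixed_space[OF M] x y xy' vs.scale_right_distrib sum.distrib)
next
  note r = representationD[OF repK]
  fix a x assume xV: "x \<in> V"
  obtain Mx where M': "open_normal Mx" "x \<in> fixed_space V \<pi> Mx"
    using smooth_open_normal xV by blast
  define M where "M = Mx \<inter> N"
  have M: "open_normal M" "M \<subseteq> N" using open_normal_Int M' N by (auto simp: M_def)
  have x: "x \<in> fixed_space V \<pi> M"
    using M' fixed_space_antimono[of M Mx] by (auto simp: M_def)
  interpret M: finite_quotient M GK by (rule open_normal_finite_quotient[OF M(1)])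
  have ax: "s a x \<in> fixed_space V \<pi> M"
    using vs.subspace_scale[OF representationD(2)[OF representation_fixed_space[OF repK M(1)]]] x by blast
  have "\<pi> (SOME k. k \<in> c) (s a x) = s a (\<pi> (SOME k. k \<in> c) x)"
    if "c \<in> carrier (GK Mod M)" for c
    using M.coset_rep(1)[OF that] xV by (intro linear_betweenD(3)[OF r(3)]) auto
  then show "hecke_op \<mu> s \<pi> f (s a x) = s a (hecke_op \<mu> s \<pi> f x)"
    by (simp add: hecke_op_fixed_space[OF M] x ax vs.scale_sum_right mult.commute)
qed

text \<open>The Hecke operator maps \<open>V\<close> into the fixed space of \<open>N\<close>, so its trace can be computed there.  On
  this space it is a combination of the operators \<open>\<pi> k\<close> with one \<open>k\<close> from each \<open>N\<close>-coset.\<close>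

lemma character_distribution_coset_sum:
  assumes D: "is_basis s (fixed_space V \<pi> N) D"
  shows "character_distribution \<mu> s V \<pi> f = of_real (measure \<mu> N) *
    (\<Sum>c\<in>carrier (GK Mod N). f (SOME k. k \<in> c) * basis_trace s D (\<pi> (SOME k. k \<in> c)))"
proof -
  interpret N: finite_quotient N GK by (rule open_normal_finite_quotient[OF N])
  note r = representationD[OF representation_fixed_space[OF repK N]]
  note D' = is_basisD[OF r(1) D]
  let ?U = "fixed_space V \<pi> N" and ?T = "hecke_op \<mu> s \<pi> f"
  have TU: "?T ` V \<subseteq> ?U" using hecke_op_image by auto
  have TUU: "?T ` ?U \<subseteq> ?T ` V" by (auto simp: fixed_space_def)
  have sub: "vs.subspace (?T ` V)"
    by (rule subspace_image_linear_between[OF r(1) hecke_op_linear r(1) representationD(2)[OF rep]])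
  define B where "B = (SOME B. \<not> vs.dependent B \<and> vs.span B = ?T ` V)"
  have "\<exists>B. \<not> vs.dependent B \<and> vs.span B = ?T ` V"
    using is_basis_exists[OF r(1) sub finite_dim_subset[OF r(1) D'(6) TU]] by (auto simp: is_basis_def)
  from someI_ex[OF this] have B: "\<not> vs.dependent B" "vs.span B = ?T ` V" by (auto simp: B_def)
  have "B \<subseteq> vs.span D" using vs.span_superset[of B] B(2) TU D'(3) by auto
  then have "finite B" using vs.independent_span_bound[OF D'(1) B(1)] by blast
  then have Bb: "is_basis s (?T ` V) B" using B by (simp add: is_basis_def)
  obtain C where C: "B \<subseteq> C" "is_basis s ?U C"
    using is_basis_extend[OF r(1) D'(4,6) _ B(1)] \<open>B \<subseteq> vs.span D\<close> D'(3) by auto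
  have linU: "linear_between s ?U s ?U ?T"
    using hecke_op_linear TU by (auto simp: linear_between_def fixed_space_def)
  have "character_distribution \<mu> s V \<pi> f = basis_trace s B ?T"
    by (simp add: character_distribution_def finite_rank_trace_def B_def basis_trace_def Let_def)
  also have "\<dots> = basis_trace s C ?T"
    by (rule basis_trace_range[OF r(1) C(2) Bb C(1) TUU, symmetric])
  also have "\<dots> = basis_trace s D ?T"
    by (rule basis_trace_unique[OF r(1) C(2) D linU])
  also have "\<dots> = (\<Sum>c\<in>carrier (GK Mod N). of_real (measure \<mu> N) * f (SOME k. k \<in> c) *
      basis_trace s D (\<pi> (SOME k. k \<in> c)))"
    by (rule basis_trace_lincomb[OF r(1) D])
      (use N.coset_rep(1) r(6) in \<open>auto simp: hecke_op_fixed_space[OF N subset_refl]\<close>)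
  finally show ?thesis by (simp add: sum_distrib_left mult.assoc)
qed

end

text \<open>Extended by 0 outside \<open>K\<close>, the conjugate character is a test function on \<open>G\<close>.\<close>

definition conj_character :: "'w::ab_group_add cscale \<Rightarrow> 'w set \<Rightarrow> ('g \<Rightarrow> 'w \<Rightarrow> 'w) \<Rightarrow> 'g \<Rightarrow> complex" where
  "conj_character s' B \<tau> x = (if x \<in> K then cnj (basis_trace s' B (\<tau> x)) else 0)"

lemma conj_character_outside: "x \<in> carrier G - K \<Longrightarrow> conj_character s' B \<tau> x = 0"
  by (simp add: conj_character_def)

context
  fixes N :: "'g set" and s' :: "complex \<Rightarrow> 'w::ab_group_add \<Rightarrow> 'w" and W B \<tau>
  assumes N: "open_normal N" and tau: "Defs.representation GK s' W \<tau>"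
    and triv: "\<forall>n\<in>N. \<forall>w\<in>W. \<tau> n w = w" and B: "is_basis s' W B"
begin

lemma conj_character_invariant:
  assumes "n \<in> N" "k \<in> K"
  shows "conj_character s' B \<tau> (n \<otimes> k) = conj_character s' B \<tau> k"
proof -
  note r = representationD[OF tau]
  have nK: "n \<in> K" using assms open_normalD(3)[OF N] by auto
  have nkK: "n \<otimes> k \<in> K" using GK.m_closed[of n k] nK assms by simp
  have "\<tau> (n \<otimes> k) w = \<tau> k w" if "w \<in> W" for w
    using r(5)[of n k w] r(6)[of k w] triv that assms nK by simp
  then show ?thesis
    using is_basisD(5)[OF r(1) B] assms nkK
    by (auto simp: conj_character_def basis_trace_def intro!: sum.cong)
qed

lemma norm_conj_character_le: "cmod (conj_character s' B \<tau> x) \<le> real (vector_space.dim s' W)"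
  using finite_quotient.norm_character_le_dim[OF open_normal_finite_quotient[OF N] tau triv B, of x]
  by (simp add: conj_character_def)

lemma test_function_conj_character: "test_function G (conj_character s' B \<tau>)"
  unfolding test_function_def
proof (intro conjI ballI)
  show "\<exists>C. compact C \<and> C \<subseteq> carrier G \<and> (\<forall>x\<in>carrier G - C. conj_character s' B \<tau> x = 0)"
    using K_compact K_subset conj_character_outside by blast
  fix x assume x: "x \<in> carrier G"
  show "\<exists>U. openG U \<and> x \<in> U \<and> (\<forall>y\<in>U. conj_character s' B \<tau> y = conj_character s' B \<tau> x)"
  proof (cases "x \<in> K")
    case True
    have "x \<in> N #> x" using rcos_self[OF x, of N] incl_subgroup[OF K_subgroup open_normalD(2)[OF N]] by simp
    then show ?thesis
      using open_right_coset[OF open_normalD(4)[OF N] x] True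
      by (intro exI[of _ "N #> x"]) (auto simp: r_coset_def conj_character_invariant)
  next
    case False
    have "openG (carrier G \<inter> (- K))"
      using compact_imp_closed[OF K_compact] by (intro openin_open_Int) auto
    then show ?thesis
      using False x conj_character_outside by (intro exI[of _ "carrier G \<inter> (- K)"]) (auto simp: conj_character_def)
  qed
qed

lemma Hom_rep_fixed_space: "Hom_rep GK s' W \<tau> s (fixed_space V \<pi> N) \<pi> = Hom_rep GK s' W \<tau> s V \<pi>"
proof (intro Set.set_eqI iffI)
  fix T assume T: "T \<in> Hom_rep GK s' W \<tau> s V \<pi>"
  have "\<pi> n (T w) = T w" if "n \<in> N" "w \<in> W" for n w
  proof -
    have "T (\<tau> n w) = \<pi> n (T w)" using T that open_normalD(3)[OF N] by (auto simp: Hom_rep_def)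
    then show ?thesis using triv that by simp
  qed
  then show "T \<in> Hom_rep GK s' W \<tau> s (fixed_space V \<pi> N) \<pi>"
    using T by (auto simp: Hom_rep_def linear_between_def fixed_space_def)
qed (auto simp: Hom_rep_def linear_between_def fixed_space_def)

text \<open>The trace of the Hecke operator of \<open>cnj \<chi>\<close> is \<open>vol(N)\<close> times the character sum over
  \<open>K / N\<close>, which is \<open>|K / N|\<close> times the multiplicity.\<close>

theorem multiplicity_eq_character_distribution:
  shows "finite_dim (pointwise_scale s) (Hom_rep GK s' W \<tau> s V \<pi>)"
    and "character_distribution \<mu> s V \<pi> (conj_character s' B \<tau>) =
      of_real (measure \<mu> K) * of_nat (vector_space.dim (pointwise_scale s) (Hom_rep GK s' W \<tau> s V \<pi>))"
proof -
  interpret N: finite_quotient N GK by (rule open_normal_finite_quotient[OF N])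
  note rU = representation_fixed_space[OF repK N]
  have trivU: "\<forall>n\<in>N. \<forall>u\<in>fixed_space V \<pi> N. \<pi> n u = u" by (auto simp: fixed_space_def)
  obtain D where D: "is_basis s (fixed_space V \<pi> N) D"
    using is_basis_exists[OF representationD(1,2)[OF rU] finite_dim_fixed_space[OF N]] by blast
  note main = N.dim_Hom_rep_eq_coset_sum[OF rU trivU tau triv D B, unfolded Hom_rep_fixed_space]
  show "finite_dim (pointwise_scale s) (Hom_rep GK s' W \<tau> s V \<pi>)" by (rule main(1))
  have "character_distribution \<mu> s V \<pi> (conj_character s' B \<tau>) = of_real (measure \<mu> N) *
    (\<Sum>c\<in>carrier (GK Mod N). conj_character s' B \<tau> (SOME k. k \<in> c) * basis_trace s D (\<pi> (SOME k. k \<in> c)))"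
    by (rule character_distribution_coset_sum[OF N conj_character_invariant conj_character_outside D])
  also have "\<dots> = of_real (measure \<mu> N) *
    (\<Sum>c\<in>carrier (GK Mod N). cnj (basis_trace s' B (\<tau> (SOME k. k \<in> c))) * basis_trace s D (\<pi> (SOME k. k \<in> c)))"
    using N.coset_rep(1) by (intro arg_cong2[where f = "(*)"] sum.cong refl) (simp add: conj_character_def)
  also have "\<dots> = of_real (measure \<mu> N) * (of_nat (card (carrier (GK Mod N))) *
      of_nat (vector_space.dim (pointwise_scale s) (Hom_rep GK s' W \<tau> s V \<pi>)))"
    by (simp only: main(2))
  finally show "character_distribution \<mu> s V \<pi> (conj_character s' B \<tau>) =
      of_real (measure \<mu> K) * of_nat (vector_space.dim (pointwise_scale s) (Hom_rep GK s' W \<tau> s V \<pi>))"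
    by (simp add: measure_K_eq[OF N])
qed

lemma integral_norm_conj_character:
  shows "integrable \<mu> (\<lambda>x. (cmod (conj_character s' B \<tau> x))\<^sup>2)"
    and "(\<integral>x. (cmod (conj_character s' B \<tau> x))\<^sup>2 \<partial>\<mu>) =
      measure \<mu> K * real (vector_space.dim (pointwise_scale s') (Hom_rep GK s' W \<tau> s' W \<tau>))"
proof -
  interpret N: finite_quotient N GK by (rule open_normal_finite_quotient[OF N])
  let ?d = "vector_space.dim (pointwise_scale s') (Hom_rep GK s' W \<tau> s' W \<tau>)"
  note I = integral_coset_sum[OF N, of "\<lambda>x. (cmod (conj_character s' B \<tau> x))\<^sup>2"]
  show "integrable \<mu> (\<lambda>x. (cmod (conj_character s' B \<tau> x))\<^sup>2)"
    by (rule I(1)) (auto simp: conj_character_invariant conj_character_outside)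
  have "complex_of_real (\<Sum>c\<in>carrier (GK Mod N). (cmod (basis_trace s' B (\<tau> (SOME k. k \<in> c))))\<^sup>2)
      = of_nat (card (carrier (GK Mod N))) * of_nat ?d"
    unfolding N.dim_Hom_rep_eq_coset_sum(2)[OF tau triv tau triv B B]
    by (simp only: of_real_sum complex_norm_square mult.commute)
  also have "\<dots> = complex_of_real (real (card (carrier (GK Mod N))) * real ?d)" by simp
  finally have e: "(\<Sum>c\<in>carrier (GK Mod N). (cmod (basis_trace s' B (\<tau> (SOME k. k \<in> c))))\<^sup>2)
      = real (card (carrier (GK Mod N))) * real ?d" by (simp only: of_real_eq_iff)
  have "(\<integral>x. (cmod (conj_character s' B \<tau> x))\<^sup>2 \<partial>\<mu>) =
      measure \<mu> N *\<^sub>R (\<Sum>c\<in>carrier (GK Mod N). (cmod (conj_character s' B \<tau> (SOME k. k \<in> c)))\<^sup>2)"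
    by (rule I(2)) (auto simp: conj_character_invariant conj_character_outside)
  also have "\<dots> = measure \<mu> N * (\<Sum>c\<in>carrier (GK Mod N). (cmod (basis_trace s' B (\<tau> (SOME k. k \<in> c))))\<^sup>2)"
    using N.coset_rep(1) by (simp add: conj_character_def)
  finally show "(\<integral>x. (cmod (conj_character s' B \<tau> x))\<^sup>2 \<partial>\<mu>) = measure \<mu> K * real ?d"
    by (simp add: e measure_K_eq[OF N])
qed

lemma integral_norm_conj_character_irreducible:
  assumes irr: "irreducible_rep GK s' W \<tau>"
  shows "(\<integral>x. (cmod (conj_character s' B \<tau> x))\<^sup>2 \<partial>\<mu>) \<le> measure \<mu> K"
proof -
  have "vector_space.dim (pointwise_scale s') (Hom_rep GK s' W \<tau> s' W \<tau>) \<le> 1"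
    by (rule dim_Hom_rep_irreducible[OF tau irr is_basisD(6)[OF representationD(1)[OF tau] B]])
  then have "measure \<mu> K * real (vector_space.dim (pointwise_scale s') (Hom_rep GK s' W \<tau> s' W \<tau>))
      \<le> measure \<mu> K * 1" by (intro mult_left_mono) auto
  then show ?thesis by (simp add: integral_norm_conj_character)
qed

end

end


section \<open>Integrability of the character near a compact open subgroup\<close>

context haar_compact_open
begin

lemma test_function_restrict:
  assumes f: "test_function G f" and S: "open S" "closed S"
  shows "test_function G (\<lambda>x. if x \<in> S then f x else 0)"
  unfolding test_function_def
proof (intro conjI ballI)
  show "\<exists>C. compact C \<and> C \<subseteq> carrier G \<and> (\<forall>x\<in>carrier G - C. (if x \<in> S then f x else 0) = 0)"
  proof -
    obtain C where "compact C" "C \<subseteq> carrier G" "\<forall>x\<in>carrier G - C. f x = 0"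
      using f unfolding test_function_def by blast
    then show ?thesis by (intro exI[of _ C]) auto
  qed
  fix x assume "x \<in> carrier G"
  then obtain U c where U: "openG U" "x \<in> U" "\<forall>y\<in>U. f y = c"
    using f unfolding test_function_def by metis
  have "openG (U \<inter> S)" "openG (U \<inter> - S)"
    using U(1) S by (auto intro: openin_Int_open)
  then show "\<exists>U. openG U \<and> x \<in> U \<and>
      (\<forall>y\<in>U. (if y \<in> S then f y else 0) = (if x \<in> S then f x else 0))"
  proof (cases "x \<in> S")
    case True
    then show ?thesis using U \<open>openG (U \<inter> S)\<close> by (intro exI[of _ "U \<inter> S"]) auto
  next
    case False
    then show ?thesis using U \<open>openG (U \<inter> - S)\<close> by (intro exI[of _ "U \<inter> - S"]) auto
  qed
qed

lemma test_function_continuous: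
  assumes "test_function G f"
  shows "continuous_on (carrier G) f"
  unfolding continuous_on_topological
proof (intro ballI allI impI)
  fix x B assume x: "x \<in> carrier G" and B: "open B" "f x \<in> B"
  obtain U c where U: "openG U" "x \<in> U" "\<forall>y\<in>U. f y = c"
    using assms x unfolding test_function_def by metis
  then obtain A where "open A" "U = carrier G \<inter> A" by (auto simp: openin_open)
  then show "\<exists>A. open A \<and> x \<in> A \<and> (\<forall>y\<in>carrier G. y \<in> A \<longrightarrow> f y \<in> B)"
    using U B by (intro exI[of _ A]) auto
qed

lemma test_function_measurable: "test_function G f \<Longrightarrow> f \<in> borel_measurable \<mu>"
  using borel_measurable_continuous_on_restrict[OF test_function_continuous] haar
  by (simp add: haar_measure_def cong: measurable_cong_sets)

lemma test_function_times_integrable: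
  assumes f: "test_function G f" and th: "locally_integrable G \<mu> \<theta>"
  shows "integrable \<mu> (\<lambda>x. f x * \<theta> x)"
proof -
  obtain C where C: "compact C" "C \<subseteq> carrier G" "\<forall>x\<in>carrier G - C. f x = 0"
    using f unfolding test_function_def by blast
  have "bounded (f ` C)"
    using compact_continuous_image[OF continuous_on_subset[OF test_function_continuous[OF f] C(2)] C(1)]
    by (rule compact_imp_bounded)
  then obtain M where M: "\<And>x. x \<in> C \<Longrightarrow> cmod (f x) \<le> M" by (auto simp: bounded_iff)
  have int: "integrable \<mu> (\<lambda>x. indicator C x *\<^sub>R \<theta> x)"
    using th C by (auto simp: locally_integrable_def set_integrable_def)
  show ?thesis
  proof (rule Bochner_Integration.integrable_bound)
    show "integrable \<mu> (\<lambda>x. M *\<^sub>R norm (indicator C x *\<^sub>R \<theta> x))"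
      using int by (intro integrable_scaleR_right integrable_norm)
    show "(\<lambda>x. f x * \<theta> x) \<in> borel_measurable \<mu>"
      using test_function_measurable[OF f] th by (auto simp: locally_integrable_def)
    show "AE x in \<mu>. norm (f x * \<theta> x) \<le> norm (M *\<^sub>R norm (indicator C x *\<^sub>R \<theta> x))"
    proof (rule AE_I2)
      fix x assume x: "x \<in> space \<mu>"
      show "norm (f x * \<theta> x) \<le> norm (M *\<^sub>R norm (indicator C x *\<^sub>R \<theta> x))"
      proof (cases "x \<in> C")
        case True
        have "cmod (f x) * cmod (\<theta> x) \<le> \<bar>M\<bar> * cmod (\<theta> x)"
          using M[OF True] by (intro mult_right_mono) auto
        then show ?thesis using True by (simp add: norm_mult abs_mult)
      qed (use x C in \<open>simp add: space_haar\<close>)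
    qed
  qed
qed

end

context smooth_admissible_rep
begin

text \<open>On the part \<open>S\<close> of \<open>K\<close>, the character distribution is given by a single function in \<open>L\<^sup>p\<close>.  The
  function is supported in \<open>K \<inter> S\<close>, which lets two such functions be glued.\<close>

definition Lp_character_on :: "real \<Rightarrow> 'g set \<Rightarrow> bool" where
  "Lp_character_on p S \<longleftrightarrow> (\<exists>\<theta>. \<theta> \<in> borel_measurable \<mu> \<and>
     (\<forall>x\<in>carrier G. x \<notin> K \<inter> S \<longrightarrow> \<theta> x = 0) \<and> integrable \<mu> (\<lambda>x. cmod (\<theta> x) powr p) \<and>
     (\<forall>f. test_function G f \<and> (\<forall>x\<in>carrier G. x \<notin> K \<inter> S \<longrightarrow> f x = 0) \<longrightarrow>
       integrable \<mu> (\<lambda>x. f x * \<theta> x) \<and> character_distribution \<mu> s V \<pi> f = (\<integral>x. f x * \<theta> x \<partial>\<mu>)))"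

text \<open>The first function is used on \<open>S\<close> and the second one off \<open>S\<close>.  A test function is cut accordingly
  into two test functions, since \<open>S\<close> is clopen.  The globally defined \<open>\<theta>\<^sub>0\<close> shows that the character
  distribution is additive on the two pieces.\<close>

lemma Lp_character_on_Un:
  assumes S: "open S" "closed S"
    and L: "Lp_character_on p S" "Lp_character_on p S'"
    and th0: "character_function G \<mu> s V \<pi> \<theta>\<^sub>0"
  shows "Lp_character_on p (S \<union> S')"
proof -
  obtain \<theta>1 where t1: "\<theta>1 \<in> borel_measurable \<mu>" "\<And>x. x \<in> carrier G \<Longrightarrow> x \<notin> K \<inter> S \<Longrightarrow> \<theta>1 x = 0"
    "integrable \<mu> (\<lambda>x. cmod (\<theta>1 x) powr p)"
    "\<And>f. test_function G f \<Longrightarrow> (\<forall>x\<in>carrier G. x \<notin> K \<inter> S \<longrightarrow> f x = 0) \<Longrightarrow>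
       integrable \<mu> (\<lambda>x. f x * \<theta>1 x) \<and> character_distribution \<mu> s V \<pi> f = (\<integral>x. f x * \<theta>1 x \<partial>\<mu>)"
    using L(1) unfolding Lp_character_on_def by blast
  obtain \<theta>2 where t2: "\<theta>2 \<in> borel_measurable \<mu>" "\<And>x. x \<in> carrier G \<Longrightarrow> x \<notin> K \<inter> S' \<Longrightarrow> \<theta>2 x = 0"
    "integrable \<mu> (\<lambda>x. cmod (\<theta>2 x) powr p)"
    "\<And>f. test_function G f \<Longrightarrow> (\<forall>x\<in>carrier G. x \<notin> K \<inter> S' \<longrightarrow> f x = 0) \<Longrightarrow>
       integrable \<mu> (\<lambda>x. f x * \<theta>2 x) \<and> character_distribution \<mu> s V \<pi> f = (\<integral>x. f x * \<theta>2 x \<partial>\<mu>)"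
    using L(2) unfolding Lp_character_on_def by blast
  define \<theta> where "\<theta> x = (if x \<in> S then \<theta>1 x else \<theta>2 x)" for x
  have Sm: "S \<inter> space \<mu> \<in> sets \<mu>"
    unfolding space_haar by (rule open_measurable) (use S in \<open>auto simp: openin_open\<close>)
  have meas: "\<theta> \<in> borel_measurable \<mu>"
    unfolding \<theta>_def[abs_def] by (rule measurable_If_set[OF t1(1) t2(1) Sm])
  show ?thesis
    unfolding Lp_character_on_def
  proof (intro exI[of _ \<theta>] conjI allI ballI impI)
    show "\<theta> \<in> borel_measurable \<mu>" by (rule meas)
    show "\<theta> x = 0" if "x \<in> carrier G" "x \<notin> K \<inter> (S \<union> S')" for x
      using that t1(2) t2(2) by (auto simp: \<theta>_def)
    show "integrable \<mu> (\<lambda>x. cmod (\<theta> x) powr p)"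
    proof (rule Bochner_Integration.integrable_bound)
      show "integrable \<mu> (\<lambda>x. cmod (\<theta>1 x) powr p + cmod (\<theta>2 x) powr p)" using t1 t2 by simp
      show "(\<lambda>x. cmod (\<theta> x) powr p) \<in> borel_measurable \<mu>" using meas by simp
    qed (auto simp: \<theta>_def)
    fix f assume f: "test_function G f \<and> (\<forall>x\<in>carrier G. x \<notin> K \<inter> (S \<union> S') \<longrightarrow> f x = 0)"
    define f1 where "f1 x = (if x \<in> S then f x else 0)" for x
    define f2 where "f2 x = (if x \<in> - S then f x else 0)" for x
    have test: "test_function G f1" "test_function G f2"
      unfolding f1_def[abs_def] f2_def[abs_def]
      using test_function_restrict[of f S] test_function_restrict[of f "- S"] f S by blast+
    have I1: "integrable \<mu> (\<lambda>x. f1 x * \<theta>1 x)" "character_distribution \<mu> s V \<pi> f1 = (\<integral>x. f1 x * \<theta>1 x \<partial>\<mu>)"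
      using t1(4)[OF test(1)] f by (auto simp: f1_def)
    have I2: "integrable \<mu> (\<lambda>x. f2 x * \<theta>2 x)" "character_distribution \<mu> s V \<pi> f2 = (\<integral>x. f2 x * \<theta>2 x \<partial>\<mu>)"
      using t2(4)[OF test(2)] f by (auto simp: f2_def)
    have eq: "f x * \<theta> x = f1 x * \<theta>1 x + f2 x * \<theta>2 x" for x
      by (auto simp: f1_def f2_def \<theta>_def)
    show "integrable \<mu> (\<lambda>x. f x * \<theta> x)" unfolding eq using I1 I2 by simp
    have lint: "locally_integrable G \<mu> \<theta>\<^sub>0" using th0 by (simp add: character_function_def)
    have "character_distribution \<mu> s V \<pi> f = (\<integral>x. f x * \<theta>\<^sub>0 x \<partial>\<mu>)"
      using th0 f by (simp add: character_function_def)
    also have "\<dots> = (\<integral>x. f1 x * \<theta>\<^sub>0 x + f2 x * \<theta>\<^sub>0 x \<partial>\<mu>)"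
      by (intro Bochner_Integration.integral_cong refl) (auto simp: f1_def f2_def)
    also have "\<dots> = (\<integral>x. f1 x * \<theta>\<^sub>0 x \<partial>\<mu>) + (\<integral>x. f2 x * \<theta>\<^sub>0 x \<partial>\<mu>)"
      by (intro Bochner_Integration.integral_add test_function_times_integrable test lint)
    also have "\<dots> = character_distribution \<mu> s V \<pi> f1 + character_distribution \<mu> s V \<pi> f2"
      using th0 test by (simp add: character_function_def)
    also have "\<dots> = (\<integral>x. f x * \<theta> x \<partial>\<mu>)"
      unfolding eq using I1 I2 by simp
    finally show "character_distribution \<mu> s V \<pi> f = (\<integral>x. f x * \<theta> x \<partial>\<mu>)" .
  qed
qed

text \<open>Passing from \<open>p'\<close> to a smaller exponent is possible as \<open>K\<close> has finite volume: there
  \<open>|\<theta>|\<^sup>p \<le> 1 + |\<theta>|\<^sup>p\<^sup>'\<close>.\<close>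

lemma Lp_character_on_clopen:
  assumes S: "open S" "closed S" "S \<subseteq> ball y r" and p: "0 < p" "p \<le> p'"
    and th: "character_function G \<mu> s V \<pi> \<theta>" and L: "in_Lp_on \<mu> p' (ball y r \<inter> carrier G) \<theta>"
  shows "Lp_character_on p S"
proof -
  define \<theta>' where "\<theta>' x = (if x \<in> K \<inter> S then \<theta> x else 0)" for x
  have lint: "locally_integrable G \<mu> \<theta>" using th by (simp add: character_function_def)
  have KSo: "openG (K \<inter> S)" using K_open S by (auto intro: openin_Int_open)
  have KS: "K \<inter> S \<in> sets \<mu>" by (rule open_measurable[OF KSo])
  have KS': "(K \<inter> S) \<inter> space \<mu> \<in> sets \<mu>" using KS by auto
  have meas: "\<theta>' \<in> borel_measurable \<mu>"
    unfolding \<theta>'_def[abs_def] using lint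
    by (intro measurable_If_set[OF _ _ KS']) (auto simp: locally_integrable_def)
  show ?thesis
    unfolding Lp_character_on_def
  proof (intro exI[of _ \<theta>'] conjI allI ballI impI)
    show "\<theta>' \<in> borel_measurable \<mu>" by (rule meas)
    show "\<theta>' x = 0" if "x \<notin> K \<inter> S" for x using that unfolding \<theta>'_def by (rule if_not_P)
    have "set_integrable \<mu> (K \<inter> S) (\<lambda>g. cmod (\<theta> g) powr p')"
      using L K_subset S(3) by (intro set_integrable_subset[OF _ KS]) (auto simp: in_Lp_on_def)
    then have "integrable \<mu> (\<lambda>x. indicator (K \<inter> S) x *\<^sub>R (cmod (\<theta> x) powr p'))"
      by (simp add: set_integrable_def)
    moreover have "integrable \<mu> (indicator K :: 'g \<Rightarrow> real)"
      using K_measurable K_finite by (simp add: integrable_indicator_iff)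
    ultimately have int: "integrable \<mu> (\<lambda>x. indicator K x + indicator (K \<inter> S) x *\<^sub>R (cmod (\<theta> x) powr p'))"
      by simp
    show "integrable \<mu> (\<lambda>x. cmod (\<theta>' x) powr p)"
    proof (rule Bochner_Integration.integrable_bound[OF int])
      show "(\<lambda>x. cmod (\<theta>' x) powr p) \<in> borel_measurable \<mu>" using meas by simp
      show "AE x in \<mu>. norm (cmod (\<theta>' x) powr p)
          \<le> norm (indicator K x + indicator (K \<inter> S) x *\<^sub>R (cmod (\<theta> x) powr p') :: real)"
      proof (rule AE_I2)
        fix x
        have "a powr p \<le> 1 + a powr p'" if "a \<ge> 0" for a :: real
        proof (cases "a \<le> 1")
          case True
          then have "a powr p \<le> 1 powr p" using that p by (intro powr_mono2) auto
          then show ?thesis by simp (meson add_increasing2 powr_ge_zero)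
        next
          case False
          then have "a powr p \<le> a powr p'" using p by (intro powr_mono) auto
          then show ?thesis by simp
        qed
        then show "norm (cmod (\<theta>' x) powr p)
          \<le> norm (indicator K x + indicator (K \<inter> S) x *\<^sub>R (cmod (\<theta> x) powr p') :: real)"
          by (auto simp: \<theta>'_def indicator_def)
      qed
    qed
    fix f assume f: "test_function G f \<and> (\<forall>x\<in>carrier G. x \<notin> K \<inter> S \<longrightarrow> f x = 0)"
    have eq: "f x * \<theta>' x = f x * \<theta> x" if "x \<in> space \<mu>" for x
      using f that by (auto simp: \<theta>'_def space_haar)
    have "integrable \<mu> (\<lambda>x. f x * \<theta>' x) \<longleftrightarrow> integrable \<mu> (\<lambda>x. f x * \<theta> x)"
      by (rule Bochner_Integration.integrable_cong) (simp_all add: eq)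
    then show "integrable \<mu> (\<lambda>x. f x * \<theta>' x)"
      using test_function_times_integrable[OF _ lint] f by blast
    have "(\<integral>x. f x * \<theta>' x \<partial>\<mu>) = (\<integral>x. f x * \<theta> x \<partial>\<mu>)"
      by (rule Bochner_Integration.integral_cong) (simp_all add: eq)
    then show "character_distribution \<mu> s V \<pi> f = (\<integral>x. f x * \<theta>' x \<partial>\<mu>)"
      using th f by (simp add: character_function_def)
  qed
qed

lemma Lp_character_on_empty:
  assumes th0: "character_function G \<mu> s V \<pi> \<theta>\<^sub>0"
  shows "Lp_character_on p {}"
  unfolding Lp_character_on_def
proof (intro exI[of _ "\<lambda>_. 0"] conjI allI ballI impI)
  fix f assume f: "test_function G f \<and> (\<forall>x\<in>carrier G. x \<notin> K \<inter> {} \<longrightarrow> f x = 0)"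
  have "(\<integral>x. f x * \<theta>\<^sub>0 x \<partial>\<mu>) = (\<integral>x. 0 \<partial>\<mu>)"
    using f by (intro Bochner_Integration.integral_cong) (auto simp: space_haar)
  then show "character_distribution \<mu> s V \<pi> f = (\<integral>x. f x * 0 \<partial>\<mu>)"
    using th0 f by (simp add: character_function_def)
qed auto

text \<open>Each point of \<open>K\<close> has a clopen neighbourhood on which some version of the character function
  has an exponent \<open>1 + t\<close> with \<open>t > \<epsilon>\<close>.  Finitely many of these neighbourhoods cover \<open>K\<close>.\<close>

lemma Lp_character_on_K:
  assumes e: "0 < \<epsilon>" "ereal \<epsilon> < eps_star G \<mu> s V \<pi>"
  shows "Lp_character_on (1 + \<epsilon>) UNIV"
proof -
  have "\<exists>S \<theta>. open S \<and> closed S \<and> x \<in> S \<and> character_function G \<mu> s V \<pi> \<theta> \<and> Lp_character_on (1 + \<epsilon>) S"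
    if x: "x \<in> K" for x
  proof -
    have xG: "x \<in> carrier G" using x K_subset by auto
    have "eps_star G \<mu> s V \<pi> \<le> eps_star_at G \<mu> s V \<pi> x"
      unfolding eps_star_def by (rule INF_lower[OF xG])
    then have "ereal \<epsilon> < eps_star_at G \<mu> s V \<pi> x" by (rule order_less_le_trans[OF e(2)])
    then obtain t \<theta> y r where t: "\<epsilon> < t" "character_function G \<mu> s V \<pi> \<theta>" "x \<in> ball y r"
      "in_Lp_on \<mu> (1 + t) (ball y r \<inter> carrier G) \<theta>"
      unfolding eps_star_at_def less_Sup_iff by auto
    obtain S where S: "open S" "closed S" "x \<in> S" "S \<subseteq> ball y r"
      using clopen_base[OF xG open_ball t(3)] by blast
    have "Lp_character_on (1 + \<epsilon>) S"
      by (rule Lp_character_on_clopen[OF S(1,2,4) _ _ t(2,4)]) (use e t in auto)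
    then show ?thesis using S t by blast
  qed
  then obtain S \<theta> where S: "\<And>x. x \<in> K \<Longrightarrow> open (S x) \<and> closed (S x) \<and> x \<in> S x \<and>
      character_function G \<mu> s V \<pi> (\<theta> x) \<and> Lp_character_on (1 + \<epsilon>) (S x)"
    by metis
  obtain F where F: "F \<subseteq> K" "finite F" "K \<subseteq> (\<Union>x\<in>F. S x)"
    using compactE_image[OF K_compact, of K S] S by blast
  have th0: "character_function G \<mu> s V \<pi> (\<theta> \<one>)"
    using S[of \<one>] subgroup.one_closed[OF K_subgroup] by blast
  have "Lp_character_on (1 + \<epsilon>) (\<Union>x\<in>F. S x)"
    using F(2,1)
  proof (induction F rule: finite_induct)
    case empty
    then show ?case using Lp_character_on_empty[OF th0] by simp
  next
    case (insert x F)
    then have "Lp_character_on (1 + \<epsilon>) (S x \<union> (\<Union>x\<in>F. S x))"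
      using S[of x] e by (intro Lp_character_on_Un[OF _ _ _ _ th0]) auto
    then show ?case by simp
  qed
  then show ?thesis
    unfolding Lp_character_on_def using F(3) by (simp add: Int_absorb2)
qed

end


section \<open>The multiplicity bound\<close>

text \<open>Here \<open>a\<close> stands for \<open>|\<chi>|\<close>, \<open>b\<close> for \<open>|\<theta>|\<close>, and \<open>d\<close> for the dimension.  Young's inequality with the
  conjugate exponents \<open>1 + \<epsilon>\<close> and \<open>q = (1 + \<epsilon>) / \<epsilon>\<close> is applied to \<open>b\<close> and \<open>a / d\<^sup>\<alpha>\<close>.  By
  \<open>a \<le> d\<close> and \<open>\<alpha> q = q - 2 \<ge> 0\<close>, the \<open>q\<close>-th power of the latter is at most \<open>a\<^sup>2\<close>, whose integral over
  \<open>K\<close> is bounded independently of \<open>d\<close>.\<close>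

lemma Young_character_bound:
  fixes a b d \<epsilon> :: real
  assumes "0 \<le> a" "a \<le> d" "1 \<le> d" "0 \<le> b" "0 < \<epsilon>" "\<epsilon> \<le> 1"
  shows "a * b \<le> d powr (1 - 2 * \<epsilon> / (1 + \<epsilon>)) * (b powr (1 + \<epsilon>) + a\<^sup>2)"
proof (cases "a = 0")
  case False
  define \<alpha> where "\<alpha> = 1 - 2 * \<epsilon> / (1 + \<epsilon>)"
  define q where "q = (1 + \<epsilon>) / \<epsilon>"
  have q: "q \<ge> 2" using assms by (simp add: q_def field_simps)
  have "\<alpha> = (1 - \<epsilon>) / (1 + \<epsilon>)" using assms by (simp add: \<alpha>_def field_simps)
  then have "\<alpha> * q = (1 - \<epsilon>) / \<epsilon>" using assms by (simp add: q_def)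
  also have "\<dots> = q - 2" using assms by (simp add: q_def field_simps)
  finally have aq: "\<alpha> * q = q - 2" .
  have a: "a > 0" using False assms by simp
  have dp: "d powr \<alpha> > 0" using assms by simp
  have "(a / d powr \<alpha>) powr q = a powr q / d powr (q - 2)"
    using a dp by (simp add: powr_divide powr_powr aq)
  also have "a powr q = a powr (q - 2) * a\<^sup>2"
    using a by (simp add: powr_diff powr_numeral)
  also have "a powr (q - 2) * a\<^sup>2 / d powr (q - 2) \<le> d powr (q - 2) * a\<^sup>2 / d powr (q - 2)"
    using assms q by (intro divide_right_mono mult_right_mono powr_mono2) auto
  also have "\<dots> = a\<^sup>2" using assms by simp
  finally have le: "(a / d powr \<alpha>) powr q \<le> a\<^sup>2" .
  have "b * (a / d powr \<alpha>) \<le> b powr (1 + \<epsilon>) / (1 + \<epsilon>) + (a / d powr \<alpha>) powr q / q"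
    using assms q a dp by (intro Youngs_inequality) (auto simp: q_def field_simps)
  also have "\<dots> \<le> b powr (1 + \<epsilon>) + a\<^sup>2"
  proof (rule add_mono)
    show "b powr (1 + \<epsilon>) / (1 + \<epsilon>) \<le> b powr (1 + \<epsilon>)"
      using assms by (simp add: field_simps)
    have "(a / d powr \<alpha>) powr q / q \<le> (a / d powr \<alpha>) powr q / 1"
      using q by (intro divide_left_mono) auto
    then show "(a / d powr \<alpha>) powr q / q \<le> a\<^sup>2" using le by simp
  qed
  finally have "d powr \<alpha> * (b * (a / d powr \<alpha>)) \<le> d powr \<alpha> * (b powr (1 + \<epsilon>) + a\<^sup>2)"
    using dp by (intro mult_left_mono) auto
  then show ?thesis using dp by (simp add: \<alpha>_def mult.commute)
qed (use assms in auto)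

lemma dim_le_of_injective:
  assumes s: "vector_space s" and s': "vector_space s'" and V: "module.subspace s V" "finite_dim s V"
    and B: "is_basis s' W B" and T: "linear_between s' W s V T"
    and inj: "\<And>w. w \<in> W \<Longrightarrow> T w = 0 \<Longrightarrow> w = 0"
  shows "vector_space.dim s' W \<le> vector_space.dim s V"
proof -
  interpret s: vector_space s by fact
  interpret s': vector_space s' by fact
  note B' = is_basisD[OF s' B]
  obtain D where D: "is_basis s V D" using is_basis_exists[OF s V] by blast
  note D' = is_basisD[OF s D]
  have BW: "b \<in> B \<Longrightarrow> b \<in> W" for b using B'(5) by auto
  have injB: "inj_on T B"
  proof (rule inj_onI)
    fix x y assume xy: "x \<in> B" "y \<in> B" "T x = T y"
    have m: "s' (-1) y \<in> W" by (rule s'.subspace_scale[OF B'(4) BW[OF xy(2)]])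
    have "T (x + s' (-1) y) = T x + T (s' (-1) y)"
      by (rule linear_betweenD(2)[OF T BW[OF xy(1)] m])
    also have "T (s' (-1) y) = s (-1) (T y)"
      by (rule linear_betweenD(3)[OF T BW[OF xy(2)]])
    also have "T x + s (-1) (T y) = 0" using xy by simp
    finally have "x + s' (-1) y = 0"
      by (rule inj[OF s'.subspace_add[OF B'(4) BW[OF xy(1)] m]])
    then show "x = y" by simp
  qed
  have "s.independent (T ` B)"
  proof
    assume "s.dependent (T ` B)"
    then obtain u v where u: "v \<in> T ` B" "u v \<noteq> 0" "(\<Sum>v\<in>T ` B. s (u v) v) = 0"
      using s.dependent_finite[of "T ` B"] B'(1) by auto
    obtain b where b: "b \<in> B" "v = T b" using u by auto
    have "T (\<Sum>b\<in>B. s' (u (T b)) b) = (\<Sum>b\<in>B. T (s' (u (T b)) b))"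
      using BW by (intro linear_between_sum[OF s' T s B'(4)]) (auto intro: s'.subspace_scale[OF B'(4)])
    also have "\<dots> = (\<Sum>b\<in>B. s (u (T b)) (T b))"
      using BW by (intro sum.cong refl linear_betweenD(3)[OF T]) auto
    also have "\<dots> = 0" using u(3) by (simp add: sum.reindex[OF injB])
    finally have "(\<Sum>b\<in>B. s' (u (T b)) b) = 0"
      using BW by (intro inj s'.subspace_sum[OF B'(4)] s'.subspace_scale[OF B'(4)])
    then have "u (T b) = 0"
      using s'.independentD[OF B'(2,1) subset_refl, of "\<lambda>b. u (T b)"] b by simp
    then show False using u b by simp
  qed
  moreover have "T ` B \<subseteq> s.span D" using D'(3) linear_betweenD(1)[OF T] BW by auto
  ultimately have "card (T ` B) \<le> card D"
    using s.independent_span_bound[OF D'(1)] by blast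
  then show ?thesis by (simp add: card_image[OF injB] B'(7) D'(7))
qed

text \<open>The kernel of an intertwining map is an invariant subspace.\<close>

lemma injective_Hom_rep_irreducible:
  assumes s: "vector_space s" and V: "module.subspace s V"
    and rho: "\<And>k. k \<in> carrier H \<Longrightarrow> linear_between s V s V (\<rho> k)"
    and tau: "Defs.representation H s' W \<tau>" and irr: "irreducible_rep H s' W \<tau>"
    and T: "T \<in> Hom_rep H s' W \<tau> s V \<rho>" "T \<noteq> 0" and w: "w \<in> W" "T w = 0"
  shows "w = 0"
proof -
  note r = representationD[OF tau]
  interpret s: vector_space s by fact
  interpret s': vector_space s' by (rule r(1))
  have lin: "linear_between s' W s V T" and out: "\<And>w. w \<notin> W \<Longrightarrow> T w = 0"
    and eq: "\<And>k w. k \<in> carrier H \<Longrightarrow> w \<in> W \<Longrightarrow> T (\<tau> k w) = \<rho> k (T w)"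
    using T(1) by (auto simp: Hom_rep_def)
  let ?N = "{w \<in> W. T w = 0}"
  have "invariant_subspace H s' W \<tau> ?N"
    unfolding invariant_subspace_def
  proof (intro conjI ballI)
    show "s'.subspace ?N"
      by (rule s'.subspaceI)
        (auto simp: s'.subspace_0[OF r(2)] s'.subspace_add[OF r(2)] s'.subspace_scale[OF r(2)]
          linear_betweenD(2,3)[OF lin] linear_between_zero[OF r(1) lin s r(2)])
    show "\<tau> g ` ?N \<subseteq> ?N" if "g \<in> carrier H" for g
      using that r(6) by (auto simp: eq linear_between_zero[OF s rho s V])
  qed auto
  then have "?N = {0} \<or> ?N = W" using irr by (auto simp: irreducible_rep_def)
  moreover have "?N \<noteq> W"
  proof
    assume "?N = W"
    then have "T x = 0" for x using out by (cases "x \<in> W") auto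
    then show False using T(2) by (auto simp: fun_eq_iff)
  qed
  ultimately show ?thesis using w by auto
qed

context smooth_admissible_rep
begin

interpretation vs: vector_space s by (rule representationD(1)[OF rep])

text \<open>The multiplicity formula, with the integrand \<open>cnj \<chi> \<cdot> \<theta>\<close> bounded pointwise by \<open>h\<close>.\<close>

lemma multiplicity_le_integral:
  assumes \<theta>: "\<And>f. test_function G f \<Longrightarrow> (\<forall>x\<in>carrier G. x \<notin> K \<longrightarrow> f x = 0) \<Longrightarrow>
       integrable \<mu> (\<lambda>x. f x * \<theta> x) \<and> character_distribution \<mu> s V \<pi> f = (\<integral>x. f x * \<theta> x \<partial>\<mu>)"
    and N: "open_normal N" and tau: "Defs.representation GK s' W \<tau>"
    and triv: "\<forall>n\<in>N. \<forall>w\<in>W. \<tau> n w = w" and B: "is_basis s' W B"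
    and h: "integrable \<mu> h" "\<And>x. x \<in> carrier G \<Longrightarrow> cmod (conj_character s' B \<tau> x) * cmod (\<theta> x) \<le> h x"
  shows "measure \<mu> K * real (vector_space.dim (pointwise_scale s) (Hom_rep GK s' W \<tau> s V \<pi>)) \<le> integral\<^sup>L \<mu> h"
proof -
  let ?f = "conj_character s' B \<tau>"
    and ?m = "vector_space.dim (pointwise_scale s) (Hom_rep GK s' W \<tau> s V \<pi>)"
  have f: "integrable \<mu> (\<lambda>x. ?f x * \<theta> x)" "character_distribution \<mu> s V \<pi> ?f = (\<integral>x. ?f x * \<theta> x \<partial>\<mu>)"
    using \<theta>[OF test_function_conj_character[OF N tau triv B]] conj_character_outside by auto
  have "complex_of_real (measure \<mu> K * real ?m) = (\<integral>x. ?f x * \<theta> x \<partial>\<mu>)"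
    using multiplicity_eq_character_distribution(2)[OF N tau triv B] f(2) by simp
  then have "measure \<mu> K * real ?m = cmod (\<integral>x. ?f x * \<theta> x \<partial>\<mu>)"
    by (metis abs_of_nonneg measure_nonneg mult_nonneg_nonneg norm_of_real of_nat_0_le_iff)
  also have "\<dots> \<le> (\<integral>x. cmod (?f x * \<theta> x) \<partial>\<mu>)" by (rule integral_norm_bound)
  also have "\<dots> \<le> integral\<^sup>L \<mu> h"
    using h(2) by (intro integral_mono integrable_norm f(1) h(1)) (simp add: norm_mult space_haar)
  finally show ?thesis .
qed

text \<open>Let \<open>V\<^sup>N\<close> be a proper subspace of \<open>V\<^sup>M\<close>.  By symmetry \<open>End\<^sub>K(V\<^sup>N) = Hom\<^sub>K(V\<^sup>N, V\<^sup>M)\<close> has the same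
  dimension as \<open>Hom\<^sub>K(V\<^sup>M, V\<^sup>N)\<close>, and this is a proper subspace of \<open>End\<^sub>K(V\<^sup>M)\<close>: it does not contain the
  identity.  The endomorphism spaces appear as \<open>Hom\<^sub>K(V\<^sup>N, V)\<close>, in the form in which the
  multiplicity formula gives their dimension.\<close>

lemma fixed_space_dim_endomorphisms_mono:
  assumes N: "open_normal N" and M: "open_normal M" "M \<subseteq> N" and ne: "fixed_space V \<pi> M \<noteq> fixed_space V \<pi> N"
  shows "vector_space.dim (pointwise_scale s) (Hom_rep GK s (fixed_space V \<pi> N) \<pi> s V \<pi>) <
    vector_space.dim (pointwise_scale s) (Hom_rep GK s (fixed_space V \<pi> M) \<pi> s V \<pi>)"
proof -
  interpret M: finite_quotient M GK by (rule open_normal_finite_quotient[OF M(1)])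
  interpret p: vector_space "pointwise_scale s" by (rule vector_space_pointwise_scale[OF vs.vector_space_axioms])
  let ?U = "fixed_space V \<pi> N" and ?W = "fixed_space V \<pi> M"
  note rU = representation_fixed_space[OF repK N] and rW = representation_fixed_space[OF repK M(1)]
  note U' = representationD[OF rU] and W' = representationD[OF rW]
  have UW: "?U \<subset> ?W" using fixed_space_antimono[OF M(2)] ne by auto
  have tU: "\<forall>n\<in>N. \<forall>u\<in>?U. \<pi> n u = u" and tW: "\<forall>n\<in>M. \<forall>u\<in>?W. \<pi> n u = u" by (auto simp: fixed_space_def)
  have tU': "\<forall>n\<in>M. \<forall>u\<in>?U. \<pi> n u = u" using tU M(2) by auto
  note fin = finite_dim_fixed_space[OF N] finite_dim_fixed_space[OF M(1)]
  obtain BU BW where BU: "is_basis s ?U BU" and BW: "is_basis s ?W BW"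
    using is_basis_exists U'(1,2) W'(2) fin by meson
  have "p.dim (Hom_rep GK s ?U \<pi> s V \<pi>) = p.dim (Hom_rep GK s ?U \<pi> s ?W \<pi>)"
    by (simp only: Hom_rep_fixed_space[OF M(1) rU tU' BU])
  also have "\<dots> = p.dim (Hom_rep GK s ?W \<pi> s ?U \<pi>)"
    by (rule M.dim_Hom_rep_symmetric[OF rW tW rU tU' fin(2,1)])
  also have "\<dots> < p.dim (Hom_rep GK s ?W \<pi> s ?W \<pi>)"
  proof (rule dim_subset_finite_dim[OF p.vector_space_axioms])
    show "p.subspace (Hom_rep GK s ?W \<pi> s ?W \<pi>)"
      by (rule subspace_Hom_rep[OF U'(1) U'(1) W'(2,3,6)])
    show "p.subspace (Hom_rep GK s ?W \<pi> s ?U \<pi>)"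
      by (rule subspace_Hom_rep[OF U'(1) U'(1) U'(2,3) W'(6)])
    show "finite_dim (pointwise_scale s) (Hom_rep GK s ?W \<pi> s ?W \<pi>)"
      using multiplicity_eq_character_distribution(1)[OF M(1) rW tW BW]
      by (simp only: Hom_rep_fixed_space[OF M(1) rW tW BW])
    define J where "J x = (if x \<in> ?W then x else 0)" for x
    have "J \<in> Hom_rep GK s ?W \<pi> s ?W \<pi>"
      using W'(2,6) vs.subspace_add vs.subspace_scale by (auto simp: Hom_rep_def linear_between_def J_def)
    moreover have "J \<notin> Hom_rep GK s ?W \<pi> s ?U \<pi>"
    proof
      assume "J \<in> Hom_rep GK s ?W \<pi> s ?U \<pi>"
      then have "J x \<in> ?U" if "x \<in> ?W" for x using that by (auto simp: Hom_rep_def linear_between_def)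
      then show False using UW by (auto simp: J_def)
    qed
    moreover have "Hom_rep GK s ?W \<pi> s ?U \<pi> \<subseteq> Hom_rep GK s ?W \<pi> s ?W \<pi>"
      using UW by (auto simp: Hom_rep_def linear_between_def)
    ultimately show "Hom_rep GK s ?W \<pi> s ?U \<pi> \<subset> Hom_rep GK s ?W \<pi> s ?W \<pi>" by blast
  qed
  also have "\<dots> = p.dim (Hom_rep GK s ?W \<pi> s V \<pi>)"
    by (simp only: Hom_rep_fixed_space[OF M(1) rW tW BW])
  finally show ?thesis .
qed

text \<open>Choose \<open>N\<close> with \<open>dim End\<^sub>K(V\<^sup>N)\<close> maximal.  No open normal subgroup of \<open>N\<close> has more fixed vectors
  than \<open>N\<close>, and every vector of \<open>V\<close> is fixed by some open normal subgroup of \<open>N\<close>.\<close>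

lemma finite_dim_of_bounded_endomorphisms:
  assumes "\<And>N. open_normal N \<Longrightarrow>
    vector_space.dim (pointwise_scale s) (Hom_rep GK s (fixed_space V \<pi> N) \<pi> s V \<pi>) \<le> b"
  shows "finite_dim s V"
proof -
  let ?D = "\<lambda>N. vector_space.dim (pointwise_scale s) (Hom_rep GK s (fixed_space V \<pi> N) \<pi> s V \<pi>)"
  have "\<exists>N. open_normal N \<and> (\<forall>M. open_normal M \<longrightarrow> ?D M \<le> ?D N)"
    by (rule ex_has_greatest_nat[of open_normal K ?D "Suc b"]) (use K_open_normal assms in \<open>simp_all add: less_Suc_eq_le\<close>)
  then obtain N where N: "open_normal N" "\<And>M. open_normal M \<Longrightarrow> ?D M \<le> ?D N" by blast
  have "V \<subseteq> fixed_space V \<pi> N"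
  proof
    fix v assume "v \<in> V"
    then obtain M where M: "open_normal M" "v \<in> fixed_space V \<pi> M" using smooth_open_normal by blast
    have MN: "open_normal (M \<inter> N)" by (rule open_normal_Int[OF M(1) N(1)])
    have "fixed_space V \<pi> (M \<inter> N) = fixed_space V \<pi> N"
      using fixed_space_dim_endomorphisms_mono[OF N(1) MN] N(2)[OF MN] by fastforce
    then show "v \<in> fixed_space V \<pi> N" using fixed_space_antimono[of "M \<inter> N" M] M(2) by auto
  qed
  then show ?thesis
    using finite_dim_fixed_space[OF N(1)] finite_dim_subset[OF vs.vector_space_axioms] by blast
qed

text \<open>For \<open>\<epsilon> \<le> 1\<close> the bound is the integral of \<open>Young_character_bound\<close>.  For \<open>\<epsilon> > 1\<close> the
  space \<open>V\<close> is finite-dimensional, and every \<open>\<tau>\<close> that occurs embeds into it.  The power \<open>d\<^sup>\<alpha>\<close> then is at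
  least \<open>(dim V)\<^sup>\<alpha> > 0\<close>, so a bound for the multiplicity alone suffices.  In both cases 1 is added to the
  constant to make the inequality strict.\<close>

theorem multiplicity_bound:
  assumes e: "0 < \<epsilon>" "ereal \<epsilon> < eps_star G \<mu> s V \<pi>"
  shows "\<exists>C::real. C > 0 \<and> (\<forall>(W, \<tau>) \<in> Irr GK.
    edim (pointwise_scale s) (Hom_rep GK (pointwise_scale (*)) W \<tau> s V \<pi>)
      < ereal (C * real (vector_space.dim (pointwise_scale (*)) W) powr (1 - 2 * \<epsilon> / (1 + \<epsilon>))))"
proof -
  let ?vol = "measure \<mu> K" and ?s' = "pointwise_scale (*) :: complex \<Rightarrow> (nat \<Rightarrow> complex) \<Rightarrow> nat \<Rightarrow> complex"
  define \<alpha> where "\<alpha> = 1 - 2 * \<epsilon> / (1 + \<epsilon>)"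
  note vol = measure_K_pos
  have divide: "x \<le> b / v * a" if "0 < v" "v * x \<le> a * b" for x a b v :: real
    using that by (simp add: pos_le_divide_eq mult_ac)
  obtain \<theta> where th: "\<theta> \<in> borel_measurable \<mu>" "\<And>x. x \<in> carrier G \<Longrightarrow> x \<notin> K \<Longrightarrow> \<theta> x = 0"
    "integrable \<mu> (\<lambda>x. cmod (\<theta> x) powr (1 + \<epsilon>))"
    "\<And>f. test_function G f \<Longrightarrow> (\<forall>x\<in>carrier G. x \<notin> K \<longrightarrow> f x = 0) \<Longrightarrow>
       integrable \<mu> (\<lambda>x. f x * \<theta> x) \<and> character_distribution \<mu> s V \<pi> f = (\<integral>x. f x * \<theta> x \<partial>\<mu>)"
    using Lp_character_on_K[OF e] unfolding Lp_character_on_def by (simp only: Int_UNIV_right) blast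
  define m where "m W \<tau> = vector_space.dim (pointwise_scale s) (Hom_rep GK ?s' W \<tau> s V \<pi>)" for W \<tau>
  have irr: "\<exists>N B. open_normal N \<and> (\<forall>n\<in>N. \<forall>w\<in>W. \<tau> n w = w) \<and> is_basis ?s' W B \<and>
      Defs.representation GK ?s' W \<tau> \<and> irreducible_rep GK ?s' W \<tau> \<and> vector_space.dim ?s' W \<ge> 1 \<and>
      edim (pointwise_scale s) (Hom_rep GK ?s' W \<tau> s V \<pi>) = ereal (real (m W \<tau>))"
    if "(W, \<tau>) \<in> Irr GK" for W \<tau>
  proof -
    have W: "Defs.representation GK ?s' W \<tau>" "smooth_rep GK ?s' W \<tau>" "irreducible_rep GK ?s' W \<tau>"
      using \<open>(W, \<tau>) \<in> Irr GK\<close> by (auto simp: Irr_def)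
    note W' = representationD[OF W(1)]
    obtain N where N: "open_normal N" "\<forall>n\<in>N. \<forall>w\<in>W. \<tau> n w = w"
      using irreducible_smooth_rep(2)[OF W] by blast
    obtain B where B: "is_basis ?s' W B"
      using is_basis_exists[OF W'(1,2) irreducible_smooth_rep(1)[OF W]] by blast
    note B' = is_basisD[OF W'(1) B]
    interpret s': vector_space ?s' by (rule W'(1))
    have "B \<noteq> {}" using B'(3) W(3) by (auto simp: irreducible_rep_def)
    then have "card B \<ge> 1" using B'(1) by (simp add: Suc_le_eq card_gt_0_iff)
    then show ?thesis
      using N B W B'(7) multiplicity_eq_character_distribution(1)[OF N(1) W(1) N(2) B]
      by (intro exI[of _ N] exI[of _ B]) (simp add: edim_def m_def)
  qed
  have "\<exists>C>0. \<forall>W \<tau>. (W, \<tau>) \<in> Irr GK \<longrightarrow> real (m W \<tau>) < C * real (vector_space.dim ?s' W) powr \<alpha>"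
  proof (cases "\<epsilon> \<le> 1")
    case True
    let ?I = "\<integral>x. cmod (\<theta> x) powr (1 + \<epsilon>) \<partial>\<mu>"
    have I0: "?I \<ge> 0" by (rule integral_nonneg_AE) simp
    have "real (m W \<tau>) < ((?I + ?vol) / ?vol + 1) * real (vector_space.dim ?s' W) powr \<alpha>"
      if W: "(W, \<tau>) \<in> Irr GK" for W \<tau>
    proof -
      obtain N B where N: "open_normal N" and triv: "\<forall>n\<in>N. \<forall>w\<in>W. \<tau> n w = w" and B: "is_basis ?s' W B"
        and tau: "Defs.representation GK ?s' W \<tau>" and ir: "irreducible_rep GK ?s' W \<tau>"
        and d: "vector_space.dim ?s' W \<ge> 1"
        using irr[OF W] by blast
      let ?d = "real (vector_space.dim ?s' W)" and ?f = "conj_character ?s' B \<tau>"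
      have d1: "?d \<ge> 1" using d by simp
      note int = integral_norm_conj_character(1)[OF N tau triv B]
        integral_norm_conj_character_irreducible[OF N tau triv B ir]
      have "?vol * real (m W \<tau>) \<le> (\<integral>x. ?d powr \<alpha> * (cmod (\<theta> x) powr (1 + \<epsilon>) + (cmod (?f x))\<^sup>2) \<partial>\<mu>)"
        unfolding m_def
      proof (rule multiplicity_le_integral[OF th(4) N tau triv B])
        show "integrable \<mu> (\<lambda>x. ?d powr \<alpha> * (cmod (\<theta> x) powr (1 + \<epsilon>) + (cmod (?f x))\<^sup>2))"
          using th(3) int(1) by simp
        show "cmod (?f x) * cmod (\<theta> x) \<le> ?d powr \<alpha> * (cmod (\<theta> x) powr (1 + \<epsilon>) + (cmod (?f x))\<^sup>2)" for x
          unfolding \<alpha>_def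
          using norm_conj_character_le[OF N tau triv B] d1 e True by (intro Young_character_bound) auto
      qed
      also have "\<dots> = ?d powr \<alpha> * (?I + (\<integral>x. (cmod (?f x))\<^sup>2 \<partial>\<mu>))"
        using th(3) int(1) by simp
      also have "\<dots> \<le> ?d powr \<alpha> * (?I + ?vol)"
        using int(2) by (intro mult_left_mono) auto
      finally have "real (m W \<tau>) \<le> (?I + ?vol) / ?vol * ?d powr \<alpha>"
        by (rule divide[OF vol])
      also have "\<dots> < ((?I + ?vol) / ?vol + 1) * ?d powr \<alpha>"
        using d1 by (intro mult_strict_right_mono) auto
      finally show ?thesis .
    qed
    moreover have "(?I + ?vol) / ?vol + 1 > 0" using I0 vol by (simp add: add_nonneg_pos)
    ultimately show ?thesis by blast
  next
    case False
    \<comment> \<open>Square-integrability follows from \<open>|\<theta>|\<^sup>2 \<le> 1 + |\<theta>|\<^sup>1\<^sup>+\<^sup>\<epsilon>\<close> on \<open>K\<close>, as \<open>\<epsilon> > 1\<close>.\<close>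
    have th2: "integrable \<mu> (\<lambda>x. (cmod (\<theta> x))\<^sup>2)"
    proof (rule Bochner_Integration.integrable_bound)
      show "integrable \<mu> (\<lambda>x. indicator K x + cmod (\<theta> x) powr (1 + \<epsilon>))"
        using th(3) K_measurable K_finite by (simp add: integrable_indicator_iff)
      show "(\<lambda>x. (cmod (\<theta> x))\<^sup>2) \<in> borel_measurable \<mu>" using th(1) by simp
      show "AE x in \<mu>. norm ((cmod (\<theta> x))\<^sup>2) \<le> norm (indicator K x + cmod (\<theta> x) powr (1 + \<epsilon>))"
      proof (rule AE_I2)
        fix x assume x: "x \<in> space \<mu>"
        have "(cmod (\<theta> x))\<^sup>2 \<le> indicator K x + cmod (\<theta> x) powr (1 + \<epsilon>)"
        proof (cases "x \<in> K")
          case False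
          then show ?thesis using x th(2) by (simp add: space_haar)
        next
          case True
          show ?thesis
          proof (cases "cmod (\<theta> x) \<le> 1")
            case True
            then have "(cmod (\<theta> x))\<^sup>2 \<le> 1" by (simp add: power_le_one)
            then show ?thesis using \<open>x \<in> K\<close> by simp (meson add_increasing2 powr_ge_zero)
          next
            case c: False
            then have "(cmod (\<theta> x))\<^sup>2 = cmod (\<theta> x) powr 2" by (simp add: powr_numeral)
            also have "\<dots> \<le> cmod (\<theta> x) powr (1 + \<epsilon>)" using c False by (intro powr_mono) auto
            finally show ?thesis using \<open>x \<in> K\<close> by simp
          qed
        qed
        then show "norm ((cmod (\<theta> x))\<^sup>2) \<le> norm (indicator K x + cmod (\<theta> x) powr (1 + \<epsilon>))" by simp
      qed
    qed
    let ?J = "\<integral>x. (cmod (\<theta> x))\<^sup>2 \<partial>\<mu>"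
    have J0: "?J \<ge> 0" by (rule integral_nonneg_AE) simp
    have half: "a * b \<le> (b\<^sup>2 + a\<^sup>2) / 2" for a b :: real
      using sum_squares_bound[of a b] by (simp add: field_simps)
    have mean_le: "(j + f) / 2 \<le> 1 * (j + v)" if "f \<le> v" "0 \<le> j" "0 < v" for f j v :: real
      using that by (simp add: field_simps)
    have "finite_dim s V"
    proof (rule finite_dim_of_bounded_endomorphisms)
      fix N assume N: "open_normal N"
      let ?U = "fixed_space V \<pi> N"
      let ?D = "vector_space.dim (pointwise_scale s) (Hom_rep GK s ?U \<pi> s V \<pi>)"
      note rU = representation_fixed_space[OF repK N]
      have tU: "\<forall>n\<in>N. \<forall>u\<in>?U. \<pi> n u = u" by (auto simp: fixed_space_def)
      obtain B where B: "is_basis s ?U B"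
        using is_basis_exists[OF representationD(1,2)[OF rU] finite_dim_fixed_space[OF N]] by blast
      let ?f = "conj_character s B \<pi>"
      note int = integral_norm_conj_character[OF N rU tU B, unfolded Hom_rep_fixed_space[OF N rU tU B]]
      have "?vol * real ?D \<le> (\<integral>x. ((cmod (\<theta> x))\<^sup>2 + (cmod (?f x))\<^sup>2) / 2 \<partial>\<mu>)"
        by (rule multiplicity_le_integral[OF th(4) N rU tU B]) (use th2 int(1) half in auto)
      also have "\<dots> = (?J + ?vol * real ?D) / 2" using th2 int by simp
      \<comment> \<open>The integral of \<open>|\<chi>|\<^sup>2\<close> is \<open>vol(K) D\<close> itself and is absorbed on the left.\<close>
      finally have "?vol * real ?D \<le> 1 * ?J" by simp
      then have "real ?D \<le> ?J / ?vol * 1" by (rule divide[OF vol])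
      then show "?D \<le> nat \<lfloor>?J / ?vol\<rfloor>" by (simp only: mult_1_right le_nat_floor)
    qed
    define n where "n = vector_space.dim s V"
    have "real (m W \<tau>) < ((?J + ?vol) / ?vol * real n powr (- \<alpha>) + 1) * real (vector_space.dim ?s' W) powr \<alpha>"
      if W: "(W, \<tau>) \<in> Irr GK" for W \<tau>
    proof -
      obtain N B where N: "open_normal N" and triv: "\<forall>n\<in>N. \<forall>w\<in>W. \<tau> n w = w" and B: "is_basis ?s' W B"
        and tau: "Defs.representation GK ?s' W \<tau>" and ir: "irreducible_rep GK ?s' W \<tau>"
        and d: "vector_space.dim ?s' W \<ge> 1"
        using irr[OF W] by blast
      let ?d = "real (vector_space.dim ?s' W)" and ?f = "conj_character ?s' B \<tau>"
      have d1: "?d \<ge> 1" using d by simp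
      have C0: "(?J + ?vol) / ?vol * real n powr (- \<alpha>) \<ge> 0" using J0 vol by simp
      show ?thesis
      proof (cases "m W \<tau> = 0")
        case True
        then show ?thesis using d1 C0 by (auto intro!: mult_pos_pos add_nonneg_pos)
      next
        case m: False
        interpret p: vector_space "pointwise_scale s"
          by (rule vector_space_pointwise_scale[OF vs.vector_space_axioms])
        have "\<not> Hom_rep GK ?s' W \<tau> s V \<pi> \<subseteq> {0}"
          using m p.dim_le_card[of "Hom_rep GK ?s' W \<tau> s V \<pi>" "{}"] by (auto simp: m_def)
        then obtain T where T: "T \<in> Hom_rep GK ?s' W \<tau> s V \<pi>" "T \<noteq> 0" by auto
        have "vector_space.dim ?s' W \<le> n"
          unfolding n_def
        proof (rule dim_le_of_injective[OF vs.vector_space_axioms representationD(1)[OF tau]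
              representationD(2)[OF rep] \<open>finite_dim s V\<close> B])
          show "linear_between ?s' W s V T" using T(1) by (simp add: Hom_rep_def)
          show "w = 0" if "w \<in> W" "T w = 0" for w
            using that representationD(3)[OF repK]
            by (intro injective_Hom_rep_irreducible[OF vs.vector_space_axioms
                  representationD(2)[OF repK] _ tau ir T])
        qed
        then have dn: "?d \<le> real n" by simp
        note int = integral_norm_conj_character(1)[OF N tau triv B]
          integral_norm_conj_character_irreducible[OF N tau triv B ir]
        have "?vol * real (m W \<tau>) \<le> (\<integral>x. ((cmod (\<theta> x))\<^sup>2 + (cmod (?f x))\<^sup>2) / 2 \<partial>\<mu>)"
          unfolding m_def
          by (rule multiplicity_le_integral[OF th(4) N tau triv B]) (use th2 int(1) half in auto)
        also have "\<dots> = (?J + (\<integral>x. (cmod (?f x))\<^sup>2 \<partial>\<mu>)) / 2" using th2 int(1) by simp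
        also have "\<dots> \<le> 1 * (?J + ?vol)" by (rule mean_le[OF int(2) J0 vol])
        finally have "real (m W \<tau>) \<le> (?J + ?vol) / ?vol * 1" by (rule divide[OF vol])
        also have "\<dots> \<le> (?J + ?vol) / ?vol * (real n powr (- \<alpha>) * ?d powr \<alpha>)"
        proof (rule mult_left_mono)
          have "\<alpha> \<le> 0" using False e by (simp add: \<alpha>_def field_simps)
          then have "?d powr (- \<alpha>) \<le> real n powr (- \<alpha>)" using dn d1 by (intro powr_mono2) auto
          then have "?d powr (- \<alpha>) * ?d powr \<alpha> \<le> real n powr (- \<alpha>) * ?d powr \<alpha>"
            by (rule mult_right_mono) simp
          then show "1 \<le> real n powr (- \<alpha>) * ?d powr \<alpha>" using d1 by (simp add: powr_add[symmetric])
          show "0 \<le> (?J + ?vol) / ?vol" using J0 vol by (intro divide_nonneg_nonneg add_nonneg_nonneg) auto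
        qed
        also have "\<dots> = (?J + ?vol) / ?vol * real n powr (- \<alpha>) * ?d powr \<alpha>" by (simp only: mult.assoc)
        also have "\<dots> < ((?J + ?vol) / ?vol * real n powr (- \<alpha>) + 1) * ?d powr \<alpha>"
          using d1 by (intro mult_strict_right_mono) auto
        finally show ?thesis .
      qed
    qed
    moreover have "(?J + ?vol) / ?vol * real n powr (- \<alpha>) + 1 > 0"
      using J0 vol by (intro add_nonneg_pos) auto
    ultimately show ?thesis by blast
  qed
  then obtain C where C: "C > 0"
    "\<And>W \<tau>. (W, \<tau>) \<in> Irr GK \<Longrightarrow> real (m W \<tau>) < C * real (vector_space.dim ?s' W) powr \<alpha>" by blast
  show ?thesis
  proof (intro exI[of _ C] conjI C(1) ballI)
    fix z assume z: "z \<in> Irr GK"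
    obtain W \<tau> where W: "z = (W, \<tau>)" by (cases z)
    have "edim (pointwise_scale s) (Hom_rep GK ?s' W \<tau> s V \<pi>) = ereal (real (m W \<tau>))"
      using irr z unfolding W by blast
    then show "case z of (W, \<tau>) \<Rightarrow> edim (pointwise_scale s) (Hom_rep GK ?s' W \<tau> s V \<pi>)
        < ereal (C * real (vector_space.dim ?s' W) powr (1 - 2 * \<epsilon> / (1 + \<epsilon>)))"
      using C(2) z by (simp add: W \<alpha>_def)
  qed
qed

end


section \<open>Groups of rational points over a non-Archimedean field\<close>

lemma group_GL: "group (GL :: ('k::field ^ 'n::finite ^ 'n) monoid)"
proof (rule groupI)
  fix x y :: "'k ^ 'n ^ 'n"
  assume "x \<in> carrier GL" "y \<in> carrier GL"
  then show "x \<otimes>\<^bsub>GL\<^esub> y \<in> carrier GL" by (simp add: GL_def invertible_mult)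
next
  fix x :: "'k ^ 'n ^ 'n"
  assume "x \<in> carrier GL"
  then obtain y where "x ** y = mat 1" "y ** x = mat 1" by (auto simp: GL_def invertible_def)
  then show "\<exists>y\<in>carrier GL. y \<otimes>\<^bsub>GL\<^esub> x = \<one>\<^bsub>GL\<^esub>"
    by (intro bexI[of _ y]) (auto simp: GL_def invertible_def)
next
  show "\<one>\<^bsub>GL\<^esub> \<in> carrier GL" by (auto simp: GL_def invertible_def intro!: exI[of _ "mat 1"])
qed (simp_all add: GL_def matrix_mul_assoc)

definition to_ac_matrix :: "'f::field ^ 'n::finite ^ 'n \<Rightarrow> 'f alg_closure ^ 'n ^ 'n" where
  "to_ac_matrix A = (\<chi> i j. to_ac (A $ i $ j))"

lemma to_ac_matrix_mult: "to_ac_matrix (A ** B) = to_ac_matrix A ** to_ac_matrix B"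
  by (simp add: to_ac_matrix_def matrix_matrix_mult_def to_ac_sum)

lemma to_ac_matrix_one: "to_ac_matrix (mat 1) = mat 1"
  by (auto simp: to_ac_matrix_def mat_def vec_eq_iff)

lemma det_to_ac_matrix: "det (to_ac_matrix A) = to_ac (det A)"
  by (simp add: det_def to_ac_matrix_def to_ac_sum to_ac_prod)

text \<open>The inverse over the algebraic closure of a matrix with entries in \<open>F\<close> has its entries in
  \<open>F\<close>, because the determinant is nonzero already in \<open>F\<close>.\<close>

lemma group_rational_points:
  fixes \<G> :: "('f::field_char_0 alg_closure ^ 'n::finite ^ 'n) set"
  assumes "subgroup \<G> GL"
  shows "group (rational_points \<G>)"
proof -
  interpret AC: group "GL :: ('f alg_closure ^ 'n ^ 'n) monoid" by (rule group_GL)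
  interpret G: subgroup \<G> GL by fact
  have carrier: "carrier (rational_points \<G>) = {A. to_ac_matrix A \<in> \<G>}"
    by (simp add: rational_points_def to_ac_matrix_def)
  have mult: "x \<otimes>\<^bsub>rational_points \<G>\<^esub> y = x ** y" and one: "\<one>\<^bsub>rational_points \<G>\<^esub> = mat 1" for x y
    by (simp_all add: rational_points_def GL_def)
  show ?thesis
  proof (rule groupI)
    show "x \<otimes>\<^bsub>rational_points \<G>\<^esub> y \<in> carrier (rational_points \<G>)"
      if "x \<in> carrier (rational_points \<G>)" "y \<in> carrier (rational_points \<G>)" for x y
      using that G.m_closed[of "to_ac_matrix x" "to_ac_matrix y"]
      by (simp add: carrier mult to_ac_matrix_mult GL_def)
    show "\<one>\<^bsub>rational_points \<G>\<^esub> \<in> carrier (rational_points \<G>)"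
      using G.one_closed by (simp add: carrier one to_ac_matrix_one GL_def)
    show "\<exists>y\<in>carrier (rational_points \<G>). y \<otimes>\<^bsub>rational_points \<G>\<^esub> x = \<one>\<^bsub>rational_points \<G>\<^esub>"
      if x: "x \<in> carrier (rational_points \<G>)" for x
    proof -
      have xG: "to_ac_matrix x \<in> \<G>" using x by (simp add: carrier)
      then have "invertible (to_ac_matrix x)" using G.subset by (auto simp: GL_def)
      then have "det x \<noteq> 0" by (simp add: invertible_det_nz det_to_ac_matrix)
      then obtain y where y: "x ** y = mat 1" "y ** x = mat 1"
        by (auto simp: invertible_det_nz[symmetric] invertible_def)
      have yx: "to_ac_matrix y ** to_ac_matrix x = mat 1" "to_ac_matrix x ** to_ac_matrix y = mat 1"
        by (simp_all add: to_ac_matrix_mult[symmetric] y to_ac_matrix_one)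
      then have "to_ac_matrix y \<in> carrier GL" by (auto simp: GL_def invertible_def)
      then have "inv\<^bsub>GL\<^esub> (to_ac_matrix x) = to_ac_matrix y"
        using yx xG G.subset by (intro AC.inv_equality) (auto simp: GL_def)
      then have "to_ac_matrix y \<in> \<G>" using G.m_inv_closed[OF xG] by simp
      then show ?thesis using y by (auto simp: carrier mult one)
    qed
  qed (auto simp: mult one matrix_mul_assoc)
qed

context nonarch_local_field_char_0
begin

lemma dist_add_le: "dist (a + b) (c + d) \<le> max (dist a c) (dist b d)"
proof -
  have "dist (a + b) (c + d) = dist ((a - c) + (b - d)) 0"
    by (subst dist_translate) (simp add: algebra_simps)
  also have "\<dots> \<le> max (dist ((a - c) + (b - d)) (b - d)) (dist (b - d) 0)"
    by (rule ultrametric)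
  also have "dist ((a - c) + (b - d)) (b - d) = dist (a - c) 0"
    by (subst dist_translate) simp
  finally show ?thesis by (simp add: dist_translate[of a c] dist_translate[of b d])
qed

lemma dist_mult_left: "dist (c * a) (c * b) = dist c 0 * dist a b"
  by (subst dist_translate, subst (2) dist_translate) (simp add: abs_mult[symmetric] algebra_simps)

end

lemma continuous_on_add_nonarch:
  fixes f g :: "'a::metric_space \<Rightarrow> 'f::nonarch_local_field_char_0"
  assumes "continuous_on S f" "continuous_on S g"
  shows "continuous_on S (\<lambda>x. f x + g x)"
  unfolding continuous_on_iff
proof (intro ballI allI impI)
  fix x and e :: real assume x: "x \<in> S" "0 < e"
  obtain d1 where d1: "d1 > 0" "\<forall>y\<in>S. dist y x < d1 \<longrightarrow> dist (f y) (f x) < e"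
    using assms(1) x unfolding continuous_on_iff by blast
  obtain d2 where d2: "d2 > 0" "\<forall>y\<in>S. dist y x < d2 \<longrightarrow> dist (g y) (g x) < e"
    using assms(2) x unfolding continuous_on_iff by blast
  have "dist (f y + g y) (f x + g x) < e" if "y \<in> S" "dist y x < min d1 d2" for y
    using that d1 d2 dist_add_le[of "f y" "g y" "f x" "g x"] by fastforce
  then show "\<exists>d>0. \<forall>y\<in>S. dist y x < d \<longrightarrow> dist (f y + g y) (f x + g x) < e"
    using d1 d2 by (intro exI[of _ "min d1 d2"]) auto
qed

lemma continuous_on_mult_left_nonarch:
  fixes f :: "'a::metric_space \<Rightarrow> 'f::nonarch_local_field_char_0"
  assumes "continuous_on S f"
  shows "continuous_on S (\<lambda>x. c * f x)"
  unfolding continuous_on_iff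
proof (intro ballI allI impI)
  fix x and e :: real assume x: "x \<in> S" "0 < e"
  let ?e = "e / (dist c 0 + 1)"
  have c: "dist c 0 + 1 > 0" by (simp add: add_nonneg_pos)
  then have "?e > 0" using x by simp
  then obtain d where d: "d > 0" "\<forall>y\<in>S. dist y x < d \<longrightarrow> dist (f y) (f x) < ?e"
    using assms x unfolding continuous_on_iff by blast
  have "dist (c * f y) (c * f x) < e" if "y \<in> S" "dist y x < d" for y
  proof -
    have "dist c 0 * dist (f y) (f x) \<le> (dist c 0 + 1) * dist (f y) (f x)"
      by (intro mult_right_mono) auto
    also have "\<dots> < (dist c 0 + 1) * ?e" using d that c by (intro mult_strict_left_mono) auto
    also have "\<dots> = e" using c by simp
    finally show ?thesis by (simp add: dist_mult_left)
  qed
  then show "\<exists>d>0. \<forall>y\<in>S. dist y x < d \<longrightarrow> dist (c * f y) (c * f x) < e" using d(1) by blast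
qed

lemma continuous_on_sum_nonarch:
  fixes f :: "'i \<Rightarrow> 'a::metric_space \<Rightarrow> 'f::nonarch_local_field_char_0"
  assumes "\<And>i. i \<in> I \<Longrightarrow> continuous_on S (f i)"
  shows "continuous_on S (\<lambda>x. \<Sum>i\<in>I. f i x)"
  using assms by (induction I rule: infinite_finite_induct) (auto intro: continuous_on_add_nonarch)

lemma
  fixes A :: "'f::nonarch_local_field_char_0 ^ 'n::finite ^ 'n"
  shows continuous_on_matrix_mult_left: "continuous_on S (\<lambda>Z. A ** Z)"
    and continuous_on_matrix_mult_right: "continuous_on S (\<lambda>Z. Z ** A)"
proof -
  have entry: "continuous_on S (\<lambda>Z :: 'f ^ 'n ^ 'n. Z $ i $ j)" for i j
    by (intro continuous_on_component continuous_on_id)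
  show "continuous_on S (\<lambda>Z. A ** Z)"
    unfolding matrix_matrix_mult_def
    by (intro continuous_on_vec_lambda continuous_on_sum_nonarch continuous_on_mult_left_nonarch entry)
  have "Z $ i $ k * A $ k $ j = A $ k $ j * Z $ i $ k" for Z :: "'f ^ 'n ^ 'n" and i j k
    by (rule mult.commute)
  then show "continuous_on S (\<lambda>Z. Z ** A)"
    unfolding matrix_matrix_mult_def
    by (simp only:)
      (intro continuous_on_vec_lambda continuous_on_sum_nonarch continuous_on_mult_left_nonarch entry)
qed

text \<open>By the ultrametric inequality, every point outside an open ball of radius \<open>r\<close> is the centre of a
  ball of radius \<open>r\<close> that is disjoint from it.\<close>

lemma closed_ball_nonarch:
  fixes a :: "'f::nonarch_local_field_char_0"
  shows "closed (ball a r)"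
  unfolding closed_def open_dist
proof (intro ballI)
  fix y assume "y \<in> - ball a r"
  then have y: "r \<le> dist a y" by simp
  show "\<exists>e>0. \<forall>z. dist z y < e \<longrightarrow> z \<in> - ball a r"
  proof (cases "r > 0")
    case True
    have "z \<in> - ball a r" if "dist z y < r" for z
      using ultrametric[of a y z] y that by (auto simp: dist_commute)
    then show ?thesis using True by blast
  next
    case False
    then show ?thesis
      by (intro exI[of _ 1]) (auto simp: not_less intro: order_trans[of _ 0])
  qed
qed

text \<open>The metric on matrices is Euclidean in the entries, so its balls need not be closed.  The balls
  of the maximum norm are clopen, as finite intersections of preimages of balls in \<open>F\<close>, and the
  Euclidean distance is at most the sum of the distances of the entries.\<close>

lemma clopen_base_matrix:
  fixes A :: "'f::nonarch_local_field_char_0 ^ 'n::finite ^ 'n"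
  assumes "open U" "A \<in> U"
  shows "\<exists>S. open S \<and> closed S \<and> A \<in> S \<and> S \<subseteq> U"
proof -
  obtain e where e: "e > 0" "ball A e \<subseteq> U" using assms by (meson openE)
  let ?n = "real CARD('n)"
  define r where "r = e / (?n * ?n + 1)"
  have pos: "?n * ?n + 1 > 0" by (simp add: add_nonneg_pos)
  have r: "r > 0" using e pos by (simp add: r_def)
  define S where "S = (\<Inter>i\<in>UNIV. \<Inter>j\<in>UNIV. (\<lambda>Z :: 'f ^ 'n ^ 'n. Z $ i $ j) -` ball (A $ i $ j) r)"
  have entry: "isCont (\<lambda>Z :: 'f ^ 'n ^ 'n. Z $ i $ j) Z" for i j Z
    by (intro continuous_intros)
  have "open S" unfolding S_def
    by (intro open_INT finite_UNIV ballI finite continuous_open_vimage open_ball entry)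
  moreover have "closed S" unfolding S_def
    by (intro closed_INT ballI continuous_closed_vimage closed_ball_nonarch entry)
  moreover have "A \<in> S" using r by (simp add: S_def)
  moreover have "S \<subseteq> U"
  proof
    fix Z assume Z: "Z \<in> S"
    have "dist A Z \<le> (\<Sum>i\<in>UNIV. dist (A $ i) (Z $ i))"
      unfolding dist_vec_def by (rule L2_set_le_sum) simp
    also have "\<dots> \<le> (\<Sum>i\<in>UNIV. \<Sum>j\<in>UNIV. dist (A $ i $ j) (Z $ i $ j))"
    proof (rule sum_mono)
      fix i :: 'n
      show "dist (A $ i) (Z $ i) \<le> (\<Sum>j\<in>UNIV. dist (A $ i $ j) (Z $ i $ j))"
        unfolding dist_vec_def[of "A $ i"] by (rule L2_set_le_sum) simp
    qed
    also have "\<dots> \<le> (\<Sum>i\<in>(UNIV :: 'n set). \<Sum>j\<in>(UNIV :: 'n set). r)"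
      using Z by (intro sum_mono) (auto simp: S_def intro: less_imp_le)
    also have "\<dots> = ?n * ?n * r" by simp
    also have "\<dots> < (?n * ?n + 1) * r" using r by (simp add: algebra_simps)
    also have "\<dots> = e" using pos by (simp add: r_def)
    finally show "Z \<in> U" using e(2) by auto
  qed
  ultimately show ?thesis by blast
qed

theorem theoremE:
  fixes \<G> :: "('f::nonarch_local_field_char_0 alg_closure ^ 'n::finite ^ 'n) set"
    and G :: "('f ^ 'n ^ 'n) monoid"
    and \<mu> :: "('f ^ 'n ^ 'n) measure"
    and s :: "complex \<Rightarrow> 'v::ab_group_add \<Rightarrow> 'v"
    and V :: "'v set"
    and \<pi> :: "'f ^ 'n ^ 'n \<Rightarrow> 'v \<Rightarrow> 'v"
    and K :: "('f ^ 'n ^ 'n) set"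
    and \<epsilon> :: real
  assumes "reductive_F_group \<G>"
    and "G = rational_points \<G>"
    and "haar_measure G \<mu>"
    and "(V, \<pi>) \<in> Rep G s"
    and "compact_open_subgroup K G"
    and "0 < \<epsilon>"
    and "ereal \<epsilon> < eps_star G \<mu> s V \<pi>"
  shows "\<exists>C::real. C > 0 \<and>
    (\<forall>(W, \<tau>) \<in> Irr (G\<lparr>carrier := K\<rparr>).
       edim (pointwise_scale s) (Hom_rep (G\<lparr>carrier := K\<rparr>) (pointwise_scale (*)) W \<tau> s V \<pi>)
         < ereal (C * real (vector_space.dim (pointwise_scale (*)) W)
                        powr (1 - 2 * \<epsilon> / (1 + \<epsilon>))))"
proof -
  have "subgroup \<G> GL"
    using assms(1) by (simp add: reductive_F_group_def algebraic_F_group_def)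
  then interpret group G
    unfolding assms(2) by (rule group_rational_points)
  have mult: "x \<otimes>\<^bsub>G\<^esub> y = x ** y" for x y
    by (simp add: assms(2) rational_points_def GL_def)
  interpret smooth_admissible_rep G K \<mu> s V \<pi>
  proof unfold_locales
    show "continuous_on (carrier G) (\<lambda>x. g \<otimes>\<^bsub>G\<^esub> x)" for g
      unfolding mult by (rule continuous_on_matrix_mult_left)
    show "continuous_on (carrier G) (\<lambda>x. x \<otimes>\<^bsub>G\<^esub> g)" for g
      unfolding mult by (rule continuous_on_matrix_mult_right)
    show "\<exists>S. open S \<and> closed S \<and> x \<in> S \<and> S \<subseteq> U" if "open U" "x \<in> U" for x :: "'f ^ 'n ^ 'n" and U
      using that by (rule clopen_base_matrix)
    show "representation G s V \<pi>" "smooth_rep G s V \<pi>" "admissible_rep G s V \<pi>"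
      using assms(4) by (auto simp: Rep_def)
  qed (fact assms(3,5))+
  show ?thesis
    by (rule multiplicity_bound[OF assms(6,7)])
qed

end
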